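(* Fix $p\in(0,1]$ and a probability distribution $\mu$ on $\mathbb{R}$ satisfying conditions (i)-(iv) of the context. For any positive integers $d,n_0,\dots,n_d$ and any unit vector $\vec u\in\mathbb{R}^{n_0}$, $\|\vec u\|_2=1$, let $M^{(d)}$ be the random $n_d\times n_0$ matrix defined in the context and set $$\beta := \left(\frac{3}{p}-1\right)\sum_{i=1}^{d}\frac{1}{n_i}+\frac{\mu_4-3}{p\,n_1}\|\vec u\|_4^4 .$$ Then $\frac{n_0}{n_d}\|M^{(d)}\vec u\|_2^2$ is approximately log-normal, $\frac{n_0}{n_d}\|M^{(d)}\vec u\|_2^2\approx\exp(\mathcal N(-\tfrac12\beta,\beta))$, in the following two senses. (1) (Distribution) $$d_{\mathrm{KS}}\left(\ln\left(\frac{n_0}{n_d}\|M^{(d)}\vec u\|_2^2\right),\ \mathcal N\left(-\tfrac12\beta,\beta\right)\right)=O\left(\sum_{i=1}^{d}\frac{1}{n_i^2}\right)^{1/5},$$ where the implicit constant is uniform for $p$ in a compact subset of $(0,1]$ and $\beta$ in a compact set bounded away from $\beta=0$. (2) (Moments) For every integer $k\ge 0$ satisfying $\binom{k}{2}<\min_{1\le i\le d}n_i$, $$\mathbb{E}\left[\frac{n_0^k}{n_d^k}\|M^{(d)}\vec u\|_2^{2k}\right]=\exp\left[\binom{k}{2}\beta+O\left(\sum_{i=1}^{d}\frac{1}{n_i^2}\right)\right]=\mathbb{E}\left[\left(\exp\left(\mathcal N\left(-\tfrac12\beta,\beta\right)\right)\right)^k\right]+O\left(\beta^{-1}\sum_{i=1}^{d}\frac{1}{n_i^2}\right),$$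 where the implicit constants depend on $k$ and the moments of $\mu$ (with $p$ fixed) but not on $\beta,d,n_i$.
   Context: Conditions on $\mu$: if $W\sim\mu$, then (i) $\mathbb{E}[W]=0$ and $\mathbb{E}[W^2]=1$; (ii) $W$ and $-W$ have the same distribution; (iii) all moments $\mu_k:=\mathbb{E}[W^k]$, $k\in\mathbb{N}$, are finite; (iv) $\mathbb{P}(W=x)=0$ for every $x\in\mathbb{R}$. Model: $M^{(d)}:=X^{(d)}\cdots X^{(1)}$, where $X^{(i)}:=(p\,n_{i-1})^{-1/2}D^{(i)}W^{(i)}$. Here $W^{(i)}$ is an $n_i\times n_{i-1}$ random matrix with i.i.d. entries drawn from $\mu$, and $D^{(i)}=\mathrm{Diag}(\xi^{(i)}_1,\dots,\xi^{(i)}_{n_i})$ with $\xi^{(i)}_j$ i.i.d. Bernoulli$(p)$ ($\{0,1\}$-valued, equal to $1$ with probability $p$); all the matrices $W^{(i)},D^{(i)}$, $1\le i\le d$, are independent. $\mathcal N(m,\sigma^2)$ denotes a Gaussian random variable (or its law) with mean $m$ and variance $\sigma^2$. The Kolmogorov-Smirnov distance is $d_{\mathrm{KS}}(X,Y)=\sup_{t\in\mathbb{R}}|\mathbb{P}(X\le t)-\mathbb{P}(Y\le t)|$; by convention $\ln 0=-\infty$. $O(x)^{1/5}$ denotes a quantity bounded by a constant times $x^{1/5}$. $\|\vec u\|_4^4=\sum_j u_j^4$.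
   Formalization: In the second equality of (2) the implicit constant may also depend on an upper bound b for β (β ≤ b); with a constant independent of β it fails, e.g. for p=1, μ=N(0,1), k=2, n_i=n, d=nL with n large and L→∞. *)

theory Defs
  imports "HOL-Probability.Probability" "Jordan_Normal_Form.Matrix"
begin

text \<open>
  Matrices and vectors are those of \<^theory>\<open>Jordan_Normal_Form.Matrix\<close>, whose dimensions are
  values. The type-indexed vectors of HOL-Analysis are not used, so their notation is removed.
\<close>

no_notation Finite_Cartesian_Product.vec_nth (infixl \<open>$\<close> 90)

definition l2_norm :: "real vec \<Rightarrow> real" where
  "l2_norm v = sqrt (\<Sum>j<dim_vec v. (v $ j)\<^sup>2)"

definition l4_norm_pow4 :: "real vec \<Rightarrow> real" where
  "l4_norm_pow4 v = (\<Sum>j<dim_vec v. (v $ j) ^ 4)"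

definition raw_moment :: "real measure \<Rightarrow> nat \<Rightarrow> real" where
  "raw_moment \<mu> k = (\<integral>x. x ^ k \<partial>\<mu>)"

locale weight_distribution = real_distribution \<mu> for \<mu> :: "real measure" +
  assumes finite_moments: "\<And>k::nat. integrable \<mu> (\<lambda>x. x ^ k)"
    and mean_zero: "raw_moment \<mu> 1 = 0"
    and variance_one: "raw_moment \<mu> 2 = 1"
    and symmetric: "distr \<mu> borel uminus = \<mu>"
    and no_atoms: "\<And>x. measure \<mu> {x} = 0"

text \<open>
  The layers are \<open>i = 1, \<dots>, d\<close>; inside a layer, rows and columns are counted from \<open>0\<close>.
  \<open>W i j k\<close> is the entry of \<open>W\<^sup>(\<^sup>i\<^sup>)\<close> in row \<open>j < n i\<close> and column \<open>k < n (i - 1)\<close>,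
  and \<open>\<xi> i j\<close> is the \<open>j\<close>-th diagonal entry of \<open>D\<^sup>(\<^sup>i\<^sup>)\<close>. All these variables form one mutually
  independent family, indexed by a disjoint sum.
\<close>

locale random_layers = prob_space M for M :: "'a measure" +
  fixes \<mu> :: "real measure" and p :: real and d :: nat and n :: "nat \<Rightarrow> nat"
    and W :: "nat \<Rightarrow> nat \<Rightarrow> nat \<Rightarrow> 'a \<Rightarrow> real" and \<xi> :: "nat \<Rightarrow> nat \<Rightarrow> 'a \<Rightarrow> real"
  assumes d_pos: "0 < d"
    and n_pos: "\<And>i. i \<le> d \<Longrightarrow> 0 < n i"
    and W_distr: "\<And>i j k. i \<in> {1..d} \<Longrightarrow> j < n i \<Longrightarrow> k < n (i - 1) \<Longrightarrow> distr M borel (W i j k) = \<mu>"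
    and \<xi>_distr: "\<And>i j. i \<in> {1..d} \<Longrightarrow> j < n i \<Longrightarrow>
      distr M borel (\<xi> i j) = distr (measure_pmf (bernoulli_pmf p)) borel of_bool"
    and indep: "indep_vars (\<lambda>_. borel)
      (case_sum (\<lambda>(i, j, k). W i j k) (\<lambda>(i, j). \<xi> i j))
      ((SIGMA i:{1..d}. {..<n i} \<times> {..<n (i - 1)}) <+> (SIGMA i:{1..d}. {..<n i}))"

definition layer_matrix ::
  "real \<Rightarrow> (nat \<Rightarrow> nat) \<Rightarrow> (nat \<Rightarrow> nat \<Rightarrow> nat \<Rightarrow> 'a \<Rightarrow> real) \<Rightarrow> (nat \<Rightarrow> nat \<Rightarrow> 'a \<Rightarrow> real) \<Rightarrow> nat \<Rightarrow> 'a \<Rightarrow> real mat"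
  where
  "layer_matrix p n W \<xi> i \<omega> =
     ((p * real (n (i - 1))) powr (- 1 / 2)) \<cdot>\<^sub>m
       (mat_diag (n i) (\<lambda>j. \<xi> i j \<omega>) * Matrix.mat (n i) (n (i - 1)) (\<lambda>(j, k). W i j k \<omega>))"

fun matrix_product ::
  "real \<Rightarrow> (nat \<Rightarrow> nat) \<Rightarrow> (nat \<Rightarrow> nat \<Rightarrow> nat \<Rightarrow> 'a \<Rightarrow> real) \<Rightarrow> (nat \<Rightarrow> nat \<Rightarrow> 'a \<Rightarrow> real) \<Rightarrow> nat \<Rightarrow> 'a \<Rightarrow> real mat"
  where
  "matrix_product p n W \<xi> 0 \<omega> = 1\<^sub>m (n 0)"
| "matrix_product p n W \<xi> (Suc i) \<omega> = layer_matrix p n W \<xi> (Suc i) \<omega> * matrix_product p n W \<xi> i \<omega>"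

definition beta_param :: "real measure \<Rightarrow> real \<Rightarrow> nat \<Rightarrow> (nat \<Rightarrow> nat) \<Rightarrow> real vec \<Rightarrow> real" where
  "beta_param \<mu> p d n u =
     (3 / p - 1) * (\<Sum>i=1..d. 1 / real (n i)) + (raw_moment \<mu> 4 - 3) / (p * real (n 1)) * l4_norm_pow4 u"

definition inv_sq_sum :: "nat \<Rightarrow> (nat \<Rightarrow> nat) \<Rightarrow> real" where
  "inv_sq_sum d n = (\<Sum>i=1..d. 1 / (real (n i))\<^sup>2)"

text \<open>
  The second argument is the variance, which has to be positive. This is always so for
  \<^const>\<open>beta_param\<close>: its value is at least \<open>(1 / p - 1) / n\<^sub>1\<close>, and equality would need \<open>d = 1\<close>
  and \<open>\<mu>\<^sub>4 = 1\<close>, that is \<open>W\<^sup>2 = 1\<close> almost surely, which the absence of atoms excludes.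
\<close>

definition gaussian :: "real \<Rightarrow> real \<Rightarrow> real measure" where
  "gaussian m v = density lborel (normal_density m (sqrt v))"

text \<open>The logarithm with \<open>ln 0 = -\<infinity>\<close>; the library's \<^term>\<open>ln (0::real)\<close> is \<open>0\<close>.\<close>

definition ext_ln :: "real \<Rightarrow> ereal" where
  "ext_ln x = (if x \<le> 0 then - \<infinity> else ereal (ln x))"

text \<open>
  Laws on the extended line, compared at real thresholds only, since \<open>ext_ln\<close> may take the
  value \<open>-\<infinity>\<close>.
\<close>

definition ks_dist :: "ereal measure \<Rightarrow> ereal measure \<Rightarrow> real" where
  "ks_dist \<nu> \<nu>' = (SUP t::real. \<bar>measure \<nu> {..ereal t} - measure \<nu>' {..ereal t}\<bar>)"

definition scaled_sq_norm ::
  "real \<Rightarrow> nat \<Rightarrow> (nat \<Rightarrow> nat) \<Rightarrow> (nat \<Rightarrow> nat \<Rightarrow> nat \<Rightarrow> 'a \<Rightarrow> real) \<Rightarrow> (nat \<Rightarrow> nat \<Rightarrow> 'a \<Rightarrow> real) \<Rightarrow> real vec \<Rightarrow> 'a \<Rightarrow> real"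
  where
  "scaled_sq_norm p d n W \<xi> u \<omega> =
     real (n 0) / real (n d) * (l2_norm (matrix_product p n W \<xi> d \<omega> *\<^sub>v u))\<^sup>2"

end

theory Submission
  imports Defs
begin

text \<open>
  Write \<open>u\<^sub>i\<close> for the image of \<open>u\<close> after \<open>i\<close> layers. The normalised squared norm \<open>Z\<^sub>i = (n\<^sub>0 / n\<^sub>i) |u\<^sub>i|\<^sup>2\<close>
  is a product of gains \<open>Q\<^sub>l\<close>, where \<open>Q\<^sub>l\<close> depends on the fresh weights of layer \<open>l + 1\<close> and on the
  direction of \<open>u\<^sub>l\<close> only. Given the past, \<open>Q\<^sub>l\<close> is an average of \<open>n\<^sub>l\<^sub>+\<^sub>1\<close> independent variables with mean
  \<open>1\<close>, so \<open>\<delta> = Q\<^sub>l - 1\<close> has mean \<open>0\<close>, an explicit variance which involves the direction through its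
  fourth-power sum, and moments of order \<open>\<ge> 3\<close> of size \<open>O(1 / n\<^sub>l\<^sub>+\<^sub>1\<^sup>2)\<close>. The fourth-power sum of a
  direction produced by a layer of width \<open>n\<close> is \<open>O(1 / n)\<close> on average, so that only the first layer sees
  the shape of \<open>u\<close>.

  For real powers, \<open>E[Z\<^sub>i\<^sup>k]\<close> is multiplied at each layer by \<open>1 + (k choose 2) \<sigma>\<^sup>2\<close> up to second order, and the
  logarithms of these factors add up to \<open>(k choose 2) \<beta>\<close>. For the distribution the same computation is done
  with the imaginary power \<open>k = \<i>t\<close>: the characteristic function of \<open>ln Z\<^sub>d\<close> differs from that of the normal
  law by \<open>O(|t| + t\<^sup>4)\<close> times \<open>S\<close>, the sum of the \<open>1 / n\<^sub>i\<^sup>2\<close>. Convolving both laws with a normal law of standard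
  deviation \<open>h\<close>, Levy's inversion formula bounds the distance of the smoothed distribution functions by
  \<open>O(S / h\<^sup>4)\<close>, removing the smoothing costs \<open>O(h)\<close>, and \<open>h = S\<^sup>1\<^sup>/\<^sup>5\<close> balances the two.
\<close>


section \<open>Independence and moments of independent sums\<close>

text \<open>For \<open>p < 1\<close> a whole layer is switched off with positive probability, so a
  gain \<open>Q\<close> can be 0 and has neither a logarithm nor negative moments. Three devices
  cope with this. The logarithm is truncated to |\<delta>| \<le> 1/2, and fourth moments show that
  the truncation matters with probability O(S) only. A dead state gets an arbitrary unit heading, so
  the conditional moments hold without exception. The fourth-power sum of a new heading is a
  quotient by \<open>Q ^ 2\<close>; it is estimated only after multiplication by
  \<open>Q ^ 2\<close>, or where \<open>Q\<close> is at least 1/2.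

  Orders r \<ge> 3 all yield 1/n^2 because a centred sum of n independent terms has r-th moment
  O(n^(r div 2)), and r - r div 2 is then at least 2. Constants do not grow with d: for imaginary
  powers the layer factors have modulus at most 1, for real powers the logarithms of relative errors
  are added. The headings leave mixed terms 1/(n_i n_(i+1)), which sum to at most S by the
  inequality of arithmetic and geometric means. The bound |t| + t^4 vanishes at t = 0, which cancels
  the pole of Levy's formula, and its degree produces the power h^(-4).\<close>

lemma (in prob_space) indep_var_freeze:
  fixes g :: "'s \<Rightarrow> 'c::{banach, second_countable_topology}" and q :: "'s \<times> 's \<Rightarrow> real"
  assumes indep: "indep_var S P T Y"
    and g [measurable]: "g \<in> borel_measurable S"
    and q [measurable]: "q \<in> borel_measurable (S \<Otimes>\<^sub>M T)"
    and int_g: "integrable M (\<lambda>\<omega>. g (P \<omega>))"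
    and int_q: "\<And>x. x \<in> space S \<Longrightarrow> integrable M (\<lambda>\<omega>. q (x, Y \<omega>))"
    and bound: "\<And>x. x \<in> space S \<Longrightarrow> (\<integral>\<omega>. \<bar>q (x, Y \<omega>)\<bar> \<partial>M) \<le> C"
  shows integrable_indep_var_freeze: "integrable M (\<lambda>\<omega>. q (P \<omega>, Y \<omega>) *\<^sub>R g (P \<omega>))"
    and integral_indep_var_freeze: "(\<integral>\<omega>. q (P \<omega>, Y \<omega>) *\<^sub>R g (P \<omega>) \<partial>M) =
      (\<integral>\<omega>. (\<integral>\<omega>'. q (P \<omega>, Y \<omega>') \<partial>M) *\<^sub>R g (P \<omega>) \<partial>M)"
proof -
  have P [measurable]: "P \<in> measurable M S" and Y [measurable]: "Y \<in> measurable M T"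
    using indep by (auto dest: indep_var_rv1 indep_var_rv2)
  interpret D: prob_space "distr M S P" by (rule prob_space_distr) fact
  interpret E: prob_space "distr M T Y" by (rule prob_space_distr) fact
  interpret DE: pair_sigma_finite "distr M S P" "distr M T Y" ..
  have eq: "distr M S P \<Otimes>\<^sub>M distr M T Y = distr M (S \<Otimes>\<^sub>M T) (\<lambda>\<omega>. (P \<omega>, Y \<omega>))"
    using indep by (simp add: indep_var_distribution_eq)
  let ?h = "\<lambda>z. q z *\<^sub>R g (fst z)"
  have inner: "(\<integral>y. q (x, y) \<partial>distr M T Y) = (\<integral>\<omega>'. q (x, Y \<omega>') \<partial>M)" if "x \<in> space S" for x
    using that by (subst integral_distr) auto
  have innern: "(\<integral>y. norm (?h (x, y)) \<partial>distr M T Y) = (\<integral>\<omega>'. \<bar>q (x, Y \<omega>')\<bar> \<partial>M) * norm (g x)"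
    if "x \<in> space S" for x
    using that by (subst integral_distr) auto
  have meas1: "(\<lambda>x. \<integral>y. norm (?h (x, y)) \<partial>distr M T Y) \<in> borel_measurable (distr M S P)"
    by (rule E.borel_measurable_lebesgue_integral) simp
  have int_h: "integrable (distr M S P \<Otimes>\<^sub>M distr M T Y) ?h"
  proof (rule DE.Fubini_integrable)
    show "?h \<in> borel_measurable (distr M S P \<Otimes>\<^sub>M distr M T Y)" by measurable
    have intg: "integrable (distr M S P) g"
      using int_g by (subst integrable_distr_eq) auto
    show "integrable (distr M S P) (\<lambda>x. \<integral>y. norm (?h (x, y)) \<partial>distr M T Y)"
    proof (rule Bochner_Integration.integrable_bound)
      show "integrable (distr M S P) (\<lambda>x. C *\<^sub>R g x)" using intg by simp
      show "AE x in distr M S P. norm (\<integral>y. norm (?h (x, y)) \<partial>distr M T Y) \<le> norm (C *\<^sub>R g x)"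
      proof (rule AE_I2)
        fix x assume "x \<in> space (distr M S P)"
        then have x: "x \<in> space S" by simp
        have "(\<integral>\<omega>'. \<bar>q (x, Y \<omega>')\<bar> \<partial>M) * norm (g x) \<le> \<bar>C\<bar> * norm (g x)"
          using bound[OF x] by (intro mult_right_mono) auto
        moreover have "0 \<le> (\<integral>\<omega>'. \<bar>q (x, Y \<omega>')\<bar> \<partial>M)" by simp
        ultimately show "norm (\<integral>y. norm (?h (x, y)) \<partial>distr M T Y) \<le> norm (C *\<^sub>R g x)"
          unfolding innern[OF x] by simp
      qed
    qed (rule meas1)
    show "AE x in distr M S P. integrable (distr M T Y) (\<lambda>y. ?h (x, y))"
      using int_q by (intro AE_I2) (auto simp: integrable_distr_eq)
  qed
  show "integrable M (\<lambda>\<omega>. q (P \<omega>, Y \<omega>) *\<^sub>R g (P \<omega>))"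
    using int_h unfolding eq by (subst (asm) integrable_distr_eq) auto
  have "(\<integral>\<omega>. q (P \<omega>, Y \<omega>) *\<^sub>R g (P \<omega>) \<partial>M) = (\<integral>z. ?h z \<partial>(distr M S P \<Otimes>\<^sub>M distr M T Y))"
    unfolding eq by (subst integral_distr) auto
  also have "\<dots> = (\<integral>x. (\<integral>y. ?h (x, y) \<partial>distr M T Y) \<partial>distr M S P)"
    by (rule DE.integral_fst'[symmetric]) (rule int_h)
  also have "\<dots> = (\<integral>x. (\<integral>y. q (x, y) \<partial>distr M T Y) *\<^sub>R g x \<partial>distr M S P)"
    using int_q by (intro Bochner_Integration.integral_cong) (auto simp: integrable_distr_eq)
  also have "\<dots> = (\<integral>\<omega>. (\<integral>y. q (P \<omega>, y) \<partial>distr M T Y) *\<^sub>R g (P \<omega>) \<partial>M)"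
    by (subst integral_distr) auto
  also have "\<dots> = (\<integral>\<omega>. (\<integral>\<omega>'. q (P \<omega>, Y \<omega>') \<partial>M) *\<^sub>R g (P \<omega>) \<partial>M)"
    using inner measurable_space[OF P] by (intro Bochner_Integration.integral_cong) auto
  finally show "(\<integral>\<omega>. q (P \<omega>, Y \<omega>) *\<^sub>R g (P \<omega>) \<partial>M) =
      (\<integral>\<omega>. (\<integral>\<omega>'. q (P \<omega>, Y \<omega>') \<partial>M) *\<^sub>R g (P \<omega>) \<partial>M)" .
qed

section \<open>Moments of sums of independent variables by the binomial recursion in the number of
  summands\<close>

locale indep_moments = prob_space M for M :: "'a measure" +
  fixes X :: "nat \<Rightarrow> 'a \<Rightarrow> real" and N :: nat
  assumes indep: "indep_vars (\<lambda>_. borel) X {..<N}"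
    and int_pow: "\<And>j r. j < N \<Longrightarrow> integrable M (\<lambda>\<omega>. X j \<omega> ^ r)"
begin

lemma shrink: "l \<le> N \<Longrightarrow> indep_moments M X l"
  using indep int_pow by unfold_locales (auto intro: indep_vars_subset)

lemma indep_powers:
  assumes "l < N"
  shows "indep_var borel (\<lambda>\<omega>. X l \<omega> ^ a) borel (\<lambda>\<omega>. (\<Sum>j<l. X j \<omega>) ^ b)"
proof -
  have "indep_vars (\<lambda>_. borel) X (insert l {..<l})"
    by (rule indep_vars_subset[OF indep]) (use assms in auto)
  then have "indep_var borel (X l) borel (\<lambda>\<omega>. \<Sum>j<l. X j \<omega>)"
    by (intro indep_vars_sum) auto
  from indep_var_compose[OF this, of "\<lambda>x. x ^ a" borel "\<lambda>x. x ^ b" borel]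
  show ?thesis by (simp add: comp_def)
qed

lemma sum_power_Suc:
  "(\<Sum>j<Suc l. X j \<omega>) ^ r = (\<Sum>k\<le>r. real (r choose k) * (X l \<omega> ^ k * (\<Sum>j<l. X j \<omega>) ^ (r - k)))"
  by (simp add: add.commute binomial_ring mult.assoc)

lemma integrable_sum_power: "l \<le> N \<Longrightarrow> integrable M (\<lambda>\<omega>. (\<Sum>j<l. X j \<omega>) ^ r)"
proof (induction l arbitrary: r)
  case (Suc l)
  have "integrable M (\<lambda>\<omega>. X l \<omega> ^ k * (\<Sum>j<l. X j \<omega>) ^ (r - k))" for k
    using Suc by (intro indep_var_integrable indep_powers int_pow) auto
  then show ?case unfolding sum_power_Suc by simp
qed simp

lemma integral_sum_power_Suc:
  assumes "l < N"
  shows "(\<integral>\<omega>. (\<Sum>j<Suc l. X j \<omega>) ^ r \<partial>M) =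
    (\<Sum>k\<le>r. real (r choose k) * (\<integral>\<omega>. X l \<omega> ^ k \<partial>M) * (\<integral>\<omega>. (\<Sum>j<l. X j \<omega>) ^ (r - k) \<partial>M))"
proof -
  note I = indep_powers[OF assms] int_pow[OF assms] integrable_sum_power[OF less_imp_le[OF assms]]
  have "integrable M (\<lambda>\<omega>. X l \<omega> ^ k * (\<Sum>j<l. X j \<omega>) ^ (r - k))" for k
    by (intro indep_var_integrable I)
  then show ?thesis
    unfolding sum_power_Suc by (simp add: indep_var_lebesgue_integral[OF I] mult.assoc)
qed

end

locale centred_indep_moments = indep_moments +
  assumes centred: "\<And>j. j < N \<Longrightarrow> (\<integral>\<omega>. X j \<omega> \<partial>M) = 0"
begin

lemma shrink_centred: "l \<le> N \<Longrightarrow> centred_indep_moments M X l"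
  using shrink[of l] centred unfolding centred_indep_moments_def centred_indep_moments_axioms_def by auto

lemma integral_sum: "l \<le> N \<Longrightarrow> (\<integral>\<omega>. (\<Sum>j<l. X j \<omega>) \<partial>M) = 0"
  using int_pow[of _ 1] centred by simp

lemma integral_sum_sq:
  "l \<le> N \<Longrightarrow> (\<integral>\<omega>. (\<Sum>j<l. X j \<omega>)\<^sup>2 \<partial>M) = (\<Sum>j<l. \<integral>\<omega>. (X j \<omega>)\<^sup>2 \<partial>M)"
proof (induction l)
  case (Suc l)
  then have l: "l < N" "l \<le> N" by auto
  have *: "{..2::nat} = {0,1,2}" by auto
  show ?case
    unfolding integral_sum_power_Suc[OF l(1)] * using centred[OF l(1)] integral_sum[OF l(2)] Suc.IH[OF l(2)]
    by (simp add: prob_space)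
qed simp

text \<open>Fourth cumulants of independent centred variables add up: the last sum is the cumulant
  of the total, and the fourth moment exceeds it by three times the squared variance.\<close>

lemma integral_sum_pow4:
  "l \<le> N \<Longrightarrow> (\<integral>\<omega>. (\<Sum>j<l. X j \<omega>) ^ 4 \<partial>M) =
    3 * (\<Sum>j<l. \<integral>\<omega>. (X j \<omega>)\<^sup>2 \<partial>M)\<^sup>2 + (\<Sum>j<l. (\<integral>\<omega>. X j \<omega> ^ 4 \<partial>M) - 3 * (\<integral>\<omega>. (X j \<omega>)\<^sup>2 \<partial>M)\<^sup>2)"
proof (induction l)
  case (Suc l)
  have l: "l < N" "l \<le> N" using Suc.prems by auto
  define A where "A = (\<Sum>j<l. \<integral>\<omega>. (X j \<omega>)\<^sup>2 \<partial>M)"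
  define F where "F = (\<Sum>j<l. (\<integral>\<omega>. X j \<omega> ^ 4 \<partial>M) - 3 * (\<integral>\<omega>. (X j \<omega>)\<^sup>2 \<partial>M)\<^sup>2)"
  have *: "{..4::nat} = {0,1,2,3,4}" by auto
  have c: "(4::nat) choose 2 = 6" "(4::nat) choose 3 = 4" by (simp_all add: eval_nat_numeral)
  have "(\<integral>\<omega>. (\<Sum>j<Suc l. X j \<omega>) ^ 4 \<partial>M) = (\<integral>\<omega>. (\<Sum>j<l. X j \<omega>) ^ 4 \<partial>M)
     + 6 * (\<integral>\<omega>. (X l \<omega>)\<^sup>2 \<partial>M) * (\<integral>\<omega>. (\<Sum>j<l. X j \<omega>)\<^sup>2 \<partial>M) + (\<integral>\<omega>. X l \<omega> ^ 4 \<partial>M)"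
    unfolding integral_sum_power_Suc[OF l(1)] * using centred[OF l(1)] integral_sum[OF l(2)]
    by (simp add: prob_space c)
  also have "\<dots> = 3 * A\<^sup>2 + F + 6 * (\<integral>\<omega>. (X l \<omega>)\<^sup>2 \<partial>M) * A + (\<integral>\<omega>. X l \<omega> ^ 4 \<partial>M)"
    unfolding A_def F_def using Suc.IH[OF l(2)] integral_sum_sq[OF l(2)] by simp
  also have "\<dots> = 3 * (A + (\<integral>\<omega>. (X l \<omega>)\<^sup>2 \<partial>M))\<^sup>2
      + (F + ((\<integral>\<omega>. X l \<omega> ^ 4 \<partial>M) - 3 * (\<integral>\<omega>. (X l \<omega>)\<^sup>2 \<partial>M)\<^sup>2))"
    by (simp add: power2_sum algebra_simps)
  finally show ?case by (simp add: A_def F_def)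
qed simp

end

text \<open>In the recursion for the \<open>r\<close>-th moment the term \<open>k = 1\<close>
  vanishes by centring and \<open>k = 0\<close> reproduces the previous moment. Every other term is
  at most a constant times \<open>w l * s ^ (r div 2 - 1)\<close>, and such increments add up to the
  power \<open>r div 2\<close> of the total weight. The weights let one statement serve two levels:
  squared coordinates of a unit vector inside a row, with total 1, and weight 1 for each row of a
  layer, with total \<open>n i\<close>.\<close>

lemma centred_sum_moment_bound:
  fixes B :: real
  assumes "0 \<le> B"
  shows "\<exists>C\<ge>0. \<forall>(M :: 'a measure) X N w. centred_indep_moments M X N \<longrightarrow>
    (\<forall>j<N. 0 \<le> w j \<and> (\<forall>r\<in>{2..K}. \<bar>\<integral>\<omega>. X j \<omega> ^ r \<partial>M\<bar> \<le> B * w j)) \<longrightarrow>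
    (\<forall>r\<le>K. \<bar>\<integral>\<omega>. (\<Sum>j<N. X j \<omega>) ^ r \<partial>M\<bar> \<le> C * (1 + (\<Sum>j<N. w j)) ^ (r div 2))"
proof (induction K)
  case 0
  show ?case
    by (intro exI[of _ 1]) (auto simp: centred_indep_moments_def indep_moments_def prob_space.prob_space)
next
  case (Suc K)
  then obtain C where C: "0 \<le> C" and IH: "\<And>(M :: 'a measure) X N w r. centred_indep_moments M X N \<Longrightarrow>
    (\<And>j r. j < N \<Longrightarrow> 0 \<le> w j) \<Longrightarrow> 
    (\<And>j r. j < N \<Longrightarrow> r \<in> {2..K} \<Longrightarrow> \<bar>\<integral>\<omega>. X j \<omega> ^ r \<partial>M\<bar> \<le> B * w j) \<Longrightarrow> r \<le> K \<Longrightarrow>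
    \<bar>\<integral>\<omega>. (\<Sum>j<N. X j \<omega>) ^ r \<partial>M\<bar> \<le> C * (1 + (\<Sum>j<N. w j)) ^ (r div 2)"
    by meson
  define D where "D = (\<Sum>k\<in>{2..Suc K}. real (Suc K choose k) * B * C)"
  have D: "0 \<le> D" unfolding D_def using assms C by (intro sum_nonneg) auto
  show ?case
  proof (intro exI[of _ "C + D"] conjI allI impI)
    show "0 \<le> C + D" using C D by simp
    fix M :: "'a measure" and X N w r
    assume X: "centred_indep_moments M X N"
      and w: "\<forall>j<N. 0 \<le> w j \<and> (\<forall>r\<in>{2..Suc K}. \<bar>\<integral>\<omega>. X j \<omega> ^ r \<partial>M\<bar> \<le> B * w j)"
      and r: "r \<le> Suc K"
    interpret centred_indep_moments M X N by (rule X)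
    have pre: "\<bar>\<integral>\<omega>. (\<Sum>j<l. X j \<omega>) ^ r \<partial>M\<bar> \<le> C * (1 + (\<Sum>j<l. w j)) ^ (r div 2)" if "l \<le> N" "r \<le> K" for l r
      by (rule IH) (use w that shrink_centred in auto)
    show "\<bar>\<integral>\<omega>. (\<Sum>j<N. X j \<omega>) ^ r \<partial>M\<bar> \<le> (C + D) * (1 + (\<Sum>j<N. w j)) ^ (r div 2)"
    proof (cases "r \<le> K")
      case True
      have "0 \<le> (\<Sum>j<N. w j)" using w by (intro sum_nonneg) auto
      then have "C * (1 + (\<Sum>j<N. w j)) ^ (r div 2) \<le> (C + D) * (1 + (\<Sum>j<N. w j)) ^ (r div 2)"
        using D by (intro mult_right_mono) auto
      with pre[of N r] True show ?thesis by simp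
    next
      case False
      then have r: "r = Suc K" using r by simp
      define q where "q = r div 2"
      have "l \<le> N \<Longrightarrow> \<bar>\<integral>\<omega>. (\<Sum>j<l. X j \<omega>) ^ r \<partial>M\<bar> \<le> (C + D) * (1 + (\<Sum>j<l. w j)) ^ q" for l
      proof (induction l)
        case 0
        then show ?case using C D r by simp
      next
        case (Suc l)
        then have l: "l < N" by simp
        define s where "s = 1 + (\<Sum>j<l. w j)"
        have wl: "0 \<le> w l" using w l by auto
        have "0 \<le> (\<Sum>j<l. w j)" using w l by (intro sum_nonneg) auto
        then have s: "1 \<le> s" by (simp add: s_def)
        let ?f = "\<lambda>k. real (r choose k) * (\<integral>\<omega>. X l \<omega> ^ k \<partial>M) * (\<integral>\<omega>. (\<Sum>j<l. X j \<omega>) ^ (r - k) \<partial>M)"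
        have "{..r} = {0,1} \<union> {2..r}" using r by auto
        then have "(\<Sum>k\<le>r. ?f k) = (\<Sum>k\<in>{0,1}. ?f k) + (\<Sum>k\<in>{2..r}. ?f k)"
          by (simp only:) (rule sum.union_disjoint, auto)
        also have "(\<Sum>k\<in>{0,1}. ?f k) = (\<integral>\<omega>. (\<Sum>j<l. X j \<omega>) ^ r \<partial>M)"
          using centred[OF l] by (simp add: prob_space)
        finally have eq: "(\<integral>\<omega>. (\<Sum>j<Suc l. X j \<omega>) ^ r \<partial>M) = (\<integral>\<omega>. (\<Sum>j<l. X j \<omega>) ^ r \<partial>M) + (\<Sum>k\<in>{2..r}. ?f k)"
          using integral_sum_power_Suc[OF l, of r] by simp
        have fk: "\<bar>?f k\<bar> \<le> (real (r choose k) * B * C) * (w l * s ^ (q - 1))" if k: "k \<in> {2..r}" for k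
        proof -
          have 1: "\<bar>\<integral>\<omega>. X l \<omega> ^ k \<partial>M\<bar> \<le> B * w l" using w l k r by auto
          have "\<bar>\<integral>\<omega>. (\<Sum>j<l. X j \<omega>) ^ (r - k) \<partial>M\<bar> \<le> C * s ^ ((r - k) div 2)"
            unfolding s_def using l k r by (intro pre) auto
          \<comment> \<open>Removing \<open>k \<ge> 2\<close> of the \<open>r\<close> factors lowers
            \<open>r div 2\<close> by at least one, and \<open>1 \<le> s\<close> allows the exponent
            to be raised to exactly \<open>q - 1\<close>.\<close>
          also have "\<dots> \<le> C * s ^ (q - 1)"
            using C s k by (intro mult_left_mono power_increasing) (auto simp: q_def)
          finally have 2: "\<bar>\<integral>\<omega>. (\<Sum>j<l. X j \<omega>) ^ (r - k) \<partial>M\<bar> \<le> C * s ^ (q - 1)" .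
          have "\<bar>?f k\<bar> = real (r choose k) * (\<bar>\<integral>\<omega>. X l \<omega> ^ k \<partial>M\<bar> * \<bar>\<integral>\<omega>. (\<Sum>j<l. X j \<omega>) ^ (r - k) \<partial>M\<bar>)"
            by (simp add: abs_mult)
          also have "\<dots> \<le> real (r choose k) * ((B * w l) * (C * s ^ (q - 1)))"
            using 1 2 assms wl by (intro mult_left_mono mult_mono) auto
          finally show ?thesis by (simp add: mult_ac)
        qed
        have "\<bar>\<Sum>k\<in>{2..r}. ?f k\<bar> \<le> (\<Sum>k\<in>{2..r}. (real (r choose k) * B * C) * (w l * s ^ (q - 1)))"
          by (rule order_trans[OF sum_abs]) (rule sum_mono, rule fk)
        also have "\<dots> = D * (w l * s ^ (q - 1))"
          unfolding D_def r sum_distrib_right ..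
        finally have inc: "\<bar>\<Sum>k\<in>{2..r}. ?f k\<bar> \<le> D * (w l * s ^ (q - 1))" .
        show ?case
        \<comment> \<open>Here \<open>q = 0\<close> means \<open>r = 1\<close>: the subtraction
          \<open>q - 1\<close> would truncate, but the sum over \<open>{2..r}\<close> is
          empty.\<close>
        proof (cases "q = 0")
          case True
          then have "{2..r} = {}" by (auto simp: q_def)
          then show ?thesis using eq Suc True by simp
        next
          case False
          then have q: "x ^ q = x * x ^ (q - 1)" for x :: real by (cases q) auto
          have "\<bar>\<integral>\<omega>. (\<Sum>j<Suc l. X j \<omega>) ^ r \<partial>M\<bar> \<le> (C + D) * s ^ q + D * (w l * s ^ (q - 1))"
            using eq inc Suc unfolding s_def by simp
          also have "\<dots> \<le> (C + D) * s ^ q + (C + D) * (w l * s ^ (q - 1))"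
            using C wl s by (intro add_left_mono mult_right_mono) auto
          also have "\<dots> = (C + D) * ((s + w l) * s ^ (q - 1))"
            unfolding q[of s] by (simp add: algebra_simps)
          also have "\<dots> \<le> (C + D) * ((s + w l) * (s + w l) ^ (q - 1))"
            using C D wl s by (intro mult_left_mono power_mono) auto
          finally show ?thesis unfolding q[of "1 + _"] by (simp add: s_def add.assoc)
        qed
      qed
      then show ?thesis by (simp add: q_def)
    qed
  qed
qed

section \<open>Gaussian smoothing of distribution functions\<close>

definition gauss_smooth :: "real \<Rightarrow> real measure \<Rightarrow> real measure" where
  "gauss_smooth h P = distr (P \<Otimes>\<^sub>M std_normal_distribution) borel (\<lambda>(x, z). x + h * z)"

context real_distribution
begin

interpretation N: real_distribution std_normal_distribution
  by (rule real_dist_normal_dist)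

interpretation MN: pair_prob_space M std_normal_distribution ..

lemma measurable_gauss_shift: "(\<lambda>(x, z). x + h * z) \<in> borel_measurable (M \<Otimes>\<^sub>M std_normal_distribution)"
proof -
  have "(\<lambda>z. fst z + h * snd z) \<in> borel_measurable (borel \<Otimes>\<^sub>M borel)" by measurable
  moreover have "sets (M \<Otimes>\<^sub>M std_normal_distribution) = sets (borel \<Otimes>\<^sub>M borel)"
    by (intro sets_pair_measure_cong) auto
  ultimately show ?thesis by (simp add: split_beta' cong: measurable_cong_sets)
qed

lemma real_distribution_gauss_smooth: "real_distribution (gauss_smooth h M)"
  unfolding gauss_smooth_def by (intro MN.real_distribution_distr measurable_gauss_shift)

lemma integral_gauss_smooth:
  fixes f :: "real \<Rightarrow> 'b::{banach, second_countable_topology}"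
  assumes f [measurable]: "f \<in> borel_measurable borel" and bound: "\<And>x. norm (f x) \<le> 1"
  shows "(\<integral>x. f x \<partial>gauss_smooth h M) = (\<integral>x. (\<integral>z. f (x + h * z) \<partial>std_normal_distribution) \<partial>M)"
    and "(\<integral>x. f x \<partial>gauss_smooth h M) = (\<integral>z. (\<integral>x. f (x + h * z) \<partial>M) \<partial>std_normal_distribution)"
proof -
  let ?f = "\<lambda>z. f (fst z + h * snd z)"
  have m: "(\<lambda>z. fst z + h * snd z) \<in> borel_measurable (M \<Otimes>\<^sub>M std_normal_distribution)"
    using measurable_gauss_shift[of h] by (simp add: split_beta')
  have "?f \<in> borel_measurable (M \<Otimes>\<^sub>M std_normal_distribution)"
    by (rule measurable_compose[OF m f])
  then have int: "integrable (M \<Otimes>\<^sub>M std_normal_distribution) ?f"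
    using bound by (intro MN.P.integrable_const_bound[of _ 1] AE_I2) auto
  have eq: "(\<integral>x. f x \<partial>gauss_smooth h M) = (\<integral>z. ?f z \<partial>(M \<Otimes>\<^sub>M std_normal_distribution))"
    unfolding gauss_smooth_def
    by (subst integral_distr[OF measurable_gauss_shift]) (auto simp: split_beta')
  show "(\<integral>x. f x \<partial>gauss_smooth h M) = (\<integral>x. (\<integral>z. f (x + h * z) \<partial>std_normal_distribution) \<partial>M)"
    unfolding eq using MN.integral_fst'[OF int] by simp
  show "(\<integral>x. f x \<partial>gauss_smooth h M) = (\<integral>z. (\<integral>x. f (x + h * z) \<partial>M) \<partial>std_normal_distribution)"
    unfolding eq using MN.integral_snd[of "\<lambda>x z. ?f (x, z)"] int by (simp add: split_beta')
qed

lemma char_gauss_smooth: "char (gauss_smooth h M) t = char M t * exp (- (h * t)\<^sup>2 / 2)"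
proof -
  have "char (gauss_smooth h M) t = (\<integral>x. (\<integral>z. iexp (t * (x + h * z)) \<partial>std_normal_distribution) \<partial>M)"
    unfolding char_def by (rule integral_gauss_smooth) auto
  also have "\<dots> = (\<integral>x. iexp (t * x) * char std_normal_distribution (h * t) \<partial>M)"
  proof (intro Bochner_Integration.integral_cong refl)
    fix x
    have "(\<integral>z. iexp (t * (x + h * z)) \<partial>std_normal_distribution) =
        (\<integral>z. iexp (t * x) * iexp (h * t * z) \<partial>std_normal_distribution)"
      by (intro Bochner_Integration.integral_cong) (auto simp: exp_add[symmetric] algebra_simps)
    then show "(\<integral>z. iexp (t * (x + h * z)) \<partial>std_normal_distribution) = iexp (t * x) * char std_normal_distribution (h * t)"
      by (simp add: char_def)
  qed
  also have "\<dots> = char M t * exp (- (h * t)\<^sup>2 / 2)"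
    by (simp add: char_def char_std_normal_distribution)
  finally show ?thesis .
qed

lemma cdf_gauss_smooth:
  "cdf (gauss_smooth h M) y = (\<integral>z. cdf M (y - h * z) \<partial>std_normal_distribution)"
proof -
  interpret S: real_distribution "gauss_smooth h M" by (rule real_distribution_gauss_smooth)
  have "cdf (gauss_smooth h M) y = (\<integral>x. indicator {..y} x \<partial>gauss_smooth h M)"
    by (simp add: cdf_def)
  also have "\<dots> = (\<integral>z. (\<integral>x. indicator {..y} (x + h * z) \<partial>M) \<partial>std_normal_distribution)"
    by (rule integral_gauss_smooth) (auto split: split_indicator)
  also have "\<dots> = (\<integral>z. cdf M (y - h * z) \<partial>std_normal_distribution)"
  proof (intro Bochner_Integration.integral_cong refl)
    fix z
    have "(\<integral>x. indicator {..y} (x + h * z) \<partial>M) = (\<integral>x. indicat_real {..y - h * z} x \<partial>M)"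
      by (intro Bochner_Integration.integral_cong) (auto split: split_indicator)
    then show "(\<integral>x. indicator {..y} (x + h * z) \<partial>M) = cdf M (y - h * z)" by (simp add: cdf_def)
  qed
  finally show ?thesis .
qed

lemma gauss_smooth_no_atom:
  assumes "0 < h"
  shows "measure (gauss_smooth h M) {a} = 0"
proof -
  interpret S: real_distribution "gauss_smooth h M" by (rule real_distribution_gauss_smooth)
  have "measure (gauss_smooth h M) {a} = (\<integral>x. indicator {a} x \<partial>gauss_smooth h M)" by simp
  also have "\<dots> = (\<integral>x. (\<integral>z. indicator {a} (x + h * z) \<partial>std_normal_distribution) \<partial>M)"
    by (rule integral_gauss_smooth) (auto split: split_indicator)
  also have "\<dots> = (\<integral>x. 0 \<partial>M)"
  proof (intro Bochner_Integration.integral_cong refl)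
    fix x
    have "(\<integral>z. indicator {a} (x + h * z) \<partial>std_normal_distribution) =
        (\<integral>z. indicator {(a - x) / h} z \<partial>std_normal_distribution)"
      using assms by (intro Bochner_Integration.integral_cong) (auto split: split_indicator simp: field_simps)
    also have "\<dots> = (0 :: real)"
      by (subst integral_density) (auto intro!: integral_eq_zero_AE AE_I[of _ _ "{(a - x) / h}"] split: split_indicator_asm)
    finally show "(\<integral>z. indicator {a} (x + h * z) \<partial>std_normal_distribution) = (0 :: real)" .
  qed
  finally show ?thesis by simp
qed

end

section \<open>Levy inversion for the smoothed laws, and removal of the smoothing\<close>

lemma integrable_poly_gauss:
  "integrable lborel (\<lambda>s::real. (1 + \<bar>s\<bar> ^ 3) * exp (- s\<^sup>2 / 2))"
proof -
  have "integrable lborel (\<lambda>s::real. sqrt (2 * pi) * (std_normal_density s * \<bar>s\<bar> ^ 0 + std_normal_density s * \<bar>s\<bar> ^ 3))"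
    by (intro integrable_mult_right Bochner_Integration.integrable_add integrable_std_normal_moment_abs)
  also have "(\<lambda>s::real. sqrt (2 * pi) * (std_normal_density s * \<bar>s\<bar> ^ 0 + std_normal_density s * \<bar>s\<bar> ^ 3)) =
      (\<lambda>s. (1 + \<bar>s\<bar> ^ 3) * exp (- s\<^sup>2 / 2))"
    by (intro ext) (simp add: std_normal_density_def field_simps)
  finally show ?thesis .
qed

text \<open>The substitution \<open>s = h * t\<close> costs one factor \<open>1 / h\<close>; the
  comparison \<open>h ^ 3 * (1 + \<bar>t\<bar> ^ 3) \<le> 1 + \<bar>h * t\<bar> ^ 3\<close>, valid
  for \<open>h \<le> 1\<close>, costs three more.\<close>

lemma poly_gauss_scaled:
  fixes h :: real
  assumes h: "0 < h" "h \<le> 1"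
  shows "integrable lborel (\<lambda>t. (1 + \<bar>t\<bar> ^ 3) * exp (- (h * t)\<^sup>2 / 2))" (is ?A)
    and "(\<integral>t. (1 + \<bar>t\<bar> ^ 3) * exp (- (h * t)\<^sup>2 / 2) \<partial>lborel) \<le>
      (\<integral>s. (1 + \<bar>s\<bar> ^ 3) * exp (- s\<^sup>2 / 2) \<partial>lborel) / h ^ 4" (is ?B)
proof -
  let ?k = "\<lambda>s::real. (1 + \<bar>s\<bar> ^ 3) * exp (- s\<^sup>2 / 2)"
  have int: "integrable lborel (\<lambda>t. ?k (0 + h * t))"
    by (rule lborel_integrable_real_affine[OF integrable_poly_gauss]) (use h in simp)
  have eq: "(\<integral>s. ?k s \<partial>lborel) = h * (\<integral>t. ?k (0 + h * t) \<partial>lborel)"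
    using lborel_integral_real_affine[of h ?k 0] h by simp
  have le: "(1 + \<bar>t\<bar> ^ 3) * exp (- (h * t)\<^sup>2 / 2) \<le> ?k (0 + h * t) / h ^ 3" for t
  proof -
    have "h ^ 3 \<le> 1" using h by (simp add: power_le_one)
    then have "h ^ 3 * (1 + \<bar>t\<bar> ^ 3) \<le> 1 + \<bar>h * t\<bar> ^ 3"
      using h by (simp add: abs_mult power_mult_distrib algebra_simps)
    then have "1 + \<bar>t\<bar> ^ 3 \<le> (1 + \<bar>h * t\<bar> ^ 3) / h ^ 3"
      using h by (simp add: field_simps)
    then show ?thesis
      by (drule_tac c="exp (- (h * t)\<^sup>2 / 2)" in mult_right_mono) auto
  qed
  show A: ?A
    by (rule Bochner_Integration.integrable_bound[OF integrable_divide[OF int, of "h ^ 3"]])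
       (use le h in \<open>auto intro!: AE_I2 simp: abs_mult\<close>)
  have "(\<integral>t. (1 + \<bar>t\<bar> ^ 3) * exp (- (h * t)\<^sup>2 / 2) \<partial>lborel) \<le> (\<integral>t. ?k (0 + h * t) / h ^ 3 \<partial>lborel)"
    by (rule integral_mono[OF A integrable_divide[OF int]]) (use le in auto)
  also have "\<dots> = (\<integral>s. ?k s \<partial>lborel) / h ^ 4"
    unfolding eq using h by (simp add: field_simps eval_nat_numeral)
  finally show ?B .
qed

definition poly_gauss_const :: real where
  "poly_gauss_const = (\<integral>s. (1 + \<bar>s\<bar> ^ 3) * exp (- s\<^sup>2 / 2) \<partial>lborel)"

lemma poly_gauss_const_nonneg: "0 \<le> poly_gauss_const"
  unfolding poly_gauss_const_def by simp

text \<open>Levy's formula divides by \<open>t\<close>. The factor \<open>\<bar>t\<bar>\<close> in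
  \<open>close\<close> cancels this pole, and the Gaussian factor in the characteristic functions of
  the smoothed laws makes the remaining cubic polynomial integrable. The estimate is uniform over
  the interval \<open>{a<..b}\<close>, so \<open>a\<close> can be sent to minus infinity.\<close>

lemma smoothed_cdf_close:
  fixes \<epsilon> h :: real
  assumes P: "real_distribution P" and G: "real_distribution G"
    and close: "\<And>t. cmod (char P t - char G t) \<le> \<epsilon> * (\<bar>t\<bar> + t ^ 4)"
    and h: "0 < h" "h \<le> 1" and \<epsilon>: "0 \<le> \<epsilon>"
  shows "\<bar>cdf (gauss_smooth h P) y - cdf (gauss_smooth h G) y\<bar> \<le> poly_gauss_const * \<epsilon> / h ^ 4"
proof -
  let ?P = "gauss_smooth h P" and ?G = "gauss_smooth h G"
  interpret P: real_distribution ?P by (rule real_distribution.real_distribution_gauss_smooth[OF P])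
  interpret G: real_distribution ?G by (rule real_distribution.real_distribution_gauss_smooth[OF G])
  define \<eta> where "\<eta> = poly_gauss_const * \<epsilon> / h ^ 4"
  define K where "K t = (1 + \<bar>t\<bar> ^ 3) * exp (- (h * t)\<^sup>2 / 2)" for t
  have K: "integrable lborel K" "(\<integral>t. K t \<partial>lborel) \<le> poly_gauss_const / h ^ 4"
    using poly_gauss_scaled[OF h] by (simp_all add: K_def[abs_def] poly_gauss_const_def)
  have K0: "0 \<le> K t" for t by (simp add: K_def)
  have char_diff: "cmod (char ?P t - char ?G t) \<le> \<epsilon> * \<bar>t\<bar> * K t" for t
  proof -
    have "char ?P t - char ?G t = (char P t - char G t) * of_real (exp (- (h * t)\<^sup>2 / 2))"
      by (simp add: real_distribution.char_gauss_smooth[OF P] real_distribution.char_gauss_smooth[OF G] algebra_simps)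
    then have "cmod (char ?P t - char ?G t) = cmod (char P t - char G t) * exp (- (h * t)\<^sup>2 / 2)"
      by (simp add: norm_mult)
    also have "\<dots> \<le> (\<epsilon> * (\<bar>t\<bar> + t ^ 4)) * exp (- (h * t)\<^sup>2 / 2)"
      using close by (intro mult_right_mono) auto
    also have "t ^ 4 = \<bar>t\<bar> * \<bar>t\<bar> ^ 3" by (simp flip: power_Suc)
    finally show ?thesis by (simp add: K_def algebra_simps)
  qed
  have Ioc: "\<bar>measure ?P {a<..b} - measure ?G {a<..b}\<bar> \<le> \<eta>" if ab: "a \<le> b" for a b
  proof -
    \<comment> \<open>At \<open>t = 0\<close> the convention for division makes this 0 instead of
      the limit \<open>b - a\<close>; both bounds on \<open>F\<close> still hold there.\<close>
    define F where "F t = (iexp (-(t * a)) - iexp (-(t * b))) / (\<i> * complex_of_real t)" for t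
    have [measurable]: "F \<in> borel_measurable borel" unfolding F_def by measurable
    have F1: "cmod (F t) \<le> b - a" for t
    proof (cases "t = 0")
      case False
      then show ?thesis using Levy_Inversion_aux2[of "- b" "- a" t] ab by (simp add: F_def)
    qed (use ab in \<open>simp add: F_def\<close>)
    \<comment> \<open>The bound 2 is free of \<open>a\<close> and \<open>b\<close>, unlike
      \<open>F1\<close>, which serves for integrability only.\<close>
    have F2: "cmod (F t) * \<bar>t\<bar> \<le> 2" for t
    proof (cases "t = 0")
      case False
      have "cmod (iexp (-(t * a)) - iexp (-(t * b))) \<le> 1 + 1"
        by (rule order_trans[OF norm_triangle_ineq4]) simp
      with False show ?thesis by (simp add: F_def norm_divide norm_mult)
    qed (simp add: F_def)
    have lim: "(\<lambda>T::nat. 1 / (2 * pi) * (CLBINT t=-T..T. F t * char ?P t)) \<longlonglongrightarrow> measure ?P {a<..b}"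
      "(\<lambda>T::nat. 1 / (2 * pi) * (CLBINT t=-T..T. F t * char ?G t)) \<longlonglongrightarrow> measure ?G {a<..b}"
      unfolding F_def
      by (intro P.Levy_Inversion G.Levy_Inversion ab real_distribution.gauss_smooth_no_atom[OF P h(1)]
          real_distribution.gauss_smooth_no_atom[OF G h(1)])+
    have bnd: "cmod (1 / (2 * pi) * (CLBINT t=-T..T. F t * char ?P t) -
        1 / (2 * pi) * (CLBINT t=-T..T. F t * char ?G t)) \<le> \<eta>" for T :: nat
    proof -
      have int: "complex_interval_lebesgue_integrable lborel (ereal (-real T)) (ereal (real T)) (\<lambda>t. F t * char R t)"
        if "real_distribution R" for R
      proof -
        have [measurable]: "char R \<in> borel_measurable borel" by (rule real_distribution.char_measurable[OF that])
        have "cmod (F t * char R t) \<le> b - a" for t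
          using F1[of t] real_distribution.cmod_char_le_1[OF that, of t] ab
            mult_mono[of "cmod (F t)" "b - a" "cmod (char R t)" 1]
          by (simp add: norm_mult)
        then show ?thesis
          unfolding interval_lebesgue_integrable_def set_integrable_def
          by (auto intro!: integrableI_bounded_set_indicator[where B="b - a"] AE_I2)
      qed
      note intP = int[OF P.real_distribution_axioms] and intG = int[OF G.real_distribution_axioms]
      have dle: "cmod (F t * char ?P t - F t * char ?G t) \<le> 2 * \<epsilon> * K t" for t
      proof -
        have "cmod (F t * char ?P t - F t * char ?G t) = cmod (F t) * cmod (char ?P t - char ?G t)"
          by (simp add: norm_mult right_diff_distrib[symmetric])
        also have "\<dots> \<le> cmod (F t) * (\<epsilon> * \<bar>t\<bar> * K t)"
          by (intro mult_left_mono char_diff) simp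
        also have "\<dots> = (cmod (F t) * \<bar>t\<bar>) * (\<epsilon> * K t)" by simp
        also have "\<dots> \<le> 2 * (\<epsilon> * K t)"
          using F2[of t] \<epsilon> K0[of t] by (intro mult_right_mono) auto
        finally show ?thesis by simp
      qed
      have "(CLBINT t=-T..T. F t * char ?P t) - (CLBINT t=-T..T. F t * char ?G t) =
          (CLBINT t=-T..T. F t * char ?P t - F t * char ?G t)"
        using interval_lebesgue_integral_diff(2)[OF intP intG] by simp
      also have "\<dots> = (CLBINT t. indicator {-real T<..<real T} t *\<^sub>R (F t * char ?P t - F t * char ?G t))"
        by (simp add: interval_lebesgue_integral_le_eq set_lebesgue_integral_def)
      finally have "cmod ((CLBINT t=-T..T. F t * char ?P t) - (CLBINT t=-T..T. F t * char ?G t)) =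
        cmod (CLBINT t. indicator {-real T<..<real T} t *\<^sub>R (F t * char ?P t - F t * char ?G t))" by simp
      also have "\<dots> \<le> (LBINT t. 2 * \<epsilon> * K t)"
        by (rule Bochner_Integration.integral_norm_bound_integral)
          (use interval_lebesgue_integral_diff(1)[OF intP intG] K(1) dle K0 \<epsilon> in
            \<open>auto simp: interval_lebesgue_integrable_def set_integrable_def split: split_indicator\<close>)
      also have "\<dots> \<le> 2 * \<epsilon> * (poly_gauss_const / h ^ 4)"
        using mult_left_mono[OF K(2), of "2 * \<epsilon>"] \<epsilon> by simp
      finally have 1: "cmod ((CLBINT t=-T..T. F t * char ?P t) - (CLBINT t=-T..T. F t * char ?G t)) \<le> 2 * \<eta>"
        by (simp add: \<eta>_def mult_ac)
      have \<eta>0: "0 \<le> \<eta>" using \<epsilon> h poly_gauss_const_nonneg by (simp add: \<eta>_def)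
      have "cmod (1 / (2 * pi) * (CLBINT t=-T..T. F t * char ?P t) -
        1 / (2 * pi) * (CLBINT t=-T..T. F t * char ?G t)) =
        1 / (2 * pi) * cmod ((CLBINT t=-T..T. F t * char ?P t) - (CLBINT t=-T..T. F t * char ?G t))"
        by (simp add: norm_mult norm_divide flip: right_diff_distrib diff_divide_distrib)
      also have "\<dots> \<le> 1 / (2 * pi) * (2 * \<eta>)" by (intro mult_left_mono 1) simp
      also have "\<dots> = \<eta> / pi" by simp
      also have "\<dots> \<le> \<eta>" using \<eta>0 pi_gt3 by (simp add: divide_le_eq mult_le_cancel_left1)
      finally show ?thesis .
    qed
    have "cmod (complex_of_real (measure ?P {a<..b}) - complex_of_real (measure ?G {a<..b})) \<le> \<eta>"
      by (rule Lim_norm_ubound[OF _ tendsto_diff[OF lim]]) (use bnd in auto)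
    then show ?thesis by (simp flip: of_real_diff)
  qed
  have ev: "eventually (\<lambda>i::nat. \<bar>(cdf ?P y - cdf ?P (- real i)) - (cdf ?G y - cdf ?G (- real i))\<bar> \<le> \<eta>) sequentially"
  proof -
    obtain i0 :: nat where i0: "- y < real i0" using reals_Archimedean2 by blast
    have "\<bar>(cdf ?P y - cdf ?P (- real i)) - (cdf ?G y - cdf ?G (- real i))\<bar> \<le> \<eta>" if "i0 \<le> i" for i
    proof -
      have "- real i < y" using i0 that by linarith
      then show ?thesis using Ioc[of "- real i" y] by (simp add: P.cdf_diff_eq G.cdf_diff_eq)
    qed
    then show ?thesis unfolding eventually_sequentially by auto
  qed
  have "(\<lambda>i::nat. \<bar>(cdf ?P y - cdf ?P (- real i)) - (cdf ?G y - cdf ?G (- real i))\<bar>) \<longlonglongrightarrow>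
      \<bar>(cdf ?P y - 0) - (cdf ?G y - 0)\<bar>"
    by (intro tendsto_intros P.cdf_lim_neg_infty G.cdf_lim_neg_infty)
  from tendsto_upperbound[OF this ev] show ?thesis by (simp add: \<eta>_def)
qed

text \<open>Let \<open>\<delta>\<close> be the supremum of \<open>\<bar>D\<bar>\<close>. Where
  \<open>D\<close> is large, monotonicity of \<open>cdf P\<close> and the Lipschitz bound for
  \<open>cdf G\<close> keep it large, with the same sign, on a window of length \<open>4 * h\<close>
  to one side. The average of \<open>D\<close> under the normal kernel centred in this window is at
  most \<open>\<eta>\<close>, while outside the window \<open>D\<close> is controlled only by
  \<open>\<delta>\<close>. The kernel has so little mass there that \<open>\<delta>\<close> comes
  back with the factor 1/3 and can be absorbed.\<close>

lemma kolmogorov_smoothing: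
  fixes \<epsilon> h m :: real
  assumes P: "real_distribution P" and G: "real_distribution G"
    and close: "\<And>t. cmod (char P t - char G t) \<le> \<epsilon> * (\<bar>t\<bar> + t ^ 4)"
    and lip: "\<And>x y. x \<le> y \<Longrightarrow> cdf G y - cdf G x \<le> m * (y - x)"
    and h: "0 < h" "h \<le> 1" and \<epsilon>: "0 \<le> \<epsilon>" and m: "0 \<le> m"
  shows "\<bar>cdf P x - cdf G x\<bar> \<le> 2 * poly_gauss_const * \<epsilon> / h ^ 4 + 6 * m * h"
proof -
  interpret P: real_distribution P by (rule P)
  interpret G: real_distribution G by (rule G)
  interpret N: real_distribution std_normal_distribution by (rule real_dist_normal_dist)
  define \<eta> where "\<eta> = poly_gauss_const * \<epsilon> / h ^ 4"
  define D where "D x = cdf P x - cdf G x" for x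
  define \<delta> where "\<delta> = (SUP x. \<bar>D x\<bar>)"
  have D1: "\<bar>D x\<bar> \<le> 1" for x
    using P.cdf_nonneg[of x] P.cdf_bounded_prob[of x] G.cdf_nonneg[of x] G.cdf_bounded_prob[of x]
    unfolding D_def by linarith
  have bdd: "bdd_above (range (\<lambda>x. \<bar>D x\<bar>))" using D1 by (intro bdd_aboveI2)
  have D\<delta>: "\<bar>D x\<bar> \<le> \<delta>" for x unfolding \<delta>_def by (rule cSUP_upper[OF _ bdd]) simp
  have \<delta>0: "0 \<le> \<delta>" using D\<delta>[of 0] by linarith
  have mono_P: "cdf P x \<le> cdf P y" and mono_G: "cdf G x \<le> cdf G y" if "x \<le> y" for x y
    using that by (auto intro: P.cdf_nondecreasing G.cdf_nondecreasing)
  have [measurable]: "cdf P \<in> borel_measurable borel" "cdf G \<in> borel_measurable borel"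
    by (auto intro!: borel_measurable_mono monoI mono_P mono_G)
  have [measurable]: "D \<in> borel_measurable borel" unfolding D_def by measurable
  have intc: "integrable std_normal_distribution (\<lambda>z. cdf R (y - h * z))" if "real_distribution R"
    and [measurable]: "cdf R \<in> borel_measurable borel" for R y
  proof -
    interpret R: real_distribution R by fact
    show ?thesis
      by (intro N.integrable_const_bound[of _ 1] AE_I2) (auto simp: R.cdf_nonneg R.cdf_bounded_prob)
  qed
  have intD: "integrable std_normal_distribution (\<lambda>z. D (y - h * z))" for y
    unfolding D_def using intc[OF P] intc[OF G] by simp
  have smD: "\<bar>\<integral>z. D (y - h * z) \<partial>std_normal_distribution\<bar> \<le> \<eta>" for y
  proof -
    have "(\<integral>z. D (y - h * z) \<partial>std_normal_distribution) = cdf (gauss_smooth h P) y - cdf (gauss_smooth h G) y"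
      unfolding D_def P.cdf_gauss_smooth G.cdf_gauss_smooth using intc[OF P] intc[OF G] by simp
    then show ?thesis using smoothed_cdf_close[OF P G close h \<epsilon>, of y] by (simp add: \<eta>_def)
  qed
  have sq: "integrable std_normal_distribution (\<lambda>z. z\<^sup>2)" "(\<integral>z. z\<^sup>2 \<partial>std_normal_distribution) = 1"
    using std_normal_distribution_even_moments[of 1] by simp_all
  have key: "s * D x \<le> 4 * m * h + 4 / 3 * \<eta> + \<delta> / 3" if s: "s = 1 \<or> s = -1" for s x
  proof (cases "s * D x - 4 * m * h \<le> 0")
    case True
    have "0 \<le> \<eta>" using \<epsilon> h poly_gauss_const_nonneg by (simp add: \<eta>_def)
    then show ?thesis using True \<delta>0 by simp
  next
    case False
    \<comment> \<open>Centre of the window: right of \<open>x\<close> for an excess of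
      \<open>cdf P\<close>, which can only have grown there, and left of \<open>x\<close> for a
      deficit.\<close>
    define y where "y = x + s * (2 * h)"
    define A where "A = s * D x - 4 * m * h"
    have A: "0 < A" using False by (simp add: A_def)
    \<comment> \<open>Near \<open>y\<close> the difference stays large by the Lipschitz bound; the parabola does the work of
      Chebyshev's inequality for the tail of the smoothing kernel.\<close>
    have pt: "A - (A + \<delta>) / 4 * z\<^sup>2 \<le> s * D (y - h * z)" for z
    proof (cases "\<bar>z\<bar> \<le> 2")
      case True
      have hz: "\<bar>h * z\<bar> \<le> 2 * h" using mult_left_mono[OF True, of h] h by (simp add: abs_mult)
      have "A \<le> s * D (y - h * z)"
      proof (cases "s = 1")
        case True
        then have 1: "x \<le> y - h * z" "y - h * z - x \<le> 4 * h" using hz by (auto simp: y_def)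
        have "m * (y - h * z - x) \<le> m * (4 * h)" using 1 m by (intro mult_left_mono)
        then show ?thesis using mono_P[OF 1(1)] lip[OF 1(1)] True unfolding A_def D_def by simp
      next
        case False
        then have s: "s = -1" using s by simp
        then have 1: "y - h * z \<le> x" "x - (y - h * z) \<le> 4 * h" using hz by (auto simp: y_def)
        have "m * (x - (y - h * z)) \<le> m * (4 * h)" using 1 m by (intro mult_left_mono)
        then show ?thesis using mono_P[OF 1(1)] lip[OF 1(1)] s unfolding A_def D_def by simp
      qed
      moreover have "0 \<le> (A + \<delta>) / 4 * z\<^sup>2" using A \<delta>0 by simp
      ultimately show ?thesis by linarith
    next
      case False
      then have "2 * 2 \<le> \<bar>z\<bar> * \<bar>z\<bar>" by (intro mult_mono) auto
      then have "4 \<le> z\<^sup>2" by (simp add: power2_eq_square)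
      then have "(A + \<delta>) / 4 * 4 \<le> (A + \<delta>) / 4 * z\<^sup>2" using A \<delta>0 by (intro mult_left_mono) auto
      then have "A - (A + \<delta>) / 4 * z\<^sup>2 \<le> - \<delta>" by simp
      also have "- \<delta> \<le> s * D (y - h * z)" using D\<delta>[of "y - h * z"] s by auto
      finally show ?thesis .
    qed
    have "(\<integral>z. A - (A + \<delta>) / 4 * z\<^sup>2 \<partial>std_normal_distribution) \<le> (\<integral>z. s * D (y - h * z) \<partial>std_normal_distribution)"
      by (rule integral_mono) (use pt intD sq in auto)
    also have "(\<integral>z. A - (A + \<delta>) / 4 * z\<^sup>2 \<partial>std_normal_distribution) = A - (A + \<delta>) / 4"
      using sq N.prob_space by (subst Bochner_Integration.integral_diff) auto
    also have "(\<integral>z. s * D (y - h * z) \<partial>std_normal_distribution) \<le> \<eta>"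
      using smD[of y] s by auto
    \<comment> \<open>Solves \<open>A - (A + \<delta>) / 4 \<le> \<eta>\<close> for
      \<open>A\<close>; the left side is the integral of the parabola, the kernel having second
      moment 1.\<close>
    finally have "A \<le> 4 / 3 * \<eta> + \<delta> / 3" by (simp add: field_simps)
    then show ?thesis unfolding A_def by linarith
  qed
  have "\<bar>D x\<bar> \<le> 4 * m * h + 4 / 3 * \<eta> + \<delta> / 3" for x
    using key[of 1 x] key[of "-1" x] by (auto simp: abs_if)
  then have "\<delta> \<le> 4 * m * h + 4 / 3 * \<eta> + \<delta> / 3"
    unfolding \<delta>_def[symmetric] by (subst (1) \<delta>_def) (rule cSUP_least, auto)
  then have "\<delta> \<le> 6 * m * h + 2 * \<eta>" by simp
  then show ?thesis using D\<delta>[of x] by (simp add: D_def \<eta>_def)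
qed

section \<open>Elementary estimates\<close>

text \<open>On the left half-plane \<open>exp\<close> has modulus at most 1, so Taylor's remainder
  carries no exponential factor. In the application \<open>z\<close> has real part
  \<open>- v * t ^ 2 / 2\<close>.\<close>

lemma cmod_exp_linear_approx:
  assumes "Re z \<le> 0"
  shows "cmod (exp z - (1 + z)) \<le> (cmod z)\<^sup>2"
proof -
  have "cmod (exp z - (\<Sum>i\<le>1. exp 0 * (z - 0) ^ i / fact i)) \<le> 1 * cmod (z - 0) ^ Suc 1 / fact 1"
  proof (rule field_Taylor[where f="\<lambda>_. exp" and S="{z. Re z \<le> 0}" and n=1])
    show "convex {z. Re z \<le> 0}" by (rule convex_halfspace_Re_le)
    show "(exp has_field_derivative exp x) (at x within {z. Re z \<le> 0})" for x :: complex
      by (auto intro!: derivative_eq_intros)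
  qed (use assms in auto)
  then show ?thesis by (simp add: power2_eq_square)
qed

text \<open>Truncated so that a Taylor bound of order \<open>\<delta>\<^sup>4\<close> holds for all \<open>\<delta>\<close>, including \<open>\<delta> = - 1\<close>, where the
  gain vanishes.\<close>

definition trunc_ln :: "real \<Rightarrow> real" where
  "trunc_ln r = (if \<bar>r - 1\<bar> \<le> 1 / 2 then ln r else 0)"

lemma borel_measurable_trunc_ln [measurable]: "trunc_ln \<in> borel_measurable borel"
  unfolding trunc_ln_def by measurable

text \<open>Taylor expansion of \<open>(1 + z) powr (\<i> * t)\<close>, with \<open>a k\<close> the
  falling factorials of \<open>\<i> * t\<close>. All \<open>a k\<close> with
  \<open>k \<ge> 1\<close> contain the factor \<open>t\<close>, which is what makes the error vanish
  at \<open>t = 0\<close>. The fourth derivative is at most 108 * 16 times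
  \<open>\<bar>t\<bar> + t ^ 4\<close>, and division by 3! leaves 288.\<close>

lemma iexp_ln_taylor:
  fixes t \<delta> :: real
  defines "a \<equiv> \<lambda>k::nat. \<Prod>j<k. (\<i> * t - of_nat j)"
  assumes \<delta>: "\<bar>\<delta>\<bar> \<le> 1 / 2"
  shows "cmod (iexp (t * ln (1 + \<delta>)) - (\<Sum>k\<le>3. a k * \<delta> ^ k / fact k)) \<le> 300 * (\<bar>t\<bar> + t ^ 4) * \<delta> ^ 4"
proof -
  \<comment> \<open>Only the real segment is used: there the base \<open>1 + z\<close> is positive
    and its imaginary power has modulus 1. On a complex disc the argument of \<open>1 + z\<close>
    would bring in growth exponential in \<open>t\<close>.\<close>
  define S where "S = complex_of_real ` {-1/2..1/2}"
  define f where "f k z = a k * (1 + z) powr (\<i> * t - of_nat k)" for k :: nat and z :: complex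
  have a4: "cmod (a 4) \<le> 108 * (\<bar>t\<bar> + t ^ 4)"
  proof -
    have 1: "cmod (\<i> * t - of_nat j) \<le> \<bar>t\<bar> + 3" if "j \<le> 3" for j
      by (rule order_trans[OF norm_triangle_ineq4]) (use that in \<open>simp add: norm_mult\<close>)
    have "a 4 = (\<i> * t) * ((\<i> * t - of_nat 1) * (\<i> * t - of_nat 2) * (\<i> * t - of_nat 3))"
      by (simp add: a_def eval_nat_numeral)
    then have "cmod (a 4) = \<bar>t\<bar> * (cmod (\<i> * t - of_nat 1) * cmod (\<i> * t - of_nat 2) * cmod (\<i> * t - of_nat 3))"
      by (simp only: norm_mult norm_of_real norm_ii)
    also have "\<dots> \<le> \<bar>t\<bar> * ((\<bar>t\<bar> + 3) * (\<bar>t\<bar> + 3) * (\<bar>t\<bar> + 3))"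
      by (intro mult_left_mono mult_mono 1) auto
    also have "\<dots> \<le> \<bar>t\<bar> * (4 * (\<bar>t\<bar> ^ 3 + 27))"
    proof (rule mult_left_mono)
      have "0 \<le> 3 * ((\<bar>t\<bar> + 3) * (\<bar>t\<bar> - 3)\<^sup>2)" by simp
      also have "\<dots> = 4 * (\<bar>t\<bar> ^ 3 + 27) - (\<bar>t\<bar> + 3) * (\<bar>t\<bar> + 3) * (\<bar>t\<bar> + 3)"
        by (simp add: power2_eq_square power3_eq_cube algebra_simps)
      finally show "(\<bar>t\<bar> + 3) * (\<bar>t\<bar> + 3) * (\<bar>t\<bar> + 3) \<le> 4 * (\<bar>t\<bar> ^ 3 + 27)" by simp
    qed simp
    also have "\<dots> = 4 * (\<bar>t\<bar> * \<bar>t\<bar> ^ 3) + 108 * \<bar>t\<bar>" by (simp add: algebra_simps)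
    also have "\<bar>t\<bar> * \<bar>t\<bar> ^ 3 = t ^ 4" by (simp flip: power_Suc)
    also have "4 * t ^ 4 + 108 * \<bar>t\<bar> \<le> 108 * (\<bar>t\<bar> + t ^ 4)" by simp
    finally show ?thesis .
  qed
  have "cmod (f 0 (of_real \<delta>) - (\<Sum>k\<le>3. f k 0 * (of_real \<delta> - 0) ^ k / fact k))
      \<le> (108 * (\<bar>t\<bar> + t ^ 4) * 16) * cmod (of_real \<delta> - 0) ^ Suc 3 / fact 3"
  proof (rule field_Taylor[where S = S and f = f])
    show "convex S" unfolding S_def by (intro convex_linear_image bounded_linear.linear bounded_linear_of_real) simp
    show "0 \<in> S" by (auto simp: S_def image_iff)
    show "complex_of_real \<delta> \<in> S"
      unfolding S_def by (rule imageI) (use abs_le_D1[OF \<delta>] minus_le_iff[THEN iffD1, OF abs_le_D2[OF \<delta>]] in simp)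
  next
    fix k z assume "z \<in> S"
    then obtain x where x: "z = of_real x" "-1/2 \<le> x" "x \<le> 1/2" by (auto simp: S_def)
    then have "Re (1 + z) > 0" by simp
    then have nz: "1 + z \<notin> \<real>\<^sub>\<le>\<^sub>0" using complex_nonpos_Reals_iff by auto
    have "((\<lambda>w. w powr (\<i> * t - of_nat k)) has_field_derivative
        ((\<i> * t - of_nat k) * (1 + z) powr (\<i> * t - of_nat k - 1))) (at (1 + z))"
      by (rule has_field_derivative_powr[OF nz])
    moreover have "((\<lambda>w. 1 + w) has_field_derivative 1) (at z)" by (auto intro!: derivative_eq_intros)
    ultimately have "((\<lambda>w. (1 + w) powr (\<i> * t - of_nat k)) has_field_derivative
        ((\<i> * t - of_nat k) * (1 + z) powr (\<i> * t - of_nat k - 1)) * 1) (at z)"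
      by (rule DERIV_chain2[where f = "\<lambda>w. w powr (\<i> * t - of_nat k)" and g = "\<lambda>w. 1 + w"])
    from has_field_derivative_at_within[OF DERIV_cmult[OF this, of "a k"], of S]
    have "(f k has_field_derivative
        a k * ((\<i> * t - of_nat k) * (1 + z) powr (\<i> * t - of_nat k - 1) * 1)) (at z within S)"
      unfolding f_def .
    moreover have "a k * ((\<i> * t - of_nat k) * (1 + z) powr (\<i> * t - of_nat k - 1) * 1) = f (Suc k) z"
    proof -
      have "\<i> * t - of_nat k - 1 = \<i> * t - of_nat (Suc k)" by simp
      then show ?thesis by (simp only: f_def a_def prod.lessThan_Suc mult.assoc mult_1_right)
    qed
    ultimately show "(f k has_field_derivative f (Suc k) z) (at z within S)" by (simp only:)
  next
    fix z assume "z \<in> S"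
    then obtain x where x: "z = of_real x" "-1/2 \<le> x" "x \<le> 1/2" by (auto simp: S_def)
    have "cmod ((1 + z) powr (\<i> * t - of_nat 4)) = (1 + x) powr (- 4)"
      using x by (subst norm_powr_real_powr) auto
    also have "\<dots> \<le> (1 / 2) powr (- 4)" using x by (intro powr_mono2') auto
    also have "\<dots> = 16" by (simp add: powr_minus powr_numeral field_simps)
    finally have "cmod (f 4 z) \<le> (108 * (\<bar>t\<bar> + t ^ 4)) * 16"
      unfolding f_def norm_mult by (intro mult_mono a4) auto
    then show "cmod (f (Suc 3) z) \<le> 108 * (\<bar>t\<bar> + t ^ 4) * 16" by simp
  qed
  moreover have "f 0 (of_real \<delta>) = iexp (t * ln (1 + \<delta>))"
  proof -
    have "Ln (1 + complex_of_real \<delta>) = ln (1 + \<delta>)"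
      using \<delta> Ln_of_real[of "1 + \<delta>"] by simp
    moreover have "1 + complex_of_real \<delta> \<noteq> 0"
    proof
      assume "1 + complex_of_real \<delta> = 0"
      then have "complex_of_real (1 + \<delta>) = 0" by simp
      then have "1 + \<delta> = 0" by (simp only: of_real_eq_0_iff)
      then show False using \<delta> by simp
    qed
    ultimately show ?thesis by (simp add: f_def a_def powr_def algebra_simps)
  qed
  moreover have "f k 0 = a k" for k by (simp add: f_def)
  ultimately have *: "cmod (iexp (t * ln (1 + \<delta>)) - (\<Sum>k\<le>3. a k * \<delta> ^ k / fact k))
      \<le> (108 * (\<bar>t\<bar> + t ^ 4) * 16) * \<bar>\<delta>\<bar> ^ 4 / fact 3" by simp
  also have "\<dots> = 288 * ((\<bar>t\<bar> + t ^ 4) * \<delta> ^ 4)"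
    by (simp add: fact_numeral)
  also have "\<dots> \<le> 300 * ((\<bar>t\<bar> + t ^ 4) * \<delta> ^ 4)"
    by (intro mult_right_mono) auto
  finally show ?thesis by (simp only: mult.assoc)
qed

text \<open>\<open>c2\<close> and \<open>c3\<close> are the binomial coefficients of
  \<open>\<i> * t\<close> over 2 and 3. Beyond the truncation the exponential is 1, and the cubic
  polynomial itself must be \<open>O(\<delta> ^ 4)\<close>; it is, because
  \<open>\<bar>\<delta>\<bar>\<close> is then bounded below. The bound on the square of
  \<open>cmod c2\<close> controls the later replacement of \<open>1 + c2 * v\<close> by
  \<open>exp (c2 * v)\<close>.\<close>

lemma iexp_trunc_ln_taylor:
  fixes t \<delta> :: real
  defines "c2 \<equiv> \<i> * t * (\<i> * t - 1) / 2" and "c3 \<equiv> \<i> * t * (\<i> * t - 1) * (\<i> * t - 2) / 6"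
  shows "cmod (iexp (t * trunc_ln (1 + \<delta>)) - (1 + \<i> * t * \<delta> + c2 * \<delta>\<^sup>2 + c3 * \<delta> ^ 3))
    \<le> 300 * (\<bar>t\<bar> + t ^ 4) * \<delta> ^ 4" (is ?A)
    and "cmod c2 \<le> \<bar>t\<bar> + t ^ 4" (is ?B) and "cmod c3 \<le> \<bar>t\<bar> + t ^ 4" (is ?C)
    and "(cmod c2)\<^sup>2 \<le> \<bar>t\<bar> + t ^ 4" (is ?D)
proof -
  define s where "s = \<bar>t\<bar>"
  have s: "0 \<le> s" by (simp add: s_def)
  have s2: "s ^ 2 \<le> s + s ^ 4" and s3: "s ^ 3 \<le> s + s ^ 4"
  proof -
    have "s ^ k \<le> s + s ^ 4" if "1 \<le> k" "k \<le> 4" for k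
    proof (cases "s \<le> 1")
      case True
      then show ?thesis using power_decreasing[of 1 k s] that s by (simp add: add_increasing2)
    next
      case False
      then show ?thesis using power_increasing[of k 4 s] that s by (simp add: add_increasing)
    qed
    from this[of 2] this[of 3] show "s ^ 2 \<le> s + s ^ 4" "s ^ 3 \<le> s + s ^ 4" by auto
  qed
  have st: "\<bar>t\<bar> + t ^ 4 = s + s ^ 4" by (simp add: s_def power_even_abs)
  have n1: "cmod (\<i> * t - 1) \<le> s + 1" and n2: "cmod (\<i> * t - 2) \<le> s + 2"
    using norm_triangle_ineq4[of "\<i> * t" 1] norm_triangle_ineq4[of "\<i> * t" 2]
    by (simp_all add: norm_mult s_def)
  have c2: "cmod c2 \<le> s * (s + 1) / 2"
    unfolding c2_def using n1 s by (simp add: norm_mult norm_divide s_def mult_left_mono)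
  have c3: "cmod c3 \<le> s * ((s + 1) * (s + 2)) / 6"
  proof -
    have "cmod c3 = s * (cmod (\<i> * t - 1) * cmod (\<i> * t - 2)) / 6"
      by (simp add: c3_def norm_mult norm_divide s_def)
    also have "\<dots> \<le> s * ((s + 1) * (s + 2)) / 6"
      using n1 n2 s by (intro divide_right_mono mult_left_mono mult_mono) auto
    finally show ?thesis .
  qed
  have "s * (s + 1) / 2 = (s + s ^ 2) / 2" by (simp add: power2_eq_square algebra_simps)
  then have "cmod c2 \<le> (s + s ^ 2) / 2" using c2 by (simp only:)
  also have "(s + s ^ 2) / 2 = s / 2 + s ^ 2 / 2" by simp
  finally show B: ?B using s2 s zero_le_power[OF s, of 4] unfolding st by linarith
  have "s * ((s + 1) * (s + 2)) / 6 = (2 * s + 3 * s ^ 2 + s ^ 3) / 6"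
    by (simp add: power2_eq_square power3_eq_cube algebra_simps)
  then have "cmod c3 \<le> (2 * s + 3 * s ^ 2 + s ^ 3) / 6" using c3 by (simp only:)
  also have "\<dots> = s / 3 + s ^ 2 / 2 + s ^ 3 / 6" by simp
  finally show C: ?C using s2 s3 s zero_le_power[OF s, of 4] unfolding st by linarith
  have "(cmod c2)\<^sup>2 = (s * cmod (\<i> * t - 1) / 2)\<^sup>2"
    by (simp add: c2_def norm_mult norm_divide s_def)
  also have "\<dots> = s\<^sup>2 * (cmod (\<i> * t - 1))\<^sup>2 / 4" by (simp add: power_mult_distrib power_divide)
  also have "(cmod (\<i> * t - 1))\<^sup>2 = s\<^sup>2 + 1" by (simp add: cmod_power2 s_def)
  also have "s\<^sup>2 * (s\<^sup>2 + 1) / 4 = (s ^ 4 + s\<^sup>2) / 4" by (simp add: eval_nat_numeral algebra_simps)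
  also have "\<dots> = s ^ 4 / 4 + s\<^sup>2 / 4" by simp
  also have "\<dots> \<le> s + s ^ 4" using s2 s zero_le_power[OF s, of 4] by linarith
  finally show ?D by (simp add: st)
  show ?A
  proof (cases "\<bar>\<delta>\<bar> \<le> 1 / 2")
    case True
    have "(\<Sum>k\<le>3. (\<Prod>j<k. (\<i> * t - of_nat j)) * \<delta> ^ k / fact k) = 1 + \<i> * t * \<delta> + c2 * \<delta>\<^sup>2 + c3 * \<delta> ^ 3"
      by (simp add: eval_nat_numeral c2_def c3_def)
    then show ?thesis
      using iexp_ln_taylor[OF True, of t] True by (simp add: trunc_ln_def)
  next
    case False
    define e where "e = \<bar>\<delta>\<bar>"
    have e: "1 / 2 < e" using False by (simp add: e_def)
    have e4: "e ^ 4 = \<delta> ^ 4" by (simp add: e_def power_even_abs)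
    have p: "(1 / 2) ^ k \<le> e ^ k" for k using e by (intro power_mono) auto
    \<comment> \<open>Multiplying \<open>(1 / 2) ^ (4 - k) \<le> e ^ (4 - k)\<close> by
      \<open>e ^ k\<close> gives the factors 8, 4 and 2.\<close>
    have e1: "e \<le> 8 * e ^ 4" and e2: "e\<^sup>2 \<le> 8 * e ^ 4" and e3: "e ^ 3 \<le> 8 * e ^ 4"
      using mult_right_mono[OF p[of 3], of e] mult_right_mono[OF p[of 2], of "e\<^sup>2"]
        mult_right_mono[OF p[of 1], of "e ^ 3"] e zero_le_power[of e 4]
      by (simp_all add: eval_nat_numeral)
    have "cmod (\<i> * t * \<delta> + c2 * \<delta>\<^sup>2 + c3 * \<delta> ^ 3) \<le> s * e + cmod c2 * e\<^sup>2 + cmod c3 * e ^ 3"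
      by (intro norm_triangle_le add_mono) (auto simp: norm_mult norm_power s_def e_def)
    also have "\<dots> \<le> (s + s ^ 4) * (8 * e ^ 4) + (s + s ^ 4) * (8 * e ^ 4) + (s + s ^ 4) * (8 * e ^ 4)"
      using B C s e e1 e2 e3 by (intro add_mono mult_mono) (auto simp: st)
    also have "\<dots> \<le> 300 * (s + s ^ 4) * e ^ 4"
      using mult_nonneg_nonneg[of "s + s ^ 4" "e ^ 4"] s e by (simp add: algebra_simps)
    finally have "cmod (\<i> * t * \<delta> + c2 * \<delta>\<^sup>2 + c3 * \<delta> ^ 3) \<le> 300 * (s + s ^ 4) * e ^ 4" .
    moreover have "iexp (t * trunc_ln (1 + \<delta>)) - (1 + \<i> * t * \<delta> + c2 * \<delta>\<^sup>2 + c3 * \<delta> ^ 3) =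
        - (\<i> * t * \<delta> + c2 * \<delta>\<^sup>2 + c3 * \<delta> ^ 3)"
      using False by (simp add: trunc_ln_def)
    ultimately show ?thesis by (simp only: norm_minus_cancel st e4)
  qed
qed

section \<open>The normal law: affine form, characteristic function, Lipschitz constant and
  exponential moments\<close>

lemma gaussian_eq_distr:
  assumes "0 < v"
  shows "gaussian m v = distr std_normal_distribution borel (\<lambda>z. m + sqrt v * z)"
proof -
  interpret N: real_distribution std_normal_distribution by (rule real_dist_normal_dist)
  have "distributed std_normal_distribution lborel (\<lambda>z. z) std_normal_density"
    by (simp add: distributed_def distr_id2)
  from N.normal_density_affine[OF this, of "sqrt v" m]
  have "distributed std_normal_distribution lborel (\<lambda>z. m + sqrt v * z) (normal_density m (sqrt v))"
    using assms by simp
  then have "distr std_normal_distribution lborel (\<lambda>z. m + sqrt v * z) = gaussian m v"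
    unfolding distributed_def gaussian_def by simp
  moreover have "distr std_normal_distribution lborel (\<lambda>z. m + sqrt v * z) =
      distr std_normal_distribution borel (\<lambda>z. m + sqrt v * z)"
    by (intro distr_cong) auto
  ultimately show ?thesis by simp
qed

lemma real_distribution_gaussian:
  assumes "0 < v"
  shows "real_distribution (gaussian m v)"
proof -
  interpret N: real_distribution std_normal_distribution by (rule real_dist_normal_dist)
  show ?thesis unfolding gaussian_eq_distr[OF assms] by (rule N.real_distribution_distr) simp
qed

lemma char_gaussian:
  assumes "0 < v"
  shows "char (gaussian m v) t = exp (\<i> * t * m - v * t\<^sup>2 / 2)"
proof -
  have sq: "(complex_of_real (sqrt v))\<^sup>2 = v" using assms by (simp flip: of_real_power)
  have "char (gaussian m v) t = (\<integral>z. iexp (t * m) * iexp (sqrt v * t * z) \<partial>std_normal_distribution)"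
    unfolding gaussian_eq_distr[OF assms] char_def
    by (subst integral_distr) (auto intro!: Bochner_Integration.integral_cong simp: exp_add[symmetric] algebra_simps)
  also have "\<dots> = iexp (t * m) * char std_normal_distribution (sqrt v * t)"
    by (simp add: char_def)
  also have "\<dots> = exp (\<i> * t * m - v * t\<^sup>2 / 2)"
    using assms by (simp add: char_std_normal_distribution power_mult_distrib exp_of_real[symmetric]
        exp_add[symmetric] algebra_simps sq)
  finally show ?thesis .
qed

text \<open>The density is bounded by its value at the mean. The constant blows up as
  \<open>v\<close> tends to 0, which is how the lower bound on \<beta> enters the distributional
  estimate.\<close>

lemma cdf_gaussian_lipschitz:
  assumes v: "0 < v" and xy: "x \<le> y"
  shows "cdf (gaussian m v) y - cdf (gaussian m v) x \<le> 1 / sqrt v * (y - x)"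
proof (cases "x = y")
  case False
  then have lt: "x < y" using xy by simp
  interpret G: real_distribution "gaussian m v" by (rule real_distribution_gaussian[OF v])
  have "emeasure (gaussian m v) {x<..y} = (\<integral>\<^sup>+z. ennreal (normal_density m (sqrt v) z) * indicator {x<..y} z \<partial>lborel)"
    unfolding gaussian_def by (rule emeasure_density) auto
  also have "\<dots> \<le> (\<integral>\<^sup>+z. ennreal (1 / sqrt v) * indicator {x<..y} z \<partial>lborel)"
  proof (intro nn_integral_mono mult_right_mono ennreal_leI)
    fix z
    have "normal_density m (sqrt v) z \<le> 1 / sqrt (2 * pi * v)"
      unfolding normal_density_def using v by (simp add: divide_right_mono)
    also have "\<dots> \<le> 1 / sqrt v"
      using v pi_gt3 by (intro divide_left_mono) (auto intro!: real_sqrt_le_mono)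
    finally show "normal_density m (sqrt v) z \<le> 1 / sqrt v" .
  qed auto
  also have "\<dots> = ennreal (1 / sqrt v * (y - x))"
    using lt v by (simp add: nn_integral_cmult flip: ennreal_mult')
  finally have "measure (gaussian m v) {x<..y} \<le> 1 / sqrt v * (y - x)"
    using lt v by (simp add: G.emeasure_eq_measure)
  then show ?thesis using G.cdf_diff_eq[OF lt] by simp
qed simp

text \<open>Completing the square shifts the mean by \<open>k * v\<close>. With
  \<open>m = - v / 2\<close> the exponent becomes \<open>(k choose 2) * v\<close>, the one found for
  the network.\<close>

lemma gaussian_exp_moment:
  assumes v: "0 < v"
  shows "(\<integral>x. exp x ^ k \<partial>gaussian m v) = exp (real k * m + (real k)\<^sup>2 * v / 2)"
proof -
  have eq: "normal_density m (sqrt v) x * exp x ^ k =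
    exp (real k * m + (real k)\<^sup>2 * v / 2) * normal_density (m + real k * v) (sqrt v) x" for x
  proof -
    have "-(x - m)\<^sup>2 / (2 * v) + real k * x =
      (real k * m + (real k)\<^sup>2 * v / 2) + (-(x - (m + real k * v))\<^sup>2 / (2 * v))"
      using v by (simp add: field_simps power2_eq_square)
    then have "exp (-(x - m)\<^sup>2 / (2 * v)) * exp (real k * x) =
      exp (real k * m + (real k)\<^sup>2 * v / 2) * exp (-(x - (m + real k * v))\<^sup>2 / (2 * v))"
      by (simp only: exp_add[symmetric])
    then show ?thesis
      using v by (simp add: normal_density_def exp_of_nat_mult)
  qed
  have "(\<integral>x. exp x ^ k \<partial>gaussian m v) = (\<integral>x. normal_density m (sqrt v) x * exp x ^ k \<partial>lborel)"
    unfolding gaussian_def by (subst integral_density) auto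
  also have "\<dots> = exp (real k * m + (real k)\<^sup>2 * v / 2)"
    unfolding eq using v by simp
  finally show ?thesis .
qed

section \<open>The extended logarithm and the Kolmogorov-Smirnov distance\<close>

lemma borel_measurable_ext_ln [measurable]: "ext_ln \<in> borel_measurable borel"
  unfolding ext_ln_def[abs_def] by measurable

text \<open>Outside \<open>Bad\<close> the events \<open>ext_ln (Z \<omega>) \<le> t\<close> and
  \<open>X \<omega> \<le> t\<close> coincide, so exchanging the two variables costs at most the
  measure of \<open>Bad\<close>. Points with value \<open>- \<infinity>\<close> can lie only in
  \<open>Bad\<close>.\<close>

lemma ks_dist_ext_ln_le:
  assumes M: "prob_space M" and [measurable]: "X \<in> borel_measurable M" "Z \<in> borel_measurable M"
    and Bad [measurable]: "Bad \<in> sets M"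
    and good: "\<And>\<omega>. \<omega> \<in> space M - Bad \<Longrightarrow> 0 < Z \<omega> \<and> ln (Z \<omega>) = X \<omega>"
    and G: "real_distribution G"
    and close: "\<And>x. \<bar>cdf (distr M borel X) x - cdf G x\<bar> \<le> e"
  shows "ks_dist (distr M borel (\<lambda>\<omega>. ext_ln (Z \<omega>))) (distr G borel ereal) \<le> e + measure M Bad"
  unfolding ks_dist_def
proof (rule cSUP_least)
  interpret prob_space M by (rule M)
  interpret G: real_distribution G by (rule G)
  fix t :: real
  define A where "A = {\<omega>\<in>space M. ext_ln (Z \<omega>) \<le> ereal t}"
  define B where "B = {\<omega>\<in>space M. X \<omega> \<le> t}"
  have [measurable]: "A \<in> sets M" "B \<in> sets M" unfolding A_def B_def by measurable
  have mA: "measure (distr M borel (\<lambda>\<omega>. ext_ln (Z \<omega>))) {..ereal t} = prob A"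
    by (subst measure_distr) (auto simp: A_def intro!: arg_cong[where f=prob])
  have mG: "measure (distr G borel ereal) {..ereal t} = cdf G t"
    unfolding cdf_def by (subst measure_distr) (auto intro!: arg_cong[where f="measure G"])
  have mB: "cdf (distr M borel X) t = prob B"
    unfolding cdf_def by (subst measure_distr) (auto simp: B_def intro!: arg_cong[where f=prob])
  have sub: "A \<subseteq> B \<union> Bad" "B \<subseteq> A \<union> Bad"
    unfolding A_def B_def ext_ln_def using good by fastforce+
  have "prob A \<le> prob (B \<union> Bad)" "prob B \<le> prob (A \<union> Bad)"
    using sub by (auto intro!: finite_measure_mono)
  then have "\<bar>prob A - prob B\<bar> \<le> prob Bad"
    using measure_Un_le[of B M Bad] measure_Un_le[of A M Bad] by simp
  then show "\<bar>measure (distr M borel (\<lambda>\<omega>. ext_ln (Z \<omega>))) {..ereal t} - measure (distr G borel ereal) {..ereal t}\<bar>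
      \<le> e + prob Bad"
    using close[of t] unfolding mA mG mB by linarith
qed simp

lemma ks_dist_le_1:
  assumes "prob_space P" "prob_space Q"
  shows "ks_dist P Q \<le> 1"
  unfolding ks_dist_def
proof (rule cSUP_least)
  interpret P: prob_space P by fact
  interpret Q: prob_space Q by fact
  fix t :: real
  show "\<bar>measure P {..ereal t} - measure Q {..ereal t}\<bar> \<le> 1"
    using P.prob_le_1[of "{..ereal t}"] Q.prob_le_1[of "{..ereal t}"]
      measure_nonneg[of P "{..ereal t}"] measure_nonneg[of Q "{..ereal t}"] by linarith
qed simp

section \<open>A single layer\<close>

type_synonym param = "nat \<times> nat \<times> nat + nat \<times> nat"

definition sq_norm :: "nat \<Rightarrow> (nat \<Rightarrow> real) \<Rightarrow> real" where
  "sq_norm m v = (\<Sum>k<m. (v k)\<^sup>2)"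

definition quart_norm :: "nat \<Rightarrow> (nat \<Rightarrow> real) \<Rightarrow> real" where
  "quart_norm m v = (\<Sum>k<m. v k ^ 4)"

definition row_prod :: "(param \<Rightarrow> real) \<Rightarrow> nat \<Rightarrow> nat \<Rightarrow> (nat \<Rightarrow> real) \<Rightarrow> nat \<Rightarrow> real" where
  "row_prod x m i v j = (\<Sum>k<m. x (Inl (i, j, k)) * v k)"

definition row_energy :: "real \<Rightarrow> (param \<Rightarrow> real) \<Rightarrow> nat \<Rightarrow> nat \<Rightarrow> (nat \<Rightarrow> real) \<Rightarrow> nat \<Rightarrow> real" where
  "row_energy p x m i v j = (x (Inr (i, j)) * row_prod x m i v j)\<^sup>2 / p"

text \<open>For a unit vector \<open>v\<close> this is \<open>n (i - 1) / n i\<close> times the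
  squared norm of the image of \<open>v\<close> under layer \<open>i\<close>. The scaling of the
  layer matrix is absorbed, so that every row energy has mean 1.\<close>

definition gain :: "real \<Rightarrow> (nat \<Rightarrow> nat) \<Rightarrow> (param \<Rightarrow> real) \<Rightarrow> nat \<Rightarrow> (nat \<Rightarrow> real) \<Rightarrow> real" where
  "gain p n x i v = (\<Sum>j<n i. row_energy p x (n (i - 1)) i v j) / real (n i)"

text \<open>A parameter \<open>Inl (i, j, k)\<close> is the weight \<open>W i j k\<close>, and \<open>Inr (i, j)\<close> is the switch \<open>\<xi> i j\<close>.\<close>

definition row_params :: "(nat \<Rightarrow> nat) \<Rightarrow> nat \<Rightarrow> nat \<Rightarrow> param set" where
  "row_params n i j = insert (Inr (i, j)) ((\<lambda>k. Inl (i, j, k)) ` {..<n (i - 1)})"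

definition layer_params :: "(nat \<Rightarrow> nat) \<Rightarrow> nat \<Rightarrow> param set" where
  "layer_params n i = (\<Union>j<n i. row_params n i j)"

text \<open>The second moment of a row energy for a unit vector,
  \<open>(3 + (raw_moment \<mu> 4 - 3) * quart_norm m v) / p\<close>, minus the squared mean
  1.\<close>

definition energy_variance :: "real \<Rightarrow> real measure \<Rightarrow> nat \<Rightarrow> (nat \<Rightarrow> real) \<Rightarrow> real" where
  "energy_variance p \<mu> m v = 3 / p - 1 + (raw_moment \<mu> 4 - 3) / p * quart_norm m v"

lemma quart_norm_bounds:
  assumes "sq_norm m v = 1"
  shows "0 \<le> quart_norm m v" "quart_norm m v \<le> 1"
proof -
  show "0 \<le> quart_norm m v" by (simp add: quart_norm_def sum_nonneg)
  have "(v k)\<^sup>2 \<le> 1" if "k < m" for k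
    using member_le_sum[of k "{..<m}" "\<lambda>k. (v k)\<^sup>2"] that assms by (simp add: sq_norm_def)
  then have "(v k)\<^sup>2 * (v k)\<^sup>2 \<le> (v k)\<^sup>2 * 1" if "k < m" for k
    using that by (intro mult_left_mono) auto
  then have "quart_norm m v \<le> (\<Sum>k<m. (v k)\<^sup>2)"
    unfolding quart_norm_def by (intro sum_mono) (simp flip: power_add)
  then show "quart_norm m v \<le> 1" using assms by (simp add: sq_norm_def)
qed

lemma sum_binomial_mult: "(\<Sum>k\<le>r. real (r choose k) * b) = 2 ^ r * b"
  using choose_row_sum[of r] unfolding sum_distrib_right[symmetric] of_nat_sum[symmetric] by simp

locale random_network = random_layers M \<mu> p d n W \<xi> + wd: weight_distribution \<mu>
  for M :: "'a measure" and \<mu> p d n W \<xi> +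
  assumes p_pos: "0 < p" and p_le_1: "p \<le> 1"
begin

definition params :: "param set" where
  "params = (SIGMA i:{1..d}. {..<n i} \<times> {..<n (i - 1)}) <+> (SIGMA i:{1..d}. {..<n i})"

text \<open>The sample point as an assignment of values to parameters: independence of rows and
  layers becomes disjointness of sets of coordinates.\<close>

definition weights :: "'a \<Rightarrow> param \<Rightarrow> real" where
  "weights \<omega> s = case_sum (\<lambda>(i, j, k). W i j k) (\<lambda>(i, j). \<xi> i j) s \<omega>"

lemma weights_simps [simp]:
  "weights \<omega> (Inl (i, j, k)) = W i j k \<omega>" "weights \<omega> (Inr (i, j)) = \<xi> i j \<omega>"
  by (simp_all add: weights_def)

lemma indep_weights: "indep_vars (\<lambda>_. borel) (\<lambda>s \<omega>. weights \<omega> s) params"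
  using indep unfolding weights_def params_def by simp

lemma row_params_subset: "i \<in> {1..d} \<Longrightarrow> j < n i \<Longrightarrow> row_params n i j \<subseteq> params"
  by (auto simp: row_params_def params_def)

lemma layer_params_subset: "i \<in> {1..d} \<Longrightarrow> layer_params n i \<subseteq> params"
  using row_params_subset by (auto simp: layer_params_def)

lemma rv_weights: "s \<in> params \<Longrightarrow> (\<lambda>\<omega>. weights \<omega> s) \<in> borel_measurable M"
  using indep_weights[unfolded indep_vars_def, THEN conjunct1] by simp

lemma rv_W [measurable]: "i \<in> {1..d} \<Longrightarrow> j < n i \<Longrightarrow> k < n (i - 1) \<Longrightarrow> W i j k \<in> borel_measurable M"
  using row_params_subset[of i j] rv_weights[of "Inl (i, j, k)"] unfolding row_params_def by simp blast

lemma rv_\<xi> [measurable]: "i \<in> {1..d} \<Longrightarrow> j < n i \<Longrightarrow> \<xi> i j \<in> borel_measurable M"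
  using row_params_subset[of i j] rv_weights[of "Inr (i, j)"] unfolding row_params_def by simp

lemma W_moment:
  assumes "i \<in> {1..d}" "j < n i" "k < n (i - 1)"
  shows "integrable M (\<lambda>\<omega>. W i j k \<omega> ^ r)" "(\<integral>\<omega>. W i j k \<omega> ^ r \<partial>M) = raw_moment \<mu> r"
proof -
  note [measurable] = rv_W[OF assms]
  have "integrable (distr M borel (W i j k)) (\<lambda>x. x ^ r)"
    using wd.finite_moments W_distr[OF assms] by simp
  then show "integrable M (\<lambda>\<omega>. W i j k \<omega> ^ r)" by (subst (asm) integrable_distr_eq) auto
  have "raw_moment \<mu> r = (\<integral>x. x ^ r \<partial>distr M borel (W i j k))"
    using W_distr[OF assms] by (simp add: raw_moment_def)
  then show "(\<integral>\<omega>. W i j k \<omega> ^ r \<partial>M) = raw_moment \<mu> r" by (subst (asm) integral_distr) auto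
qed

lemma \<xi>_moment:
  assumes "i \<in> {1..d}" "j < n i" "0 < r"
  shows "integrable M (\<lambda>\<omega>. \<xi> i j \<omega> ^ r)" "(\<integral>\<omega>. \<xi> i j \<omega> ^ r \<partial>M) = p"
proof -
  note [measurable] = rv_\<xi>[OF assms(1,2)]
  have "integrable (distr (measure_pmf (bernoulli_pmf p)) borel of_bool) (\<lambda>x::real. x ^ r)"
    by (subst integrable_distr_eq) (auto intro!: measure_pmf.integrable_const_bound[of _ 1] simp: power_le_one)
  then have "integrable (distr M borel (\<xi> i j)) (\<lambda>x. x ^ r)"
    using \<xi>_distr[OF assms(1,2)] by simp
  then show "integrable M (\<lambda>\<omega>. \<xi> i j \<omega> ^ r)" by (subst (asm) integrable_distr_eq) auto
  have "(\<integral>\<omega>. \<xi> i j \<omega> ^ r \<partial>M) = (\<integral>x. x ^ r \<partial>distr M borel (\<xi> i j))"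
    by (subst integral_distr) auto
  also have "\<dots> = (\<integral>x. x ^ r \<partial>distr (measure_pmf (bernoulli_pmf p)) borel of_bool)"
    using \<xi>_distr[OF assms(1,2)] by simp
  also have "\<dots> = (\<integral>b. of_bool b ^ r \<partial>bernoulli_pmf p)"
    by (subst integral_distr) auto
  also have "\<dots> = p" using p_pos p_le_1 assms(3) by simp
  finally show "(\<integral>\<omega>. \<xi> i j \<omega> ^ r \<partial>M) = p" .
qed

section \<open>Row energies and gains for a fixed unit vector \<open>v\<close>\<close>

context
  fixes i :: nat and v :: "nat \<Rightarrow> real"
  assumes i: "i \<in> {1..d}" and v: "sq_norm (n (i - 1)) v = 1"
begin

lemma v_le_1: "k < n (i - 1) \<Longrightarrow> (v k)\<^sup>2 \<le> 1"
  using member_le_sum[of k "{..<n (i - 1)}" "\<lambda>k. (v k)\<^sup>2"] v by (simp add: sq_norm_def)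

lemma row_indep_moments:
  assumes j: "j < n i"
  shows "centred_indep_moments M (\<lambda>k \<omega>. W i j k \<omega> * v k) (n (i - 1))"
proof
  have "indep_vars (\<lambda>k. PiM {Inl (i, j, k)} (\<lambda>_. borel))
      (\<lambda>k \<omega>. restrict (\<lambda>s. weights \<omega> s) {Inl (i, j, k)}) {..<n (i - 1)}"
    by (rule indep_vars_restrict[OF indep_weights])
       (use i j in \<open>auto simp: params_def disjoint_family_on_def\<close>)
  then have "indep_vars (\<lambda>_. borel)
      (\<lambda>k \<omega>. (\<lambda>f. f (Inl (i, j, k)) * v k) (restrict (\<lambda>s. weights \<omega> s) {Inl (i, j, k)})) {..<n (i - 1)}"
    by (rule indep_vars_compose2) measurable
  then show "indep_vars (\<lambda>_. borel) (\<lambda>k \<omega>. W i j k \<omega> * v k) {..<n (i - 1)}" by simp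
  fix k r assume "k < n (i - 1)"
  then show "integrable M (\<lambda>\<omega>. (W i j k \<omega> * v k) ^ r)"
    using W_moment(1)[OF i j] by (simp add: power_mult_distrib)
next
  fix k assume "k < n (i - 1)"
  then show "(\<integral>\<omega>. W i j k \<omega> * v k \<partial>M) = 0"
    using W_moment(2)[OF i j, of k 1] wd.mean_zero by simp
qed

lemma row_prod_eq: "row_prod (weights \<omega>) (n (i - 1)) i v j = (\<Sum>k<n (i - 1). W i j k \<omega> * v k)"
  by (simp add: row_prod_def)

lemma row_prod_moments:
  assumes j: "j < n i"
  shows "integrable M (\<lambda>\<omega>. row_prod (weights \<omega>) (n (i - 1)) i v j ^ r)"
    and "(\<integral>\<omega>. row_prod (weights \<omega>) (n (i - 1)) i v j ^ 2 \<partial>M) = 1"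
    and "(\<integral>\<omega>. row_prod (weights \<omega>) (n (i - 1)) i v j ^ 4 \<partial>M) = 3 + (raw_moment \<mu> 4 - 3) * quart_norm (n (i - 1)) v"
proof -
  interpret R: centred_indep_moments M "\<lambda>k \<omega>. W i j k \<omega> * v k" "n (i - 1)" by (rule row_indep_moments[OF j])
  have m2: "(\<integral>\<omega>. (W i j k \<omega> * v k)\<^sup>2 \<partial>M) = (v k)\<^sup>2" if "k < n (i - 1)" for k
    using W_moment(2)[OF i j that, of 2] wd.variance_one by (simp add: power_mult_distrib)
  have m4: "(\<integral>\<omega>. (W i j k \<omega> * v k) ^ 4 \<partial>M) = raw_moment \<mu> 4 * v k ^ 4" if "k < n (i - 1)" for k
    using W_moment(2)[OF i j that, of 4] by (simp add: power_mult_distrib)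
  have s2: "(\<Sum>k<n (i - 1). \<integral>\<omega>. (W i j k \<omega> * v k)\<^sup>2 \<partial>M) = 1"
    using v by (simp add: m2 sq_norm_def)
  show "integrable M (\<lambda>\<omega>. row_prod (weights \<omega>) (n (i - 1)) i v j ^ r)"
    unfolding row_prod_eq by (rule R.integrable_sum_power) simp
  show "(\<integral>\<omega>. row_prod (weights \<omega>) (n (i - 1)) i v j ^ 2 \<partial>M) = 1"
    unfolding row_prod_eq using R.integral_sum_sq[OF order_refl] s2 by simp
  have "(\<Sum>k<n (i - 1). (\<integral>\<omega>. (W i j k \<omega> * v k) ^ 4 \<partial>M) - 3 * (\<integral>\<omega>. (W i j k \<omega> * v k)\<^sup>2 \<partial>M)\<^sup>2) =
    (\<Sum>k<n (i - 1). (raw_moment \<mu> 4 - 3) * v k ^ 4)"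
  proof (intro sum.cong refl)
    fix k assume "k \<in> {..<n (i - 1)}"
    then have k: "k < n (i - 1)" by simp
    have "((v k)\<^sup>2)\<^sup>2 = v k ^ 4" by (simp flip: power_mult)
    then show "(\<integral>\<omega>. (W i j k \<omega> * v k) ^ 4 \<partial>M) - 3 * (\<integral>\<omega>. (W i j k \<omega> * v k)\<^sup>2 \<partial>M)\<^sup>2 =
        (raw_moment \<mu> 4 - 3) * v k ^ 4"
      unfolding m2[OF k] m4[OF k] by (simp add: left_diff_distrib)
  qed
  then show "(\<integral>\<omega>. row_prod (weights \<omega>) (n (i - 1)) i v j ^ 4 \<partial>M) = 3 + (raw_moment \<mu> 4 - 3) * quart_norm (n (i - 1)) v"
    unfolding row_prod_eq R.integral_sum_pow4[OF order_refl] s2 by (simp add: quart_norm_def sum_distrib_left)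
qed

text \<open>The switch and the row product read disjoint sets of parameters and are therefore
  independent. A switch takes the values 0 and 1, so all its positive powers have mean
  \<open>p\<close>; for \<open>r = 0\<close> the mean would be 1, whence
  \<open>0 < r\<close>.\<close>

lemma row_energy_moments:
  assumes j: "j < n i"
  defines "Y \<equiv> \<lambda>\<omega>. row_energy p (weights \<omega>) (n (i - 1)) i v j"
  shows "integrable M (\<lambda>\<omega>. Y \<omega> ^ r)"
    and "0 < r \<Longrightarrow> (\<integral>\<omega>. Y \<omega> ^ r \<partial>M) = p / p ^ r * (\<integral>\<omega>. row_prod (weights \<omega>) (n (i - 1)) i v j ^ (2 * r) \<partial>M)"
proof -
  let ?A = "{Inr (i, j)} :: param set" and ?B = "(\<lambda>k. Inl (i, j, k)) ` {..<n (i - 1)} :: param set"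
  let ?T = "\<lambda>\<omega>. row_prod (weights \<omega>) (n (i - 1)) i v j"
  have "indep_var (PiM ?A (\<lambda>_. borel)) (\<lambda>\<omega>. restrict (\<lambda>s. weights \<omega> s) ?A)
      (PiM ?B (\<lambda>_. borel)) (\<lambda>\<omega>. restrict (\<lambda>s. weights \<omega> s) ?B)"
    by (rule indep_var_restrict[OF indep_weights]) (use i j in \<open>auto simp: params_def\<close>)
  then have "indep_var borel ((\<lambda>f. f (Inr (i, j)) ^ (2 * r)) \<circ> (\<lambda>\<omega>. restrict (\<lambda>s. weights \<omega> s) ?A))
      borel ((\<lambda>f. row_prod f (n (i - 1)) i v j ^ (2 * r)) \<circ> (\<lambda>\<omega>. restrict (\<lambda>s. weights \<omega> s) ?B))"
    unfolding row_prod_def by (rule indep_var_compose) measurable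
  moreover have "(\<lambda>f. f (Inr (i, j)) ^ (2 * r)) \<circ> (\<lambda>\<omega>. restrict (\<lambda>s. weights \<omega> s) ?A) = (\<lambda>\<omega>. \<xi> i j \<omega> ^ (2 * r))"
    by (auto simp: fun_eq_iff)
  moreover have "(\<lambda>f. row_prod f (n (i - 1)) i v j ^ (2 * r)) \<circ> (\<lambda>\<omega>. restrict (\<lambda>s. weights \<omega> s) ?B) = (\<lambda>\<omega>. ?T \<omega> ^ (2 * r))"
    by (auto simp: fun_eq_iff row_prod_def intro!: arg_cong[where f="\<lambda>x. x ^ _"])
  ultimately have ind: "indep_var borel (\<lambda>\<omega>. \<xi> i j \<omega> ^ (2 * r)) borel (\<lambda>\<omega>. ?T \<omega> ^ (2 * r))" by simp
  have Yr: "Y \<omega> ^ r = \<xi> i j \<omega> ^ (2 * r) * ?T \<omega> ^ (2 * r) / p ^ r" for \<omega>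
    by (simp add: Y_def row_energy_def power_divide power_mult_distrib power_mult)
  have i1: "integrable M (\<lambda>\<omega>. \<xi> i j \<omega> ^ (2 * r))" using \<xi>_moment(1)[OF i j, of "2 * r"] by (cases r) auto
  note I = i1 row_prod_moments(1)[OF j, of "2 * r"]
  show "integrable M (\<lambda>\<omega>. Y \<omega> ^ r)"
    unfolding Yr by (intro integrable_divide indep_var_integrable[OF ind] I)
  show "(\<integral>\<omega>. Y \<omega> ^ r \<partial>M) = p / p ^ r * (\<integral>\<omega>. ?T \<omega> ^ (2 * r) \<partial>M)" if "0 < r"
    unfolding Yr using indep_var_lebesgue_integral[OF ind I] \<xi>_moment(2)[OF i j, of "2 * r"] that by simp
qed

lemma row_energy_mean: "j < n i \<Longrightarrow> (\<integral>\<omega>. row_energy p (weights \<omega>) (n (i - 1)) i v j \<partial>M) = 1"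
  using row_energy_moments(2)[of j 1] row_prod_moments(2)[of j] p_pos by simp

lemma row_energy_sq:
  assumes j: "j < n i"
  shows "(\<integral>\<omega>. (row_energy p (weights \<omega>) (n (i - 1)) i v j)\<^sup>2 \<partial>M) = energy_variance p \<mu> (n (i - 1)) v + 1"
proof -
  have "(\<integral>\<omega>. (row_energy p (weights \<omega>) (n (i - 1)) i v j)\<^sup>2 \<partial>M) =
      p / p\<^sup>2 * (3 + (raw_moment \<mu> 4 - 3) * quart_norm (n (i - 1)) v)"
    using row_energy_moments(2)[OF j, of 2] row_prod_moments(3)[OF j] by simp
  also have "\<dots> = energy_variance p \<mu> (n (i - 1)) v + 1"
    using p_pos by (simp add: energy_variance_def power2_eq_square add_divide_distrib)
  finally show ?thesis .
qed

lemma row_energy_nonneg: "0 \<le> row_energy p x m i' v' j"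
  using p_pos by (simp add: row_energy_def)

lemma layer_indep_moments:
  "centred_indep_moments M (\<lambda>j \<omega>. row_energy p (weights \<omega>) (n (i - 1)) i v j - 1) (n i)"
proof
  have "indep_vars (\<lambda>j. PiM (row_params n i j) (\<lambda>_. borel))
      (\<lambda>j \<omega>. restrict (\<lambda>s. weights \<omega> s) (row_params n i j)) {..<n i}"
    by (rule indep_vars_restrict[OF indep_weights])
       (use i row_params_subset in \<open>auto simp: row_params_def disjoint_family_on_def\<close>)
  then have "indep_vars (\<lambda>_. borel) (\<lambda>j \<omega>. (\<lambda>f. row_energy p f (n (i - 1)) i v j - 1)
      (restrict (\<lambda>s. weights \<omega> s) (row_params n i j))) {..<n i}"
  proof (rule indep_vars_compose2)
    fix j
    have [measurable]: "(\<lambda>f. f s) \<in> borel_measurable (PiM (row_params n i j) (\<lambda>_. borel))" if "s \<in> row_params n i j"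
      for s :: param using that by (rule measurable_component_singleton)
    have [measurable]: "(\<lambda>f. f (Inr (i, j))) \<in> borel_measurable (PiM (row_params n i j) (\<lambda>_. borel))"
      "\<And>k. k < n (i - 1) \<Longrightarrow> (\<lambda>f. f (Inl (i, j, k))) \<in> borel_measurable (PiM (row_params n i j) (\<lambda>_. borel))"
      by (auto intro!: measurable_component_singleton simp: row_params_def)
    show "(\<lambda>f. row_energy p f (n (i - 1)) i v j - 1) \<in> borel_measurable (PiM (row_params n i j) (\<lambda>_. borel))"
      unfolding row_energy_def row_prod_def
      by (intro borel_measurable_diff borel_measurable_divide borel_measurable_power borel_measurable_times
          borel_measurable_sum borel_measurable_const) auto
  qed
  moreover have "row_energy p (restrict (weights \<omega>) (row_params n i j)) (n (i - 1)) i v j =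
      row_energy p (weights \<omega>) (n (i - 1)) i v j" for \<omega> j
    by (auto simp: row_energy_def row_prod_def row_params_def intro!: arg_cong2[where f="\<lambda>a b. (a * b)\<^sup>2 / p"])
  ultimately show "indep_vars (\<lambda>_. borel) (\<lambda>j \<omega>. row_energy p (weights \<omega>) (n (i - 1)) i v j - 1) {..<n i}"
    by simp
  fix j r assume j: "j < n i"
  have "(row_energy p (weights \<omega>) (n (i - 1)) i v j - 1) ^ r =
      (\<Sum>k\<le>r. real (r choose k) * row_energy p (weights \<omega>) (n (i - 1)) i v j ^ k * (- 1) ^ (r - k))" for \<omega>
    using binomial_ring[of "row_energy p (weights \<omega>) (n (i - 1)) i v j" "- 1" r] by simp
  then show "integrable M (\<lambda>\<omega>. (row_energy p (weights \<omega>) (n (i - 1)) i v j - 1) ^ r)"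
    using row_energy_moments(1)[OF j] by simp
next
  fix j assume j: "j < n i"
  show "(\<integral>\<omega>. row_energy p (weights \<omega>) (n (i - 1)) i v j - 1 \<partial>M) = 0"
    using row_energy_moments(1)[OF j, of 1] row_energy_mean[OF j] by (simp add: prob_space)
qed

lemma gain_deviation:
  "gain p n (weights \<omega>) i v - 1 = (\<Sum>j<n i. row_energy p (weights \<omega>) (n (i - 1)) i v j - 1) / real (n i)"
  using n_pos[of i] i by (simp add: gain_def sum_subtractf field_simps)

lemma gain_moments:
  shows "integrable M (\<lambda>\<omega>. (gain p n (weights \<omega>) i v - 1) ^ r)"
    and "(\<integral>\<omega>. gain p n (weights \<omega>) i v - 1 \<partial>M) = 0"
    and "(\<integral>\<omega>. (gain p n (weights \<omega>) i v - 1)\<^sup>2 \<partial>M) = energy_variance p \<mu> (n (i - 1)) v / real (n i)"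
proof -
  interpret L: centred_indep_moments M "\<lambda>j \<omega>. row_energy p (weights \<omega>) (n (i - 1)) i v j - 1" "n i"
    by (rule layer_indep_moments)
  show "integrable M (\<lambda>\<omega>. (gain p n (weights \<omega>) i v - 1) ^ r)"
    unfolding gain_deviation power_divide using L.integrable_sum_power[OF order_refl] by simp
  show "(\<integral>\<omega>. gain p n (weights \<omega>) i v - 1 \<partial>M) = 0"
    unfolding gain_deviation using L.integral_sum[OF order_refl] by simp
  have "(\<integral>\<omega>. (row_energy p (weights \<omega>) (n (i - 1)) i v j - 1)\<^sup>2 \<partial>M) = energy_variance p \<mu> (n (i - 1)) v"
    if j: "j < n i" for j
  proof -
    have "(\<integral>\<omega>. (row_energy p (weights \<omega>) (n (i - 1)) i v j - 1)\<^sup>2 \<partial>M) =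
      (\<integral>\<omega>. (row_energy p (weights \<omega>) (n (i - 1)) i v j)\<^sup>2 - 2 * row_energy p (weights \<omega>) (n (i - 1)) i v j + 1 \<partial>M)"
      by (simp add: power2_diff algebra_simps)
    also have "\<dots> = energy_variance p \<mu> (n (i - 1)) v"
      using row_energy_moments(1)[OF j, of 1] row_energy_moments(1)[OF j, of 2] row_energy_mean[OF j] row_energy_sq[OF j]
      by (simp add: prob_space)
    finally show ?thesis .
  qed
  then show "(\<integral>\<omega>. (gain p n (weights \<omega>) i v - 1)\<^sup>2 \<partial>M) = energy_variance p \<mu> (n (i - 1)) v / real (n i)"
    unfolding gain_deviation power_divide using L.integral_sum_sq[OF order_refl]
    by (simp add: power2_eq_square)
qed

end

text \<open>Everything about \<mu> and \<open>p\<close> that the analysis of the network takes as an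
  estimate and not as an exact formula, uniformly over layers and unit vectors. Later statements are
  relative to a pair \<open>K\<close>, \<open>C\<close>, which makes the dependence of constants
  explicit.\<close>

definition layer_bounds :: "nat \<Rightarrow> real \<Rightarrow> bool" where
  "layer_bounds K C \<longleftrightarrow> 0 \<le> C \<and> (\<forall>i\<in>{1..d}. \<forall>v. sq_norm (n (i - 1)) v = 1 \<longrightarrow>
     (\<forall>r\<in>{3..K}. \<bar>\<integral>\<omega>. (gain p n (weights \<omega>) i v - 1) ^ r \<partial>M\<bar> \<le> C / (real (n i))\<^sup>2) \<and>
     (\<forall>j<n i. \<forall>r\<le>K. (\<integral>\<omega>. row_energy p (weights \<omega>) (n (i - 1)) i v j ^ r \<partial>M) \<le> C))"

end

text \<open>The bound for centred sums is used twice: inside a row with weights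
  \<open>(v k)\<^sup>2\<close>, whose total is 1 whatever the width, and then across the rows with
  constant weights. The constant is chosen from the moments, \<open>K\<close> and \<open>p0\<close>
  alone, before the network is given; \<open>p0 \<le> p\<close> controls the powers of
  \<open>1 / p\<close>.\<close>

lemma ex_layer_bounds:
  fixes mom :: "nat \<Rightarrow> real" and p0 :: real
  assumes p0: "0 < p0" "p0 \<le> 1"
  shows "\<exists>C. \<forall>(M :: 'a measure) \<mu> p d n W \<xi>. random_network M \<mu> p d n W \<xi> \<and> raw_moment \<mu> = mom \<and> p0 \<le> p
    \<longrightarrow> random_network.layer_bounds M p d n W \<xi> K C"
proof -
  \<comment> \<open>Orders up to \<open>2 * K\<close> occur, since a row energy is quadratic in the
    row product.\<close>
  define B where "B = (\<Sum>r\<le>2 * K. \<bar>mom r\<bar>)"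
  have B0: "0 \<le> B" by (simp add: B_def sum_nonneg)
  have B: "\<bar>mom r\<bar> \<le> B" if "r \<le> 2 * K" for r
    unfolding B_def using that by (intro member_le_sum) auto
  obtain C1 where C1: "0 \<le> C1" and row_all: "\<forall>(M :: 'a measure) X N w. centred_indep_moments M X N \<longrightarrow>
    (\<forall>j<N. 0 \<le> w j \<and> (\<forall>r\<in>{2..2 * K}. \<bar>\<integral>\<omega>. X j \<omega> ^ r \<partial>M\<bar> \<le> B * w j)) \<longrightarrow>
    (\<forall>r\<le>2 * K. \<bar>\<integral>\<omega>. (\<Sum>j<N. X j \<omega>) ^ r \<partial>M\<bar> \<le> C1 * (1 + (\<Sum>j<N. w j)) ^ (r div 2))"
    using centred_sum_moment_bound[OF B0, of "2 * K"] by (elim exE conjE) (rule that)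
  note row = row_all[THEN spec, THEN spec, THEN spec, THEN spec, THEN mp, THEN mp]
  define C2 where "C2 = 1 + C1 * 2 ^ K / p0 ^ K"
  have C2: "1 \<le> C2" using C1 p0 by (simp add: C2_def)
  define B' where "B' = 2 ^ K * C2"
  have B'0: "0 \<le> B'" using C2 by (simp add: B'_def)
  obtain C3 where C3: "0 \<le> C3" and lay_all: "\<forall>(M :: 'a measure) X N w. centred_indep_moments M X N \<longrightarrow>
    (\<forall>j<N. 0 \<le> w j \<and> (\<forall>r\<in>{2..K}. \<bar>\<integral>\<omega>. X j \<omega> ^ r \<partial>M\<bar> \<le> B' * w j)) \<longrightarrow>
    (\<forall>r\<le>K. \<bar>\<integral>\<omega>. (\<Sum>j<N. X j \<omega>) ^ r \<partial>M\<bar> \<le> C3 * (1 + (\<Sum>j<N. w j)) ^ (r div 2))"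
    using centred_sum_moment_bound[OF B'0, of "K"] by (elim exE conjE) (rule that)
  note lay = lay_all[THEN spec, THEN spec, THEN spec, THEN spec, THEN mp, THEN mp]
  define C where "C = C2 + C3 * 2 ^ K"
  have "random_network.layer_bounds M p d n W \<xi> K C"
    if net: "random_network M \<mu> p d n W \<xi>" and mom: "raw_moment \<mu> = mom" and p: "p0 \<le> p"
    for M :: "'a measure" and \<mu> p d n W \<xi>
  proof -
    interpret random_network M \<mu> p d n W \<xi> by (rule net)
    show ?thesis
      unfolding layer_bounds_def
    proof (intro conjI ballI allI impI)
      show "0 \<le> C" using C2 C3 by (simp add: C_def)
      fix i v assume i: "i \<in> {1..d}" and v: "sq_norm (n (i - 1)) v = 1"
      let ?Y = "\<lambda>j \<omega>. row_energy p (weights \<omega>) (n (i - 1)) i v j"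
      have n0: "0 < n i" using n_pos[of i] i by simp
      have T: "\<bar>\<integral>\<omega>. row_prod (weights \<omega>) (n (i - 1)) i v j ^ r \<partial>M\<bar> \<le> C1 * 2 ^ (r div 2)"
        if j: "j < n i" and r: "r \<le> 2 * K" for j r
      proof -
        have "\<bar>\<integral>\<omega>. (W i j k \<omega> * v k) ^ r \<partial>M\<bar> \<le> B * (v k)\<^sup>2" if k: "k < n (i - 1)" and r: "r \<in> {2..2 * K}" for k r
        proof -
          have v1: "\<bar>v k\<bar> \<le> 1" using v_le_1[OF i v k] by (simp add: abs_square_le_1)
          have "\<bar>\<integral>\<omega>. (W i j k \<omega> * v k) ^ r \<partial>M\<bar> = \<bar>mom r\<bar> * \<bar>v k\<bar> ^ r"
            using W_moment(2)[OF i j k, of r] mom by (simp add: power_mult_distrib abs_mult power_abs)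
          also have "\<dots> \<le> B * \<bar>v k\<bar> ^ 2"
            using B[of r] r B0 v1 by (intro mult_mono power_decreasing) auto
          finally show ?thesis by simp
        qed
        then have "\<bar>\<integral>\<omega>. (\<Sum>k<n (i - 1). W i j k \<omega> * v k) ^ r \<partial>M\<bar> \<le> C1 * (1 + (\<Sum>k<n (i - 1). (v k)\<^sup>2)) ^ (r div 2)"
          using row[OF row_indep_moments[OF i v j], of "\<lambda>k. (v k)\<^sup>2"] r by auto
        then show ?thesis using v unfolding row_prod_eq[OF i v] sq_norm_def by simp
      qed
      have Y: "(\<integral>\<omega>. ?Y j \<omega> ^ r \<partial>M) \<le> C2" if j: "j < n i" and r: "r \<le> K" for j r
      proof (cases "r = 0")
        case True
        then show ?thesis using C2 by (simp add: prob_space)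
      next
        case False
        have "(\<integral>\<omega>. ?Y j \<omega> ^ r \<partial>M) = p / p ^ r * (\<integral>\<omega>. row_prod (weights \<omega>) (n (i - 1)) i v j ^ (2 * r) \<partial>M)"
          using row_energy_moments(2)[OF i v j, of r] False by simp
        also have "\<dots> \<le> 1 / p0 ^ K * (C1 * 2 ^ K)"
        proof (intro mult_mono frac_le)
          have "p0 ^ K \<le> p0 ^ r" using p0 r by (intro power_decreasing) auto
          also have "\<dots> \<le> p ^ r" using p p0 by (intro power_mono) auto
          finally show "p0 ^ K \<le> p ^ r" .
          have "(\<integral>\<omega>. row_prod (weights \<omega>) (n (i - 1)) i v j ^ (2 * r) \<partial>M) \<le> C1 * 2 ^ r"
            using T[OF j, of "2 * r"] r by simp
          also have "\<dots> \<le> C1 * 2 ^ K" using C1 r by (intro mult_left_mono power_increasing) auto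
          finally show "(\<integral>\<omega>. row_prod (weights \<omega>) (n (i - 1)) i v j ^ (2 * r) \<partial>M) \<le> C1 * 2 ^ K" .
        qed (use p0 p_le_1 in auto)
        also have "\<dots> \<le> C2" by (simp add: C2_def)
        finally show ?thesis .
      qed
      have U: "\<bar>\<integral>\<omega>. (?Y j \<omega> - 1) ^ r \<partial>M\<bar> \<le> B' * 1" if j: "j < n i" and r: "r \<in> {2..K}" for j r
      proof -
        have "(?Y j \<omega> - 1) ^ r = (\<Sum>k\<le>r. real (r choose k) * ?Y j \<omega> ^ k * (- 1) ^ (r - k))" for \<omega>
          using binomial_ring[of "?Y j \<omega>" "- 1" r] by simp
        then have "(\<integral>\<omega>. (?Y j \<omega> - 1) ^ r \<partial>M) = (\<Sum>k\<le>r. real (r choose k) * (\<integral>\<omega>. ?Y j \<omega> ^ k \<partial>M) * (- 1) ^ (r - k))"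
          using row_energy_moments(1)[OF i v j] by simp
        also have "\<bar>\<dots>\<bar> \<le> (\<Sum>k\<le>r. real (r choose k) * C2)"
        proof (rule order_trans[OF sum_abs sum_mono])
          fix k assume "k \<in> {..r}"
          then have "(\<integral>\<omega>. ?Y j \<omega> ^ k \<partial>M) \<le> C2" using Y[OF j, of k] r by auto
          moreover have "0 \<le> (\<integral>\<omega>. ?Y j \<omega> ^ k \<partial>M)"
            by (intro Bochner_Integration.integral_nonneg zero_le_power row_energy_nonneg[OF i v])
          ultimately show "\<bar>real (r choose k) * (\<integral>\<omega>. ?Y j \<omega> ^ k \<partial>M) * (- 1) ^ (r - k)\<bar> \<le> real (r choose k) * C2"
            by (simp add: abs_mult power_abs mult_left_mono)
        qed
        also have "\<dots> = 2 ^ r * C2"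
          by (rule sum_binomial_mult)
        also have "\<dots> \<le> B'" unfolding B'_def using C2 r by (intro mult_right_mono power_increasing) auto
        finally show ?thesis by simp
      qed
      have S: "\<bar>\<integral>\<omega>. (\<Sum>j<n i. ?Y j \<omega> - 1) ^ r \<partial>M\<bar> \<le> C3 * (1 + real (n i)) ^ (r div 2)" if r: "r \<le> K" for r
        using lay[OF layer_indep_moments[OF i v], of "\<lambda>_. 1"] U r by auto
      show "\<bar>\<integral>\<omega>. (gain p n (weights \<omega>) i v - 1) ^ r \<partial>M\<bar> \<le> C / (real (n i))\<^sup>2" if r: "r \<in> {3..K}" for r
      proof -
        have n1: "1 \<le> real (n i)" using n0 by simp
        have "\<bar>\<integral>\<omega>. (gain p n (weights \<omega>) i v - 1) ^ r \<partial>M\<bar> = \<bar>\<integral>\<omega>. (\<Sum>j<n i. ?Y j \<omega> - 1) ^ r \<partial>M\<bar> / real (n i) ^ r"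
          unfolding gain_deviation[OF i v] power_divide by simp
        also have "\<dots> \<le> C3 * (2 * real (n i)) ^ (r div 2) / real (n i) ^ r"
        proof (rule divide_right_mono)
          have "C3 * (1 + real (n i)) ^ (r div 2) \<le> C3 * (2 * real (n i)) ^ (r div 2)"
            using n1 C3 by (intro mult_left_mono power_mono) auto
          then show "\<bar>\<integral>\<omega>. (\<Sum>j<n i. ?Y j \<omega> - 1) ^ r \<partial>M\<bar> \<le> C3 * (2 * real (n i)) ^ (r div 2)"
            using S[of r] r by simp
        qed simp
        \<comment> \<open>The exponent \<open>r - r div 2\<close> is at least 2 from
          \<open>r = 3\<close> on. For \<open>r = 2\<close> it is only 1, so the second moment has
          to be known exactly.\<close>
        also have "\<dots> = C3 * 2 ^ (r div 2) / real (n i) ^ (r - r div 2)"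
          using n0 by (simp add: power_mult_distrib power_diff field_simps)
        also have "\<dots> \<le> C / real (n i) ^ 2"
        proof (rule frac_le)
          have "C3 * 2 ^ (r div 2) \<le> C3 * 2 ^ K" using C3 r by (intro mult_left_mono power_increasing) auto
          then show "C3 * 2 ^ (r div 2) \<le> C" using C2 by (simp add: C_def)
          show "real (n i) ^ 2 \<le> real (n i) ^ (r - r div 2)" using n1 r by (intro power_increasing) auto
        qed (use n0 C2 C3 in \<open>auto simp: C_def\<close>)
        finally show ?thesis by simp
      qed
      show "(\<integral>\<omega>. ?Y j \<omega> ^ r \<partial>M) \<le> C" if "j < n i" "r \<le> K" for j r
        by (rule order_trans[OF Y[OF that]]) (simp add: C_def C3)
    qed
  qed
  then show ?thesis by blast
qed

section \<open>The layered network\<close>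

text \<open>A function that is not integrable has integral 0 by convention, and \<open>g\<close>,
  bounding a norm, has a non-negative integral; both cases give the same bound.\<close>

lemma norm_integral_le:
  fixes f :: "'b \<Rightarrow> 'c::{banach, second_countable_topology}"
  assumes "integrable M g" "\<And>x. x \<in> space M \<Longrightarrow> norm (f x) \<le> g x"
  shows "norm (\<integral>x. f x \<partial>M) \<le> (\<integral>x. g x \<partial>M)"
proof (cases "integrable M f")
  case True
  show ?thesis
    by (rule order_trans[OF integral_norm_bound integral_mono[OF integrable_norm[OF True] assms(1)]])
       (rule assms(2))
next
  case False
  then have "(\<integral>x. f x \<partial>M) = 0" by (rule not_integrable_integral_eq)
  moreover have "0 \<le> (\<integral>x. g x \<partial>M)"
    using assms(2) norm_ge_zero order_trans by (intro Bochner_Integration.integral_nonneg_AE AE_I2) blast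
  ultimately show ?thesis by simp
qed

text \<open>The zero vector is sent to the first basis vector, so that for \<open>0 < m\<close> the
  result is a unit vector in all cases; entries outside the range are set to 0.\<close>

definition direction :: "nat \<Rightarrow> (nat \<Rightarrow> real) \<Rightarrow> nat \<Rightarrow> real" where
  "direction m v k = (if k < m then if sq_norm m v = 0 then of_bool (k = 0) else v k / sqrt (sq_norm m v) else 0)"

lemma sq_norm_nonneg: "0 \<le> sq_norm m v"
  by (simp add: sq_norm_def sum_nonneg)

lemma sq_norm_direction:
  assumes "0 < m"
  shows "sq_norm m (direction m v) = 1"
proof (cases "sq_norm m v = 0")
  case True
  then have "sq_norm m (direction m v) = (\<Sum>k<m. of_bool (k = 0))"
    unfolding sq_norm_def[of m "direction m v"] by (intro sum.cong) (auto simp: direction_def)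
  then show ?thesis using assms by (simp add: of_bool_def if_distrib cong: if_cong)
next
  case False
  then have "sq_norm m (direction m v) = (\<Sum>k<m. (v k)\<^sup>2 / sq_norm m v)"
    unfolding sq_norm_def[of m "direction m v"]
    by (intro sum.cong) (auto simp: direction_def power_divide sq_norm_nonneg)
  also have "\<dots> = sq_norm m v / sq_norm m v" by (simp add: sq_norm_def flip: sum_divide_distrib)
  finally show ?thesis using False by simp
qed

lemma direction_scale: "k < m \<Longrightarrow> v k = sqrt (sq_norm m v) * direction m v k"
  using sum_nonneg_eq_0_iff[of "{..<m}" "\<lambda>k. (v k)\<^sup>2"] by (auto simp: direction_def sq_norm_def)

lemma direction_unit: "sq_norm m v = 1 \<Longrightarrow> k < m \<Longrightarrow> direction m v k = v k"
  by (simp add: direction_def)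

section \<open>The state, its heading, and functions of the past layers\<close>

fun state :: "real \<Rightarrow> (nat \<Rightarrow> nat) \<Rightarrow> real vec \<Rightarrow> (param \<Rightarrow> real) \<Rightarrow> nat \<Rightarrow> nat \<Rightarrow> real" where
  "state p n u x 0 = ($) u"
| "state p n u x (Suc i) =
    (\<lambda>j. x (Inr (Suc i, j)) * row_prod x (n i) (Suc i) (state p n u x i) j / sqrt (p * real (n i)))"

text \<open>The direction of the state, restarted at the first basis vector once a layer vanishes. Thus the
  gains keep the same conditional moments after the state has died.\<close>

fun heading :: "(nat \<Rightarrow> nat) \<Rightarrow> real vec \<Rightarrow> (param \<Rightarrow> real) \<Rightarrow> nat \<Rightarrow> nat \<Rightarrow> real" where
  "heading n u x 0 = direction (n 0) (($) u)"
| "heading n u x (Suc i) =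
    direction (n (Suc i)) (\<lambda>j. x (Inr (Suc i, j)) * row_prod x (n i) (Suc i) (heading n u x i) j)"

definition past_params :: "(nat \<Rightarrow> nat) \<Rightarrow> nat \<Rightarrow> param set" where
  "past_params n i = (\<Union>l\<in>{1..i}. layer_params n l)"

text \<open>Measurability with respect to the first \<open>i\<close> layers, expressed on
  coordinates. Elements of the product space are undefined outside \<open>past_params n i\<close>,
  whereas \<open>weights \<omega>\<close> is not; invariance under restriction mediates between the
  two.\<close>

definition adapted :: "(nat \<Rightarrow> nat) \<Rightarrow> nat \<Rightarrow> ((param \<Rightarrow> real) \<Rightarrow> 'c::topological_space) \<Rightarrow> bool" where
  "adapted n i g \<longleftrightarrow> g \<in> borel_measurable (PiM (past_params n i) (\<lambda>_. borel)) \<and>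
     (\<forall>x. g (restrict x (past_params n i)) = g x)"

lemma past_params_mono: "l \<le> i \<Longrightarrow> past_params n l \<subseteq> past_params n i"
  unfolding past_params_def by (intro UN_mono) auto

lemma layer_params_mem:
  "j < n i \<Longrightarrow> Inr (i, j) \<in> layer_params n i"
  "j < n i \<Longrightarrow> k < n (i - 1) \<Longrightarrow> Inl (i, j, k) \<in> layer_params n i"
  by (auto simp: layer_params_def row_params_def)

lemma layer_params_subset_past: "layer_params n (Suc i) \<subseteq> past_params n (Suc i)"
  unfolding past_params_def by (rule UN_upper) simp

lemma adapted_mono:
  assumes "adapted n l g" "l \<le> i"
  shows "adapted n i g"
proof -
  have sub: "past_params n l \<subseteq> past_params n i" using past_params_mono[OF assms(2)] .
  have g: "g (restrict x (past_params n l)) = g x" for x using assms(1) by (simp add: adapted_def)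
  have "(\<lambda>x. g (restrict x (past_params n l))) \<in> borel_measurable (PiM (past_params n i) (\<lambda>_. borel))"
    using assms(1) unfolding adapted_def
    by (intro measurable_compose[OF measurable_restrict_subset[OF sub]]) auto
  moreover have "g (restrict x (past_params n i)) = g x" for x
    using g[of "restrict x (past_params n i)"] g[of x] sub
    by (simp add: Int_absorb1 restrict_restrict)
  ultimately show ?thesis by (simp add: adapted_def g)
qed

lemma adapted_const: "adapted n i (\<lambda>_. c)"
  by (simp add: adapted_def)

lemma adapted_param:
  assumes "s \<in> past_params n i"
  shows "adapted n i (\<lambda>x. x s)"
  using assms by (auto simp: adapted_def intro: measurable_component_singleton)

lemma adapted_compose:
  assumes "adapted n i f" "h \<in> borel_measurable borel"
  shows "adapted n i (\<lambda>x. h (f x))"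
  using assms by (auto simp: adapted_def intro: measurable_compose)

lemma adapted_mult:
  fixes f g :: "(param \<Rightarrow> real) \<Rightarrow> real"
  shows "adapted n i f \<Longrightarrow> adapted n i g \<Longrightarrow> adapted n i (\<lambda>x. f x * g x)"
  unfolding adapted_def by (auto intro!: borel_measurable_times)

lemma adapted_divide:
  fixes f g :: "(param \<Rightarrow> real) \<Rightarrow> real"
  shows "adapted n i f \<Longrightarrow> adapted n i g \<Longrightarrow> adapted n i (\<lambda>x. f x / g x)"
  unfolding adapted_def by (auto intro!: borel_measurable_divide)

lemma adapted_sum:
  fixes f :: "'b \<Rightarrow> (param \<Rightarrow> real) \<Rightarrow> real"
  shows "(\<And>k. k \<in> A \<Longrightarrow> adapted n i (f k)) \<Longrightarrow> adapted n i (\<lambda>x. \<Sum>k\<in>A. f k x)"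
  unfolding adapted_def by (auto intro!: borel_measurable_sum sum.cong)

lemma adapted_power:
  fixes f :: "(param \<Rightarrow> real) \<Rightarrow> real"
  shows "adapted n i f \<Longrightarrow> adapted n i (\<lambda>x. f x ^ r)"
  unfolding adapted_def by (auto intro!: borel_measurable_power)

lemma adapted_if:
  fixes f g h :: "(param \<Rightarrow> real) \<Rightarrow> real"
  assumes "adapted n i f" "adapted n i g" "adapted n i h"
  shows "adapted n i (\<lambda>x. if f x = 0 then g x else h x)"
  using assms unfolding adapted_def by (auto intro!: measurable_If borel_measurable_eq)

lemma adapted_direction:
  fixes v :: "(param \<Rightarrow> real) \<Rightarrow> nat \<Rightarrow> real"
  assumes "\<And>k. k < m \<Longrightarrow> adapted n i (\<lambda>x. v x k)"
  shows "adapted n i (\<lambda>x. direction m (v x) k)"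
proof (cases "k < m")
  case True
  then show ?thesis
    unfolding direction_def sq_norm_def
    by (simp only: if_True) (intro adapted_if adapted_const adapted_divide adapted_sum adapted_power assms
        adapted_compose[where h=sqrt], auto)
qed (simp add: direction_def adapted_const)

lemma adapted_heading: "adapted n i (\<lambda>x. heading n u x i k)"
proof (induction i arbitrary: k)
  case 0
  show ?case by (simp add: adapted_const)
next
  case (Suc i)
  have mem: "j < n (Suc i) \<Longrightarrow> Inr (Suc i, j) \<in> past_params n (Suc i)"
    "j < n (Suc i) \<Longrightarrow> k < n i \<Longrightarrow> Inl (Suc i, j, k) \<in> past_params n (Suc i)" for j k
    using layer_params_mem[of j n "Suc i"] layer_params_subset_past[of n i] by auto
  show ?case
    unfolding heading.simps row_prod_def
    by (intro adapted_direction adapted_mult adapted_sum adapted_param mem adapted_mono[OF Suc.IH]) auto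
qed

definition step_gain :: "real \<Rightarrow> (nat \<Rightarrow> nat) \<Rightarrow> real vec \<Rightarrow> (param \<Rightarrow> real) \<Rightarrow> nat \<Rightarrow> real" where
  "step_gain p n u x i = gain p n x (Suc i) (heading n u x i)"

text \<open>The normalised squared norm of the state; \<open>state_heading\<close> justifies this.
  Once a gain is 0 the product stays 0, although later gains continue along restarted
  headings.\<close>

definition energy :: "real \<Rightarrow> (nat \<Rightarrow> nat) \<Rightarrow> real vec \<Rightarrow> (param \<Rightarrow> real) \<Rightarrow> nat \<Rightarrow> real" where
  "energy p n u x i = (\<Prod>l<i. step_gain p n u x l)"

lemma adapted_step_gain: "adapted n (Suc i) (\<lambda>x. step_gain p n u x i)"
proof -
  have mem: "j < n (Suc i) \<Longrightarrow> Inr (Suc i, j) \<in> past_params n (Suc i)"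
    "j < n (Suc i) \<Longrightarrow> k < n i \<Longrightarrow> Inl (Suc i, j, k) \<in> past_params n (Suc i)" for j k
    using layer_params_mem[of j n "Suc i"] layer_params_subset_past[of n i] by auto
  show ?thesis
    unfolding step_gain_def gain_def row_energy_def row_prod_def
    by (intro adapted_divide adapted_sum adapted_power adapted_mult adapted_const adapted_param mem
        adapted_mono[OF adapted_heading]) auto
qed

lemma adapted_energy: "adapted n i (\<lambda>x. energy p n u x i)"
proof (induction i)
  case (Suc i)
  then show ?case
    using adapted_mult[OF adapted_mono[OF Suc] adapted_step_gain] by (simp add: energy_def)
qed (simp add: energy_def adapted_const)

lemma layer_sq_norm:
  assumes "0 < p" "0 < n (Suc i)"
  shows "sq_norm (n (Suc i)) (\<lambda>j. x (Inr (Suc i, j)) * row_prod x (n i) (Suc i) (heading n u x i) j) =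
    p * real (n (Suc i)) * step_gain p n u x i"
  using assms by (simp add: sq_norm_def step_gain_def gain_def row_energy_def flip: sum_divide_distrib)

lemma gain_nonneg: "0 < p \<Longrightarrow> 0 \<le> gain p n x i v"
  by (simp add: gain_def row_energy_def sum_nonneg)

text \<open>The heading is \<open>w\<close> divided by its norm, whose square is
  \<open>p * n (Suc i)\<close> times the gain. The factor
  \<open>(step_gain p n u x i)\<^sup>2\<close> clears this denominator and leaves a polynomial in
  the row energies. For a vanishing gain both sides are 0.\<close>

lemma quart_norm_heading_Suc:
  assumes p: "0 < p" and n: "0 < n (Suc i)"
  shows "quart_norm (n (Suc i)) (heading n u x (Suc i)) * (step_gain p n u x i)\<^sup>2 =
    (\<Sum>j<n (Suc i). (row_energy p x (n i) (Suc i) (heading n u x i) j)\<^sup>2) / (real (n (Suc i)))\<^sup>2"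
proof -
  define w where "w j = x (Inr (Suc i, j)) * row_prod x (n i) (Suc i) (heading n u x i) j" for j
  define Q where "Q = step_gain p n u x i"
  define N where "N = n (Suc i)"
  have sq: "sq_norm N w = p * real N * Q"
    unfolding w_def N_def Q_def by (rule layer_sq_norm[where n = n, OF assms])
  have y: "row_energy p x (n i) (Suc i) (heading n u x i) j = (w j)\<^sup>2 / p" for j
    by (simp add: row_energy_def w_def)
  have h: "heading n u x (Suc i) = direction N w" by (simp add: w_def[abs_def] N_def)
  have N: "0 < N" using n by (simp add: N_def)
  have "quart_norm N (direction N w) * Q\<^sup>2 = (\<Sum>j<N. ((w j)\<^sup>2 / p)\<^sup>2) / (real N)\<^sup>2"
  proof (cases "sq_norm N w = 0")
    case True
    then have "Q = 0" using sq p N by simp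
    moreover have "w j = 0" if "j < N" for j
      using direction_scale[of j N w] that True by simp
    ultimately show ?thesis by simp
  next
    case False
    have "direction N w j ^ 4 * Q\<^sup>2 = ((w j)\<^sup>2 / p)\<^sup>2 / (real N)\<^sup>2" if "j < N" for j
    proof -
      have "direction N w j ^ 4 = ((direction N w j)\<^sup>2)\<^sup>2" by (simp flip: power_mult)
      also have "(direction N w j)\<^sup>2 = (w j)\<^sup>2 / (p * real N * Q)"
        using that False sq_norm_nonneg[of N w] by (simp add: direction_def power_divide sq)
      finally show ?thesis using False p N unfolding sq by (simp add: power_divide power_mult_distrib)
    qed
    then show ?thesis by (simp add: quart_norm_def sum_distrib_right sum_divide_distrib)
  qed
  then show ?thesis unfolding h y N_def[symmetric] Q_def[symmetric] .
qed

text \<open>A layer is linear, so the scalar in front of the heading passes through it, and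
  \<open>direction_scale\<close> splits off the next norm. This remains true when the layer kills
  the state: the energy is then 0, and the arbitrary restarted heading is multiplied by 0.\<close>

lemma state_heading:
  assumes p: "0 < p" and u: "sq_norm (n 0) (($) u) = 1"
  shows "(\<And>l. l \<le> i \<Longrightarrow> 0 < n l) \<Longrightarrow> k < n i \<Longrightarrow>
    state p n u x i k = sqrt (energy p n u x i * real (n i) / real (n 0)) * heading n u x i k"
proof (induction i arbitrary: k)
  case 0
  then show ?case using u by (simp add: energy_def direction_unit)
next
  case (Suc i)
  define w where "w j = x (Inr (Suc i, j)) * row_prod x (n i) (Suc i) (heading n u x i) j" for j
  define c where "c = sqrt (energy p n u x i * real (n i) / real (n 0))"
  define Q where "Q = step_gain p n u x i"
  have n: "0 < n i" "0 < n (Suc i)" "0 < n 0" using Suc.prems(1) by auto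
  have sq: "sq_norm (n (Suc i)) w = p * real (n (Suc i)) * Q"
    unfolding w_def Q_def by (rule layer_sq_norm[where n = n, OF p n(2)])
  have "row_prod x (n i) (Suc i) (state p n u x i) k = c * row_prod x (n i) (Suc i) (heading n u x i) k"
    unfolding row_prod_def sum_distrib_left using Suc by (intro sum.cong) (auto simp: c_def)
  then have "state p n u x (Suc i) k = c / sqrt (p * real (n i)) * w k"
    by (simp add: w_def)
  also have "w k = sqrt (p * real (n (Suc i)) * Q) * direction (n (Suc i)) w k"
    using direction_scale[OF Suc.prems(2), of w] by (simp add: sq)
  also have "c / sqrt (p * real (n i)) * (sqrt (p * real (n (Suc i)) * Q) * direction (n (Suc i)) w k) =
      sqrt (energy p n u x i * real (n i) / real (n 0) / (p * real (n i)) * (p * real (n (Suc i)) * Q)) *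
      direction (n (Suc i)) w k"
    by (simp only: c_def real_sqrt_mult real_sqrt_divide mult.assoc times_divide_eq_left times_divide_eq_right)
  also have "energy p n u x i * real (n i) / real (n 0) / (p * real (n i)) * (p * real (n (Suc i)) * Q) =
      energy p n u x (Suc i) * real (n (Suc i)) / real (n 0)"
    using p n by (simp add: energy_def Q_def)
  finally show ?case by (simp add: w_def[abs_def])
qed

lemma matrix_product_state:
  assumes u: "u \<in> carrier_vec (n 0)" and p: "0 < p"
    and x: "\<And>i j k. x (Inl (i, j, k)) = W i j k \<omega>" "\<And>i j. x (Inr (i, j)) = \<xi> i j \<omega>"
  shows "matrix_product p n W \<xi> i \<omega> \<in> carrier_mat (n i) (n 0)"
    and "j < n i \<Longrightarrow> (matrix_product p n W \<xi> i \<omega> *\<^sub>v u) $ j = state p n u x i j"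
proof -
  have L: "layer_matrix p n W \<xi> (Suc i) \<omega> \<in> carrier_mat (n (Suc i)) (n i)" for i
    unfolding layer_matrix_def
    by (intro smult_carrier_mat mult_carrier_mat[where n = "n (Suc i)"]) (auto simp: mat_diag_def)
  show P: "matrix_product p n W \<xi> i \<omega> \<in> carrier_mat (n i) (n 0)" for i
    by (induction i) (auto intro!: mult_carrier_mat[OF L])
  show "j < n i \<Longrightarrow> (matrix_product p n W \<xi> i \<omega> *\<^sub>v u) $ j = state p n u x i j"
  proof (induction i arbitrary: j)
    case 0
    then show ?case using u by simp
  next
    case (Suc i)
    let ?w = "matrix_product p n W \<xi> i \<omega> *\<^sub>v u"
    have w: "?w \<in> carrier_vec (n i)" by (rule mult_mat_vec_carrier[OF P u])
    have "matrix_product p n W \<xi> (Suc i) \<omega> *\<^sub>v u = layer_matrix p n W \<xi> (Suc i) \<omega> *\<^sub>v ?w"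
      using assoc_mult_mat_vec[OF L P u] by simp
    moreover have "(layer_matrix p n W \<xi> (Suc i) \<omega> *\<^sub>v w) $ j =
        (\<Sum>k<n i. layer_matrix p n W \<xi> (Suc i) \<omega> $$ (j, k) * w $ k)" if "w \<in> carrier_vec (n i)" for w
      using L[of i] that Suc.prems by (auto simp: scalar_prod_def lessThan_atLeast0 carrier_matD)
    moreover have "layer_matrix p n W \<xi> (Suc i) \<omega> $$ (j, k) =
        (p * real (n i)) powr (- 1 / 2) * (\<xi> (Suc i) j \<omega> * W (Suc i) j k \<omega>)" if "k < n i" for k
      using that Suc.prems by (simp add: layer_matrix_def mat_diag_mult_left[of _ "n (Suc i)" "n i"])
    ultimately have "(matrix_product p n W \<xi> (Suc i) \<omega> *\<^sub>v u) $ j =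
        (\<Sum>k<n i. (p * real (n i)) powr (- 1 / 2) * (\<xi> (Suc i) j \<omega> * W (Suc i) j k \<omega>) * ?w $ k)"
      using w by simp
    also have "\<dots> = (p * real (n i)) powr (- 1 / 2) * (\<xi> (Suc i) j \<omega> * (\<Sum>k<n i. W (Suc i) j k \<omega> * state p n u x i k))"
      by (simp add: Suc.IH sum_distrib_left mult.assoc)
    also have "(p * real (n i)) powr (- 1 / 2) = 1 / sqrt (p * real (n i))"
      using p powr_minus_divide[of "p * real (n i)" "1/2"] by (simp add: powr_half_sqrt)
    finally show ?case by (simp add: x row_prod_def)
  qed
qed

section \<open>A network with unit input, and conditioning of a layer on its past\<close>

locale network = random_network M \<mu> p d n W \<xi>
  for M :: "'a measure" and \<mu> p d n W \<xi> +
  fixes u :: "real vec"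
  assumes u_carrier: "u \<in> carrier_vec (n 0)" and u_unit: "l2_norm u = 1"
begin

abbreviation dir :: "(param \<Rightarrow> real) \<Rightarrow> nat \<Rightarrow> nat \<Rightarrow> real" where
  "dir x i \<equiv> heading n u x i"

abbreviation deviation :: "'a \<Rightarrow> nat \<Rightarrow> real" where
  "deviation \<omega> i \<equiv> step_gain p n u (weights \<omega>) i - 1"

lemma l2_norm_matrix_product:
  assumes "i \<le> d"
  shows "(l2_norm (matrix_product p n W \<xi> i \<omega> *\<^sub>v u))\<^sup>2 = sq_norm (n i) (state p n u (weights \<omega>) i)"
proof -
  note S = matrix_product_state[where x = "weights \<omega>" and W = W and \<xi> = \<xi> and \<omega> = \<omega> and n = n and u = u and p = p,
      OF u_carrier p_pos weights_simps(1) weights_simps(2)]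
  have dim: "dim_vec (matrix_product p n W \<xi> i \<omega> *\<^sub>v u) = n i" using S(1)[of i] by auto
  show ?thesis
    unfolding l2_norm_def dim sq_norm_def using S(2) by (simp add: sum_nonneg)
qed

lemma sq_norm_u: "sq_norm (n 0) (($) u) = 1"
proof -
  have "(l2_norm u)\<^sup>2 = sq_norm (n 0) (($) u)"
    using u_carrier by (auto simp: l2_norm_def sq_norm_def sum_nonneg)
  then show ?thesis by (simp add: u_unit)
qed

lemma energy_0: "energy p n u x 0 = 1"
  by (simp add: energy_def)

lemma energy_step: "energy p n u x (Suc i) = energy p n u x i * step_gain p n u x i"
  by (simp add: energy_def)

lemma step_gain_nonneg: "0 \<le> step_gain p n u x i"
  unfolding step_gain_def by (rule gain_nonneg[OF p_pos])

lemma energy_nonneg: "0 \<le> energy p n u x i"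
  by (simp add: energy_def prod_nonneg step_gain_nonneg)

lemma dir_unit: "i \<le> d \<Longrightarrow> sq_norm (n i) (dir x i) = 1"
  using n_pos[of i] by (cases i) (auto intro: sq_norm_direction)

lemma quart_norm_dir_0: "quart_norm (n 0) (dir x 0) = l4_norm_pow4 u"
  using u_carrier sq_norm_u unfolding quart_norm_def l4_norm_pow4_def by (auto intro!: sum.cong simp: direction_unit)

lemma scaled_sq_norm_eq: "scaled_sq_norm p d n W \<xi> u \<omega> = energy p n u (weights \<omega>) d"
proof -
  have "sq_norm (n d) (state p n u (weights \<omega>) d) =
      (\<Sum>k<n d. energy p n u (weights \<omega>) d * real (n d) / real (n 0) * (dir (weights \<omega>) d k)\<^sup>2)"
    unfolding sq_norm_def using energy_nonneg n_pos
    by (intro sum.cong refl) (simp add: state_heading[where n = n, OF p_pos sq_norm_u] power_mult_distrib)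
  also have "\<dots> = energy p n u (weights \<omega>) d * real (n d) / real (n 0)"
    unfolding sum_distrib_left[symmetric] sq_norm_def[symmetric] dir_unit[OF order_refl] by simp
  finally show ?thesis
    unfolding scaled_sq_norm_def l2_norm_matrix_product[OF order_refl] using n_pos[of 0] n_pos[of d] by simp
qed

lemma past_params_subset: "i \<le> d \<Longrightarrow> past_params n i \<subseteq> params"
  using layer_params_subset by (fastforce simp: past_params_def)

lemma measurable_adapted:
  assumes "adapted n i g" "i \<le> d"
  shows "(\<lambda>\<omega>. g (weights \<omega>)) \<in> borel_measurable M"
proof -
  have "(\<lambda>\<omega>. restrict (weights \<omega>) (past_params n i)) \<in> measurable M (PiM (past_params n i) (\<lambda>_. borel))"
    by (rule measurable_restrict[where X = "\<lambda>s \<omega>. weights \<omega> s"], rule rv_weights)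
       (use past_params_subset[OF assms(2)] in blast)
  from measurable_compose[OF this, of g borel] assms(1)
  have "(\<lambda>\<omega>. g (restrict (weights \<omega>) (past_params n i))) \<in> borel_measurable M"
    by (simp add: adapted_def)
  then show ?thesis using assms(1) by (simp add: adapted_def)
qed

text \<open>The heading is a function of the past and is independent of the fresh layer. It can
  therefore be frozen to a fixed unit vector \<open>v\<close> while the layer is integrated out,
  after which the single-layer moments apply.\<close>

lemma conditioning:
  fixes g :: "(param \<Rightarrow> real) \<Rightarrow> 'c::{banach, second_countable_topology}"
    and f :: "(param \<Rightarrow> real) \<Rightarrow> (nat \<Rightarrow> real) \<Rightarrow> real"
  assumes i: "i < d" and g: "adapted n i g" "integrable M (\<lambda>\<omega>. g (weights \<omega>))"
    and f: "(\<lambda>(x, y). f y (dir x i)) \<in> borel_measurable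
      (PiM (past_params n i) (\<lambda>_. borel) \<Otimes>\<^sub>M PiM (layer_params n (Suc i)) (\<lambda>_. borel))"
    and f_local: "\<And>x v. f (restrict x (layer_params n (Suc i))) v = f x v"
    and f_int: "\<And>v. sq_norm (n i) v = 1 \<Longrightarrow> integrable M (\<lambda>\<omega>. f (weights \<omega>) v)"
    and f_bound: "\<And>v. sq_norm (n i) v = 1 \<Longrightarrow> (\<integral>\<omega>. \<bar>f (weights \<omega>) v\<bar> \<partial>M) \<le> C"
  shows "integrable M (\<lambda>\<omega>. f (weights \<omega>) (dir (weights \<omega>) i) *\<^sub>R g (weights \<omega>))"
    and "(\<integral>\<omega>. f (weights \<omega>) (dir (weights \<omega>) i) *\<^sub>R g (weights \<omega>) \<partial>M) =
      (\<integral>\<omega>. (\<integral>\<omega>'. f (weights \<omega>') (dir (weights \<omega>) i) \<partial>M) *\<^sub>R g (weights \<omega>) \<partial>M)"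
proof -
  let ?A = "past_params n i" and ?B = "layer_params n (Suc i)"
  have ind: "indep_var (PiM ?A (\<lambda>_. borel)) (\<lambda>\<omega>. restrict (\<lambda>s. weights \<omega> s) ?A)
      (PiM ?B (\<lambda>_. borel)) (\<lambda>\<omega>. restrict (\<lambda>s. weights \<omega> s) ?B)"
  proof (rule indep_var_restrict[OF indep_weights])
    show "?A \<inter> ?B = {}" by (auto simp: past_params_def layer_params_def row_params_def)
  qed (use i past_params_subset layer_params_subset in auto)
  have unit: "sq_norm (n i) (dir x i) = 1" for x
    using dir_unit[of i x] i by simp
  have gr: "g (restrict x ?A) = g x" for x using g by (simp add: adapted_def)
  have dr: "dir (restrict x ?A) i = dir x i" for x
    using adapted_heading[of n i u] by (auto simp: adapted_def)
  note F = integrable_indep_var_freeze[OF ind, of g "\<lambda>(x, y). f y (dir x i)" C] integral_indep_var_freeze[OF ind, of g "\<lambda>(x, y). f y (dir x i)" C]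
  show "integrable M (\<lambda>\<omega>. f (weights \<omega>) (dir (weights \<omega>) i) *\<^sub>R g (weights \<omega>))"
    using F(1) g f f_int[OF unit] f_bound[OF unit] unfolding adapted_def by (simp add: gr dr f_local)
  show "(\<integral>\<omega>. f (weights \<omega>) (dir (weights \<omega>) i) *\<^sub>R g (weights \<omega>) \<partial>M) =
      (\<integral>\<omega>. (\<integral>\<omega>'. f (weights \<omega>') (dir (weights \<omega>) i) \<partial>M) *\<^sub>R g (weights \<omega>) \<partial>M)"
    using F(2) g f f_int[OF unit] f_bound[OF unit] unfolding adapted_def by (simp add: gr dr f_local)
qed

lemma measurable_row_energy_pair:
  assumes "j < n (Suc i)"
  shows "(\<lambda>(x, y). row_energy p y (n i) (Suc i) (dir x i) j) \<in> borel_measurable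
      (PiM (past_params n i) (\<lambda>_. borel) \<Otimes>\<^sub>M PiM (layer_params n (Suc i)) (\<lambda>_. borel))"
proof -
  have mem: "Inr (Suc i, j) \<in> layer_params n (Suc i)"
    "k < n i \<Longrightarrow> Inl (Suc i, j, k) \<in> layer_params n (Suc i)" for k
    using assms by (auto simp: layer_params_def row_params_def)
  have s: "(\<lambda>z. snd z s) \<in> borel_measurable
      (PiM (past_params n i) (\<lambda>_. borel) \<Otimes>\<^sub>M PiM (layer_params n (Suc i)) (\<lambda>_. borel :: real measure))"
    if "s \<in> layer_params n (Suc i)" for s :: param
    by (rule measurable_compose[OF measurable_snd measurable_component_singleton[OF that]])
  have "(\<lambda>x. dir x i k) \<in> borel_measurable (PiM (past_params n i) (\<lambda>_. borel))" for k
    using adapted_heading[of n i u k] by (simp add: adapted_def)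
  then have f: "(\<lambda>z. dir (fst z) i k) \<in> borel_measurable
      (PiM (past_params n i) (\<lambda>_. borel) \<Otimes>\<^sub>M PiM (layer_params n (Suc i)) (\<lambda>_. borel :: real measure))" for k
    by (rule measurable_compose[OF measurable_fst])
  show ?thesis
    unfolding row_energy_def row_prod_def split_beta'
    by (intro borel_measurable_divide borel_measurable_power borel_measurable_times
          borel_measurable_sum borel_measurable_const s f mem) auto
qed

lemma row_energy_local:
  assumes "j < n (Suc i)"
  shows "row_energy p (restrict x (layer_params n (Suc i))) (n i) (Suc i) v j = row_energy p x (n i) (Suc i) v j"
proof -
  have mem: "Inr (Suc i, j) \<in> layer_params n (Suc i)"
    "k < n i \<Longrightarrow> Inl (Suc i, j, k) \<in> layer_params n (Suc i)" for k
    using assms by (auto simp: layer_params_def row_params_def)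
  then have "row_prod (restrict x (layer_params n (Suc i))) (n i) (Suc i) v j = row_prod x (n i) (Suc i) v j"
    unfolding row_prod_def by (intro sum.cong) auto
  with mem show ?thesis by (simp add: row_energy_def)
qed

context
  fixes K :: nat and C :: real
  assumes bounds: "layer_bounds K C"
begin

lemma C_nonneg: "0 \<le> C"
  using bounds by (simp add: layer_bounds_def)

lemma gain_bound:
  assumes "i < d" "sq_norm (n i) v = 1" "3 \<le> r" "r \<le> K"
  shows "\<bar>\<integral>\<omega>. (gain p n (weights \<omega>) (Suc i) v - 1) ^ r \<partial>M\<bar> \<le> C / (real (n (Suc i)))\<^sup>2"
  using bounds assms unfolding layer_bounds_def by (auto dest!: bspec[of _ _ "Suc i"])

lemma row_energy_bound:
  assumes "i < d" "sq_norm (n i) v = 1" "j < n (Suc i)" "r \<le> K"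
  shows "(\<integral>\<omega>. row_energy p (weights \<omega>) (n i) (Suc i) v j ^ r \<partial>M) \<le> C"
  using bounds assms unfolding layer_bounds_def by (auto dest!: bspec[of _ _ "Suc i"])

lemma gain_abs_bound:
  assumes i: "i < d" and v: "sq_norm (n i) v = 1" and r: "4 * r + 4 \<le> K"
  shows "(\<integral>\<omega>. \<bar>(gain p n (weights \<omega>) (Suc i) v - 1) ^ r\<bar> \<partial>M) \<le> 1 + C"
proof -
  have Si: "Suc i \<in> {1..d}" using i by auto
  have v': "sq_norm (n (Suc i - 1)) v = 1" using v by simp
  note I = gain_moments(1)[OF Si v']
  \<comment> \<open>Trades an absolute moment for a signed one: the exponent
    \<open>4 * r + 4\<close> is even, at least \<open>r\<close>, and at least 3 as
    \<open>gain_bound\<close> requires. This is the source of the conditions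
    \<open>4 * r + 4 \<le> K\<close>.\<close>
  have pt: "\<bar>z ^ r\<bar> \<le> 1 + z ^ (4 * r + 4)" for z :: real
  proof (cases "\<bar>z\<bar> \<le> 1")
    case True
    have "\<bar>z\<bar> ^ r \<le> 1" using True by (simp add: power_le_one)
    moreover have "0 \<le> z ^ (4 * r + 4)" by (rule zero_le_even_power) simp
    ultimately show ?thesis unfolding power_abs by linarith
  next
    case False
    then have "\<bar>z\<bar> ^ r \<le> \<bar>z\<bar> ^ (4 * r + 4)" by (intro power_increasing) auto
    also have "\<dots> = z ^ (4 * r + 4)" by (rule power_even_abs) simp
    finally show ?thesis by (simp add: power_abs)
  qed
  have "(\<integral>\<omega>. \<bar>(gain p n (weights \<omega>) (Suc i) v - 1) ^ r\<bar> \<partial>M) \<le>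
      (\<integral>\<omega>. 1 + (gain p n (weights \<omega>) (Suc i) v - 1) ^ (4 * r + 4) \<partial>M)"
    by (rule integral_mono) (use I pt in auto)
  also have "\<dots> = 1 + (\<integral>\<omega>. (gain p n (weights \<omega>) (Suc i) v - 1) ^ (4 * r + 4) \<partial>M)"
    using I by (simp add: prob_space)
  also have "\<dots> \<le> 1 + C / (real (n (Suc i)))\<^sup>2"
    using gain_bound[OF i v, of "4 * r + 4"] r by simp
  also have "\<dots> \<le> 1 + C"
    using C_nonneg n_pos[of "Suc i"] i by (simp add: divide_le_eq mult_le_cancel_left1)
  finally show ?thesis .
qed

context
  fixes i :: nat and g :: "(param \<Rightarrow> real) \<Rightarrow> 'c::{banach, second_countable_topology}"
  assumes i: "i < d" and g: "adapted n i g" "integrable M (\<lambda>\<omega>. g (weights \<omega>))"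
begin

text \<open>The values of \<open>g\<close> lie in a Banach space so that real powers of the energy
  and complex phases are covered alike.\<close>

lemma deviation_power:
  assumes r: "4 * r + 4 \<le> K"
  shows "integrable M (\<lambda>\<omega>. deviation \<omega> i ^ r *\<^sub>R g (weights \<omega>))"
    and "(\<integral>\<omega>. deviation \<omega> i ^ r *\<^sub>R g (weights \<omega>) \<partial>M) =
      (\<integral>\<omega>. (\<integral>\<omega>'. (gain p n (weights \<omega>') (Suc i) (dir (weights \<omega>) i) - 1) ^ r \<partial>M) *\<^sub>R g (weights \<omega>) \<partial>M)"
proof -
  let ?f = "\<lambda>y v. (gain p n y (Suc i) v - 1) ^ r"
  have Si: "Suc i \<in> {1..d}" using i by auto
  have meas: "(\<lambda>(x, y). ?f y (dir x i)) \<in> borel_measurable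
      (PiM (past_params n i) (\<lambda>_. borel) \<Otimes>\<^sub>M PiM (layer_params n (Suc i)) (\<lambda>_. borel))"
    using measurable_row_energy_pair unfolding gain_def split_beta'
    by (intro borel_measurable_divide borel_measurable_power borel_measurable_diff
          borel_measurable_sum borel_measurable_const) auto
  have loc: "?f (restrict x (layer_params n (Suc i))) v = ?f x v" for x v
    by (simp add: gain_def row_energy_local)
  have int: "integrable M (\<lambda>\<omega>. ?f (weights \<omega>) v)" if "sq_norm (n i) v = 1" for v
    using gain_moments(1)[OF Si, of v r] that by simp
  show "integrable M (\<lambda>\<omega>. deviation \<omega> i ^ r *\<^sub>R g (weights \<omega>))"
    unfolding step_gain_def
    by (rule conditioning(1)[where f = ?f, OF i g meas loc int gain_abs_bound[OF i _ r]])
  show "(\<integral>\<omega>. deviation \<omega> i ^ r *\<^sub>R g (weights \<omega>) \<partial>M) =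
      (\<integral>\<omega>. (\<integral>\<omega>'. (gain p n (weights \<omega>') (Suc i) (dir (weights \<omega>) i) - 1) ^ r \<partial>M) *\<^sub>R g (weights \<omega>) \<partial>M)"
    unfolding step_gain_def
    by (rule conditioning(2)[where f = ?f, OF i g meas loc int gain_abs_bound[OF i _ r]])
qed

lemma deviation_mean:
  assumes "8 \<le> K"
  shows "(\<integral>\<omega>. deviation \<omega> i *\<^sub>R g (weights \<omega>) \<partial>M) = 0"
proof -
  have "Suc i \<in> {1..d}" using i by auto
  then show ?thesis
    using deviation_power(2)[of 1] assms gain_moments(2)[of "Suc i"] dir_unit[of i] i by simp
qed

lemma deviation_square:
  assumes "12 \<le> K"
  shows "(\<integral>\<omega>. (deviation \<omega> i)\<^sup>2 *\<^sub>R g (weights \<omega>) \<partial>M) =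
    (\<integral>\<omega>. (energy_variance p \<mu> (n i) (dir (weights \<omega>) i) / real (n (Suc i))) *\<^sub>R g (weights \<omega>) \<partial>M)"
proof -
  have "Suc i \<in> {1..d}" using i by auto
  then show ?thesis
    using deviation_power(2)[of 2] assms gain_moments(3)[of "Suc i"] dir_unit[of i] i by simp
qed

lemma deviation_higher:
  assumes "3 \<le> r" "4 * r + 4 \<le> K"
  shows "norm (\<integral>\<omega>. deviation \<omega> i ^ r *\<^sub>R g (weights \<omega>) \<partial>M) \<le>
    C / (real (n (Suc i)))\<^sup>2 * (\<integral>\<omega>. norm (g (weights \<omega>)) \<partial>M)"
proof -
  have "norm (\<integral>\<omega>. deviation \<omega> i ^ r *\<^sub>R g (weights \<omega>) \<partial>M) \<le>
      (\<integral>\<omega>. C / (real (n (Suc i)))\<^sup>2 * norm (g (weights \<omega>)) \<partial>M)"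
    unfolding deviation_power(2)[OF assms(2)]
  proof (rule norm_integral_le)
    show "integrable M (\<lambda>\<omega>. C / (real (n (Suc i)))\<^sup>2 * norm (g (weights \<omega>)))" using g(2) by simp
    fix \<omega>
    show "norm ((\<integral>\<omega>'. (gain p n (weights \<omega>') (Suc i) (dir (weights \<omega>) i) - 1) ^ r \<partial>M) *\<^sub>R g (weights \<omega>))
        \<le> C / (real (n (Suc i)))\<^sup>2 * norm (g (weights \<omega>))"
      using gain_bound[OF i dir_unit, of r "weights \<omega>"] assms i
      unfolding norm_scaleR by (intro mult_right_mono) auto
  qed
  then show ?thesis by simp
qed

lemma row_energy_power:
  assumes r: "r \<le> K" and j: "j < n (Suc i)"
  shows "integrable M (\<lambda>\<omega>. row_energy p (weights \<omega>) (n i) (Suc i) (dir (weights \<omega>) i) j ^ r *\<^sub>R g (weights \<omega>))"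
    and "norm (\<integral>\<omega>. row_energy p (weights \<omega>) (n i) (Suc i) (dir (weights \<omega>) i) j ^ r *\<^sub>R g (weights \<omega>) \<partial>M) \<le>
      C * (\<integral>\<omega>. norm (g (weights \<omega>)) \<partial>M)"
proof -
  let ?f = "\<lambda>y v. row_energy p y (n i) (Suc i) v j ^ r"
  have Si: "Suc i \<in> {1..d}" using i by auto
  have meas: "(\<lambda>(x, y). ?f y (dir x i)) \<in> borel_measurable
      (PiM (past_params n i) (\<lambda>_. borel) \<Otimes>\<^sub>M PiM (layer_params n (Suc i)) (\<lambda>_. borel))"
    using measurable_row_energy_pair[OF j] unfolding split_beta'
    by (intro borel_measurable_power) auto
  have loc: "?f (restrict x (layer_params n (Suc i))) v = ?f x v" for x v
    by (simp add: row_energy_local[OF j])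
  have pos: "0 \<le> ?f y v" for y v using p_pos by (simp add: row_energy_def)
  have int: "integrable M (\<lambda>\<omega>. ?f (weights \<omega>) v)" if "sq_norm (n i) v = 1" for v
    using row_energy_moments(1)[OF Si _ j, of v r] that by simp
  have abs: "(\<integral>\<omega>. \<bar>?f (weights \<omega>) v\<bar> \<partial>M) \<le> C" if "sq_norm (n i) v = 1" for v
    using row_energy_bound[OF i that j r] pos by simp
  show "integrable M (\<lambda>\<omega>. ?f (weights \<omega>) (dir (weights \<omega>) i) *\<^sub>R g (weights \<omega>))"
    by (rule conditioning(1)[where f = ?f, OF i g meas loc int abs])
  have pt: "norm ((\<integral>\<omega>'. ?f (weights \<omega>') (dir (weights \<omega>) i) \<partial>M) *\<^sub>R g (weights \<omega>)) \<le>
      C * norm (g (weights \<omega>))" for \<omega>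
  proof -
    have "0 \<le> (\<integral>\<omega>'. ?f (weights \<omega>') (dir (weights \<omega>) i) \<partial>M)" using pos by simp
    then show ?thesis
      using row_energy_bound[OF i dir_unit j r, of "weights \<omega>"] i
      unfolding norm_scaleR by (intro mult_right_mono) auto
  qed
  have "norm (\<integral>\<omega>. (\<integral>\<omega>'. ?f (weights \<omega>') (dir (weights \<omega>) i) \<partial>M) *\<^sub>R g (weights \<omega>) \<partial>M) \<le>
      (\<integral>\<omega>. C * norm (g (weights \<omega>)) \<partial>M)"
    by (rule norm_integral_le[OF _ pt]) (use g(2) in simp)
  then have "norm (\<integral>\<omega>. ?f (weights \<omega>) (dir (weights \<omega>) i) *\<^sub>R g (weights \<omega>) \<partial>M) \<le>
      (\<integral>\<omega>. C * norm (g (weights \<omega>)) \<partial>M)"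
    by (simp only: conditioning(2)[where f = ?f, OF i g meas loc int abs])
  then show "norm (\<integral>\<omega>. ?f (weights \<omega>) (dir (weights \<omega>) i) *\<^sub>R g (weights \<omega>) \<partial>M) \<le>
      C * (\<integral>\<omega>. norm (g (weights \<omega>)) \<partial>M)" by simp
qed

end

end

end

section \<open>Conditional moments of the gains\<close>

text \<open>\<open>raw_moment \<mu> 4 - 1\<close> is the integral of
  \<open>(x\<^sup>2 - 1)\<^sup>2\<close>. If it were 0, the whole mass would sit on the two points 1
  and -1. Strictness makes every \<open>layer_var\<close>, and hence \<beta>, positive even for
  \<open>p = 1\<close>.\<close>

lemma (in weight_distribution) raw_moment_4_gt_1: "1 < raw_moment \<mu> 4"
proof (rule ccontr)
  assume "\<not> 1 < raw_moment \<mu> 4"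
  have int: "integrable \<mu> (\<lambda>x. (x\<^sup>2 - 1)\<^sup>2)"
    using finite_moments[of 4] finite_moments[of 2] by (simp add: power2_diff flip: power_mult)
  have "(\<integral>x. (x\<^sup>2 - 1)\<^sup>2 \<partial>\<mu>) = (\<integral>x. x ^ 4 + 1 - 2 * x\<^sup>2 \<partial>\<mu>)"
    by (simp add: power2_diff flip: power_mult)
  also have "\<dots> = raw_moment \<mu> 4 - 1"
    using finite_moments[of 4] finite_moments[of 2] variance_one prob_space
    by (simp add: raw_moment_def)
  finally have eq: "(\<integral>x. (x\<^sup>2 - 1)\<^sup>2 \<partial>\<mu>) = raw_moment \<mu> 4 - 1" .
  have "0 \<le> (\<integral>x. (x\<^sup>2 - 1)\<^sup>2 \<partial>\<mu>)" by simp
  with eq \<open>\<not> 1 < raw_moment \<mu> 4\<close> have "(\<integral>x. (x\<^sup>2 - 1)\<^sup>2 \<partial>\<mu>) = 0" by linarith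
  then have "AE x in \<mu>. (x\<^sup>2 - 1)\<^sup>2 = 0"
    using integral_nonneg_eq_0_iff_AE[OF int] by simp
  then have "AE x in \<mu>. x \<in> {1, - 1}"
    by eventually_elim (auto simp: power2_eq_1_iff)
  then have "measure \<mu> {1, - 1} = 1"
    by (subst prob_eq_1) auto
  moreover have "measure \<mu> {1, - 1} \<le> measure \<mu> {1} + measure \<mu> {- 1}"
    using measure_Un_le[of "{1}" \<mu> "{- 1}"] by (simp add: insert_commute)
  ultimately show False by (simp add: no_atoms)
qed

context network
begin

text \<open>The summands of \<open>\<beta>\<close>. The conditional variance of a later gain differs from its \<open>layer_var\<close> by the
  fourth-power sum of the heading, which contributes the mixed term of \<open>layer_err\<close>.\<close>

definition layer_var :: "nat \<Rightarrow> real" where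
  "layer_var i = (3 / p - 1) / real (n (Suc i)) +
     (if i = 0 then (raw_moment \<mu> 4 - 3) / (p * real (n 1)) * l4_norm_pow4 u else 0)"

definition layer_err :: "nat \<Rightarrow> real" where
  "layer_err i = 1 / (real (n (Suc i)))\<^sup>2 + (if i = 0 then 0 else 1 / (real (n (Suc i)) * real (n i)))"

definition var_const :: real where
  "var_const = (3 + \<bar>raw_moment \<mu> 4 - 3\<bar>) / p"

lemma n_Suc_ge_1: "i < d \<Longrightarrow> 1 \<le> real (n (Suc i))"
  using n_pos[of "Suc i"] by simp

lemma sum_layer_var: "(\<Sum>i<d. layer_var i) = beta_param \<mu> p d n u"
proof -
  have "(\<Sum>i<d. layer_var i) = (\<Sum>i<d. (3 / p - 1) / real (n (Suc i))) +
      (raw_moment \<mu> 4 - 3) / (p * real (n 1)) * l4_norm_pow4 u"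
    unfolding layer_var_def sum.distrib using d_pos by (simp add: sum.delta)
  also have "(\<Sum>i<d. (3 / p - 1) / real (n (Suc i))) = (3 / p - 1) * (\<Sum>i=1..d. 1 / real (n i))"
    by (simp add: sum_distrib_left sum.atLeast1_atMost_eq)
  finally show ?thesis by (simp add: beta_param_def)
qed

lemma sum_inv_sq: "(\<Sum>i<d. 1 / (real (n (Suc i)))\<^sup>2) = inv_sq_sum d n"
  by (simp add: inv_sq_sum_def sum.atLeast1_atMost_eq)

lemma inv_sq_sum_nonneg: "0 \<le> inv_sq_sum d n"
  by (simp add: inv_sq_sum_def sum_nonneg)

lemma layer_err_nonneg: "0 \<le> layer_err i"
  by (simp add: layer_err_def)

lemma layer_err_ge: "1 / (real (n (Suc i)))\<^sup>2 \<le> layer_err i"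
  by (simp add: layer_err_def)

text \<open>A mixed term is at most half the sum of two neighbouring terms
  \<open>1 / (real (n i))\<^sup>2\<close>, so all mixed terms together contribute at most one
  further \<open>inv_sq_sum\<close>.\<close>

lemma sum_layer_err: "(\<Sum>i<d. layer_err i) \<le> 2 * inv_sq_sum d n"
proof -
  obtain d' where d': "d = Suc d'" using d_pos gr0_implies_Suc by blast
  let ?f = "\<lambda>i. 1 / (real (n i))\<^sup>2"
  have S: "inv_sq_sum d n = (\<Sum>i<Suc d'. ?f (Suc i))" using sum_inv_sq d' by simp
  have am: "1 / (a * b) \<le> (1 / a\<^sup>2 + 1 / b\<^sup>2) / 2" for a b :: real
    using sum_squares_bound[of "1 / a" "1 / b"] by (simp add: power_divide)
  have "(\<Sum>i<d. if i = 0 then 0 else 1 / (real (n (Suc i)) * real (n i))) =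
      (\<Sum>i<d'. 1 / (real (n (Suc (Suc i))) * real (n (Suc i))))"
    unfolding d' by (subst sum.lessThan_Suc_shift) simp
  also have "\<dots> \<le> (\<Sum>i<d'. (?f (Suc (Suc i)) + ?f (Suc i)) / 2)"
    by (intro sum_mono am)
  also have "\<dots> = ((\<Sum>i<d'. ?f (Suc (Suc i))) + (\<Sum>i<d'. ?f (Suc i))) / 2"
    by (simp add: sum.distrib sum_divide_distrib add_divide_distrib)
  also have "\<dots> \<le> (inv_sq_sum d n + inv_sq_sum d n) / 2"
  proof (intro divide_right_mono add_mono)
    show "(\<Sum>i<d'. ?f (Suc (Suc i))) \<le> inv_sq_sum d n"
      unfolding S by (subst sum.lessThan_Suc_shift) simp
    show "(\<Sum>i<d'. ?f (Suc i)) \<le> inv_sq_sum d n"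
      unfolding S by simp
  qed simp
  finally show ?thesis
    unfolding layer_err_def sum.distrib sum_inv_sq by simp
qed

text \<open>The expression is affine in \<open>t\<close>, with value 3 at 0 and
  \<open>raw_moment \<mu> 4 > 1\<close> at 1, so it stays above 1 on the interval.\<close>

lemma fourth_moment_factor:
  assumes "0 \<le> t" "t \<le> 1"
  shows "p < 3 + (raw_moment \<mu> 4 - 3) * t" "3 + (raw_moment \<mu> 4 - 3) * t \<le> 3 + \<bar>raw_moment \<mu> 4 - 3\<bar>"
proof -
  have "1 < 3 + (raw_moment \<mu> 4 - 3) * t"
  proof (cases "t = 0")
    case False
    then have "1 * t < raw_moment \<mu> 4 * t"
      using assms wd.raw_moment_4_gt_1 by (intro mult_strict_right_mono) auto
    then show ?thesis using assms by (simp add: algebra_simps)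
  qed simp
  then show "p < 3 + (raw_moment \<mu> 4 - 3) * t" using p_le_1 by auto
  have "(raw_moment \<mu> 4 - 3) * t \<le> \<bar>raw_moment \<mu> 4 - 3\<bar> * 1"
    using assms by (intro mult_mono) auto
  then show "3 + (raw_moment \<mu> 4 - 3) * t \<le> 3 + \<bar>raw_moment \<mu> 4 - 3\<bar>" by simp
qed

lemma l4_norm_bounds: "0 \<le> l4_norm_pow4 u" "l4_norm_pow4 u \<le> 1"
  using quart_norm_bounds[OF dir_unit[of 0]] quart_norm_dir_0 by simp_all

lemma layer_var_bounds:
  assumes "i < d"
  shows "0 < layer_var i" "layer_var i \<le> var_const / real (n (Suc i))"
proof -
  define t where "t = (if i = 0 then l4_norm_pow4 u else 0)"
  have t: "0 \<le> t" "t \<le> 1" using l4_norm_bounds by (auto simp: t_def)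
  have eq: "layer_var i = ((3 + (raw_moment \<mu> 4 - 3) * t) / p - 1) / real (n (Suc i))"
    by (simp add: layer_var_def t_def add_divide_distrib diff_divide_distrib left_diff_distrib)
  have N: "0 < real (n (Suc i))" using n_Suc_ge_1[OF assms] by simp
  have "1 < (3 + (raw_moment \<mu> 4 - 3) * t) / p"
    using fourth_moment_factor(1)[OF t] p_pos by simp
  then show "0 < layer_var i" unfolding eq using N by simp
  have "(3 + (raw_moment \<mu> 4 - 3) * t) / p - 1 \<le> var_const"
    using divide_right_mono[OF fourth_moment_factor(2)[OF t], of p] p_pos by (simp add: var_const_def)
  then show "layer_var i \<le> var_const / real (n (Suc i))"
    unfolding eq using N by (simp add: divide_right_mono)
qed

lemma beta_pos: "0 < beta_param \<mu> p d n u"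
  unfolding sum_layer_var[symmetric] using d_pos layer_var_bounds(1) by (intro sum_pos) auto

lemma var_const_nonneg: "0 \<le> var_const"
  using p_pos by (simp add: var_const_def)

lemma sum_layer_var_sq: "(\<Sum>i<d. (layer_var i)\<^sup>2) \<le> var_const\<^sup>2 * inv_sq_sum d n"
proof -
  have "(layer_var i)\<^sup>2 \<le> var_const\<^sup>2 * (1 / (real (n (Suc i)))\<^sup>2)" if "i < d" for i
    using power_mono[OF layer_var_bounds(2)[OF that] less_imp_le[OF layer_var_bounds(1)[OF that]], of 2]
    by (simp add: power_divide)
  then have "(\<Sum>i<d. (layer_var i)\<^sup>2) \<le> (\<Sum>i<d. var_const\<^sup>2 * (1 / (real (n (Suc i)))\<^sup>2))"
    by (intro sum_mono) auto
  then show ?thesis by (simp only: sum_distrib_left[symmetric] sum_inv_sq)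
qed

lemma quart_dir_bounds:
  assumes "i \<le> d"
  shows "0 \<le> quart_norm (n i) (dir x i)" "quart_norm (n i) (dir x i) \<le> 1"
  using quart_norm_bounds[OF dir_unit[OF assms]] by auto

lemma adapted_quart: "adapted n i (\<lambda>x. quart_norm (n i) (dir x i))"
  unfolding quart_norm_def by (intro adapted_sum adapted_power adapted_heading)

lemma energy_variance_dir:
  "energy_variance p \<mu> (n i) (dir x i) / real (n (Suc i)) = layer_var i +
    (if i = 0 then 0 else (raw_moment \<mu> 4 - 3) / p / real (n (Suc i)) * quart_norm (n i) (dir x i))"
  by (simp add: energy_variance_def layer_var_def quart_norm_dir_0[simplified] add_divide_distrib)

context
  fixes K :: nat and C :: real
  assumes bounds: "layer_bounds K C"
begin

text \<open>In the first layer the heading is \<open>u\<close> itself and the conditional variance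
  is exactly \<open>layer_var 0\<close>. Later the fourth-power sum of a random heading remains; it
  stays in the bound because moments and phases need different arguments to estimate it.\<close>

lemma deviation_sq_expand:
  fixes g :: "(param \<Rightarrow> real) \<Rightarrow> 'c::{banach, second_countable_topology}"
  assumes i: "i < d" and g: "adapted n i g" "integrable M (\<lambda>\<omega>. g (weights \<omega>))" and K: "12 \<le> K"
  shows "norm ((\<integral>\<omega>. (deviation \<omega> i)\<^sup>2 *\<^sub>R g (weights \<omega>) \<partial>M) - layer_var i *\<^sub>R (\<integral>\<omega>. g (weights \<omega>) \<partial>M)) \<le>
    (if i = 0 then 0 else var_const / real (n (Suc i)) *
      (\<integral>\<omega>. quart_norm (n i) (dir (weights \<omega>) i) * norm (g (weights \<omega>)) \<partial>M))"
proof -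
  define b where "b = (raw_moment \<mu> 4 - 3) / p / real (n (Suc i))"
  let ?q = "\<lambda>\<omega>. quart_norm (n i) (dir (weights \<omega>) i)"
  have [measurable]: "?q \<in> borel_measurable M" "(\<lambda>\<omega>. g (weights \<omega>)) \<in> borel_measurable M"
    using i measurable_adapted[OF adapted_quart, of i] g(2) by auto
  have q: "0 \<le> ?q \<omega>" "?q \<omega> \<le> 1" for \<omega> using quart_dir_bounds i by auto
  have "norm (?q \<omega> *\<^sub>R g (weights \<omega>)) \<le> norm (g (weights \<omega>))" for \<omega>
    using q[of \<omega>] mult_right_mono[of "?q \<omega>" 1 "norm (g (weights \<omega>))"] by simp
  then have int: "integrable M (\<lambda>\<omega>. ?q \<omega> *\<^sub>R g (weights \<omega>))"
    by (intro Bochner_Integration.integrable_bound[OF g(2)] AE_I2) auto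
  have b: "\<bar>b\<bar> \<le> var_const / real (n (Suc i))"
    using p_pos by (simp add: b_def var_const_def abs_divide divide_right_mono)
  have eq: "(\<integral>\<omega>. (deviation \<omega> i)\<^sup>2 *\<^sub>R g (weights \<omega>) \<partial>M) =
      layer_var i *\<^sub>R (\<integral>\<omega>. g (weights \<omega>) \<partial>M) + (if i = 0 then 0 else b *\<^sub>R (\<integral>\<omega>. ?q \<omega> *\<^sub>R g (weights \<omega>) \<partial>M))"
    unfolding deviation_square[OF bounds i g K] energy_variance_dir b_def[symmetric]
    using int g(2) by (cases "i = 0") (simp_all add: scaleR_add_left flip: scaleR_scaleR)
  have "norm (\<integral>\<omega>. ?q \<omega> *\<^sub>R g (weights \<omega>) \<partial>M) \<le> (\<integral>\<omega>. ?q \<omega> * norm (g (weights \<omega>)) \<partial>M)"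
    using integral_norm_bound[of M "\<lambda>\<omega>. ?q \<omega> *\<^sub>R g (weights \<omega>)"] q by simp
  then have "\<bar>b\<bar> * norm (\<integral>\<omega>. ?q \<omega> *\<^sub>R g (weights \<omega>) \<partial>M) \<le>
      var_const / real (n (Suc i)) * (\<integral>\<omega>. ?q \<omega> * norm (g (weights \<omega>)) \<partial>M)"
    using b by (intro mult_mono) auto
  then show ?thesis unfolding eq by simp
qed

lemma deviation_norm:
  fixes g :: "(param \<Rightarrow> real) \<Rightarrow> 'c::{banach, second_countable_topology}"
  assumes i: "i < d" and g: "adapted n i g" "integrable M (\<lambda>\<omega>. g (weights \<omega>))" and r: "4 * r + 4 \<le> K"
  shows "norm (\<integral>\<omega>. deviation \<omega> i ^ r *\<^sub>R g (weights \<omega>) \<partial>M) \<le> (1 + C) * (\<integral>\<omega>. norm (g (weights \<omega>)) \<partial>M)"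
proof -
  have pt: "norm ((\<integral>\<omega>'. (gain p n (weights \<omega>') (Suc i) (dir (weights \<omega>) i) - 1) ^ r \<partial>M) *\<^sub>R g (weights \<omega>))
      \<le> (1 + C) * norm (g (weights \<omega>))" for \<omega>
  proof -
    have "\<bar>\<integral>\<omega>'. (gain p n (weights \<omega>') (Suc i) (dir (weights \<omega>) i) - 1) ^ r \<partial>M\<bar> \<le> 1 + C"
      by (rule order_trans[OF integral_abs_bound gain_abs_bound[OF bounds i dir_unit r]]) (use i in simp)
    then show ?thesis unfolding norm_scaleR by (intro mult_right_mono) auto
  qed
  have "norm (\<integral>\<omega>. deviation \<omega> i ^ r *\<^sub>R g (weights \<omega>) \<partial>M) \<le> (\<integral>\<omega>. (1 + C) * norm (g (weights \<omega>)) \<partial>M)"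
    unfolding deviation_power(2)[OF bounds i g r] by (rule norm_integral_le[OF _ pt]) (use g(2) in simp)
  then show ?thesis by simp
qed

context
  fixes i :: nat and g :: "(param \<Rightarrow> real) \<Rightarrow> real"
  assumes i: "i < d" and g: "adapted n i g" "integrable M (\<lambda>\<omega>. g (weights \<omega>))" and g0: "\<And>x. 0 \<le> g x"
begin

lemma gain_power_integrable:
  assumes r: "4 * r + 4 \<le> K"
  shows "integrable M (\<lambda>\<omega>. step_gain p n u (weights \<omega>) i ^ r * g (weights \<omega>))"
    and "(\<integral>\<omega>. step_gain p n u (weights \<omega>) i ^ r * g (weights \<omega>) \<partial>M) =
      (\<Sum>j\<le>r. real (r choose j) * (\<integral>\<omega>. deviation \<omega> i ^ j * g (weights \<omega>) \<partial>M))"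
proof -
  have eq: "step_gain p n u (weights \<omega>) i ^ r * g (weights \<omega>) =
      (\<Sum>j\<le>r. real (r choose j) * (deviation \<omega> i ^ j * g (weights \<omega>)))" for \<omega>
    using binomial_ring[of "deviation \<omega> i" 1 r] by (simp add: sum_distrib_right mult.assoc)
  have int: "integrable M (\<lambda>\<omega>. deviation \<omega> i ^ j * g (weights \<omega>))" if "j \<le> r" for j
    using deviation_power(1)[OF bounds i g, of j] r that by simp
  show "integrable M (\<lambda>\<omega>. step_gain p n u (weights \<omega>) i ^ r * g (weights \<omega>))"
    unfolding eq using int by (intro Bochner_Integration.integrable_sum integrable_mult_right) auto
  show "(\<integral>\<omega>. step_gain p n u (weights \<omega>) i ^ r * g (weights \<omega>) \<partial>M) =
      (\<Sum>j\<le>r. real (r choose j) * (\<integral>\<omega>. deviation \<omega> i ^ j * g (weights \<omega>) \<partial>M))"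
    unfolding eq using int by (subst Bochner_Integration.integral_sum) auto
qed

lemma gain_power_le:
  assumes r: "4 * r + 4 \<le> K"
  shows "(\<integral>\<omega>. step_gain p n u (weights \<omega>) i ^ r * g (weights \<omega>) \<partial>M) \<le> 2 ^ r * (1 + C) * (\<integral>\<omega>. g (weights \<omega>) \<partial>M)"
proof -
  have "(\<Sum>j\<le>r. real (r choose j) * (\<integral>\<omega>. deviation \<omega> i ^ j * g (weights \<omega>) \<partial>M)) \<le>
      (\<Sum>j\<le>r. real (r choose j) * ((1 + C) * (\<integral>\<omega>. g (weights \<omega>) \<partial>M)))"
  proof (intro sum_mono mult_left_mono)
    fix j assume "j \<in> {..r}"
    then have "norm (\<integral>\<omega>. deviation \<omega> i ^ j * g (weights \<omega>) \<partial>M) \<le> (1 + C) * (\<integral>\<omega>. g (weights \<omega>) \<partial>M)"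
      using deviation_norm[OF i g, of j] r g0 by simp
    then show "(\<integral>\<omega>. deviation \<omega> i ^ j * g (weights \<omega>) \<partial>M) \<le> (1 + C) * (\<integral>\<omega>. g (weights \<omega>) \<partial>M)" by simp
  qed simp
  also have "\<dots> = 2 ^ r * ((1 + C) * (\<integral>\<omega>. g (weights \<omega>) \<partial>M))"
    by (rule sum_binomial_mult)
  finally show ?thesis unfolding gain_power_integrable(2)[OF r] by (simp add: mult.assoc)
qed

text \<open>Bernoulli's inequality bounds the power of the gain below by
  \<open>1 + r * \<delta>\<close>, and the linear part has conditional mean 0. Hence the moments of
  the energy never decrease, which allows errors to be measured relative to them.\<close>

lemma gain_power_ge:
  assumes r: "4 * r + 4 \<le> K" "8 \<le> K"
  shows "(\<integral>\<omega>. g (weights \<omega>) \<partial>M) \<le> (\<integral>\<omega>. step_gain p n u (weights \<omega>) i ^ r * g (weights \<omega>) \<partial>M)"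
proof -
  have int: "integrable M (\<lambda>\<omega>. deviation \<omega> i * g (weights \<omega>))"
    using deviation_power(1)[OF bounds i g, of 1] r by simp
  have 0: "(\<integral>\<omega>. deviation \<omega> i * g (weights \<omega>) \<partial>M) = 0"
    using deviation_mean[OF bounds i g r(2)] by simp
  have "(\<integral>\<omega>. g (weights \<omega>) \<partial>M) = (\<integral>\<omega>. g (weights \<omega>) + real r * (deviation \<omega> i * g (weights \<omega>)) \<partial>M)"
    using int 0 g by simp
  also have "\<dots> \<le> (\<integral>\<omega>. step_gain p n u (weights \<omega>) i ^ r * g (weights \<omega>) \<partial>M)"
  proof (rule integral_mono)
    show "integrable M (\<lambda>\<omega>. g (weights \<omega>) + real r * (deviation \<omega> i * g (weights \<omega>)))"
      using int g by simp
    show "integrable M (\<lambda>\<omega>. step_gain p n u (weights \<omega>) i ^ r * g (weights \<omega>))"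
      by (rule gain_power_integrable[OF r(1)])
    fix \<omega>
    have "1 + real r * deviation \<omega> i \<le> (1 + deviation \<omega> i) ^ r"
      using step_gain_nonneg by (intro Bernoulli_inequality) simp
    from mult_right_mono[OF this g0[of "weights \<omega>"]]
    show "g (weights \<omega>) + real r * (deviation \<omega> i * g (weights \<omega>)) \<le> step_gain p n u (weights \<omega>) i ^ r * g (weights \<omega>)"
      by (simp add: algebra_simps)
  qed
  finally show ?thesis .
qed

lemma gain_power_expand:
  assumes r: "4 * r + 4 \<le> K" "12 \<le> K"
  shows "\<bar>(\<integral>\<omega>. step_gain p n u (weights \<omega>) i ^ r * g (weights \<omega>) \<partial>M) - (\<integral>\<omega>. g (weights \<omega>) \<partial>M)
      - real (r choose 2) * (\<integral>\<omega>. (deviation \<omega> i)\<^sup>2 * g (weights \<omega>) \<partial>M)\<bar> \<le>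
    2 ^ r * (C / (real (n (Suc i)))\<^sup>2 * (\<integral>\<omega>. g (weights \<omega>) \<partial>M))"
proof -
  let ?f = "\<lambda>j. real (r choose j) * (\<integral>\<omega>. deviation \<omega> i ^ j * g (weights \<omega>) \<partial>M)"
  let ?B = "C / (real (n (Suc i)))\<^sup>2 * (\<integral>\<omega>. g (weights \<omega>) \<partial>M)"
  have B: "0 \<le> ?B" using C_nonneg[OF bounds] g0 by simp
  have f1: "?f 1 = 0"
    using deviation_mean[OF bounds i g] r by simp
  have split: "(\<Sum>j\<le>r. ?f j) = ?f 0 + ?f 2 + (\<Sum>j\<in>{3..r}. ?f j)"
  proof -
    \<comment> \<open>For \<open>r < 2\<close> the added indices have binomial coefficient 0, so no
      case distinction is needed.\<close>
    have "(\<Sum>j\<le>r. ?f j) = (\<Sum>j\<in>{0, 1, 2} \<union> {3..r}. ?f j)"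
      by (rule sum.mono_neutral_left) (auto simp: not_le binomial_eq_0)
    also have "\<dots> = (\<Sum>j\<in>{0, 1, 2}. ?f j) + (\<Sum>j\<in>{3..r}. ?f j)"
      by (rule sum.union_disjoint) auto
    also have "(\<Sum>j\<in>{0, 1, 2}. ?f j) = ?f 0 + ?f 2" using f1 by simp
    finally show ?thesis .
  qed
  have "\<bar>\<Sum>j\<in>{3..r}. ?f j\<bar> \<le> (\<Sum>j\<in>{3..r}. real (r choose j) * ?B)"
  proof (rule order_trans[OF sum_abs sum_mono])
    fix j assume "j \<in> {3..r}"
    then have "\<bar>\<integral>\<omega>. deviation \<omega> i ^ j * g (weights \<omega>) \<partial>M\<bar> \<le> ?B"
      using deviation_higher[OF bounds i g, of j] r g0 by simp
    then show "\<bar>?f j\<bar> \<le> real (r choose j) * ?B"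
      unfolding abs_mult by (intro mult_mono) auto
  qed
  also have "\<dots> \<le> (\<Sum>j\<le>r. real (r choose j) * ?B)"
    using B by (intro sum_mono2 mult_nonneg_nonneg[OF _ B]) auto
  also have "\<dots> = 2 ^ r * ?B"
    by (rule sum_binomial_mult)
  finally show ?thesis
    unfolding gain_power_integrable(2)[OF r(1)] split by simp
qed

text \<open>Two of the \<open>r + 2\<close> powers of the gain clear the denominator of the
  fourth-power sum and leave squared row energies divided by the squared width. The products of such
  a square with the other \<open>r\<close> powers are separated by
  \<open>y ^ 2 * Q ^ r \<le> y ^ 4 + Q ^ (2 * r)\<close>; the number of rows against the squared
  width leaves one factor \<open>1 / n (Suc i)\<close>. The power \<open>2 * r\<close> explains
  \<open>8 * r + 4\<close>.\<close>

lemma quart_gain_le: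
  assumes r: "8 * r + 4 \<le> K"
  shows "(\<integral>\<omega>. quart_norm (n (Suc i)) (dir (weights \<omega>) (Suc i)) * (step_gain p n u (weights \<omega>) i ^ (r + 2) * g (weights \<omega>)) \<partial>M) \<le>
    (C + 4 ^ r * (1 + C)) / real (n (Suc i)) * (\<integral>\<omega>. g (weights \<omega>) \<partial>M)"
proof -
  define N where "N = real (n (Suc i))"
  define G where "G = (\<integral>\<omega>. g (weights \<omega>) \<partial>M)"
  let ?Q = "\<lambda>\<omega>. step_gain p n u (weights \<omega>) i"
  let ?y = "\<lambda>\<omega> j. row_energy p (weights \<omega>) (n i) (Suc i) (dir (weights \<omega>) i) j"
  have N: "1 \<le> N" using n_Suc_ge_1[OF i] by (simp add: N_def)
  have G: "0 \<le> G" using g0 by (simp add: G_def)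
  have K: "4 * (2 * r) + 4 \<le> K" "4 \<le> K" using r by auto
  have int1: "integrable M (\<lambda>\<omega>. ?y \<omega> j ^ 4 * g (weights \<omega>))" if "j < n (Suc i)" for j
    using row_energy_power(1)[OF bounds i g K(2) that] by simp
  have int2: "integrable M (\<lambda>\<omega>. ?Q \<omega> ^ (2 * r) * g (weights \<omega>))"
    by (rule gain_power_integrable[OF K(1)])
  have pt: "quart_norm (n (Suc i)) (dir (weights \<omega>) (Suc i)) * (?Q \<omega> ^ (r + 2) * g (weights \<omega>)) \<le>
      (\<Sum>j<n (Suc i). ?y \<omega> j ^ 4 * g (weights \<omega>) + ?Q \<omega> ^ (2 * r) * g (weights \<omega>)) / N\<^sup>2" for \<omega>
  proof -
    have "quart_norm (n (Suc i)) (dir (weights \<omega>) (Suc i)) * (?Q \<omega> ^ (r + 2) * g (weights \<omega>)) =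
        (quart_norm (n (Suc i)) (dir (weights \<omega>) (Suc i)) * (?Q \<omega>)\<^sup>2) * (?Q \<omega> ^ r * g (weights \<omega>))"
      by (simp add: power_add power2_eq_square mult_ac)
    also have "\<dots> = (\<Sum>j<n (Suc i). (?y \<omega> j)\<^sup>2 * ?Q \<omega> ^ r * g (weights \<omega>)) / N\<^sup>2"
      using quart_norm_heading_Suc[where n = n and i = i and u = u and x = "weights \<omega>", OF p_pos] n_pos[of "Suc i"] i
      by (simp add: N_def sum_distrib_right mult.assoc)
    also have "\<dots> \<le> (\<Sum>j<n (Suc i). (?y \<omega> j ^ 4 + ?Q \<omega> ^ (2 * r)) * g (weights \<omega>)) / N\<^sup>2"
    proof (intro divide_right_mono sum_mono mult_right_mono g0)
      fix j
      have "0 \<le> (?y \<omega> j)\<^sup>2 * ?Q \<omega> ^ r" using step_gain_nonneg by simp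
      moreover have "2 * ((?y \<omega> j)\<^sup>2 * ?Q \<omega> ^ r) \<le> ((?y \<omega> j)\<^sup>2)\<^sup>2 + (?Q \<omega> ^ r)\<^sup>2"
        using sum_squares_bound[of "(?y \<omega> j)\<^sup>2" "?Q \<omega> ^ r"] by (simp add: mult.assoc)
      moreover have "((?y \<omega> j)\<^sup>2)\<^sup>2 = ?y \<omega> j ^ 4" "(?Q \<omega> ^ r)\<^sup>2 = ?Q \<omega> ^ (2 * r)"
        by (simp_all add: mult.commute flip: power_mult)
      ultimately show "(?y \<omega> j)\<^sup>2 * ?Q \<omega> ^ r \<le> ?y \<omega> j ^ 4 + ?Q \<omega> ^ (2 * r)" by linarith
    qed simp
    finally show ?thesis by (simp add: distrib_right)
  qed
  have "(\<integral>\<omega>. quart_norm (n (Suc i)) (dir (weights \<omega>) (Suc i)) * (?Q \<omega> ^ (r + 2) * g (weights \<omega>)) \<partial>M) \<le>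
      (\<integral>\<omega>. (\<Sum>j<n (Suc i). ?y \<omega> j ^ 4 * g (weights \<omega>) + ?Q \<omega> ^ (2 * r) * g (weights \<omega>)) / N\<^sup>2 \<partial>M)"
  proof (rule integral_mono')
    show "integrable M (\<lambda>\<omega>. (\<Sum>j<n (Suc i). ?y \<omega> j ^ 4 * g (weights \<omega>) + ?Q \<omega> ^ (2 * r) * g (weights \<omega>)) / N\<^sup>2)"
      using int1 int2 by (intro integrable_divide Bochner_Integration.integrable_sum Bochner_Integration.integrable_add) auto
    show "0 \<le> (\<Sum>j<n (Suc i). ?y \<omega> j ^ 4 * g (weights \<omega>) + ?Q \<omega> ^ (2 * r) * g (weights \<omega>)) / N\<^sup>2" for \<omega>
      using g0 step_gain_nonneg by (intro divide_nonneg_nonneg sum_nonneg add_nonneg_nonneg mult_nonneg_nonneg) auto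
  qed (rule pt)
  also have "\<dots> = (\<Sum>j<n (Suc i). (\<integral>\<omega>. ?y \<omega> j ^ 4 * g (weights \<omega>) \<partial>M) + (\<integral>\<omega>. ?Q \<omega> ^ (2 * r) * g (weights \<omega>) \<partial>M)) / N\<^sup>2"
    using int1 int2 by (simp add: Bochner_Integration.integral_sum)
  also have "\<dots> \<le> (\<Sum>j<n (Suc i). C * G + 4 ^ r * (1 + C) * G) / N\<^sup>2"
  proof (intro divide_right_mono sum_mono add_mono)
    fix j assume "j \<in> {..<n (Suc i)}"
    then have "norm (\<integral>\<omega>. ?y \<omega> j ^ 4 * g (weights \<omega>) \<partial>M) \<le> C * G"
      using row_energy_power(2)[OF bounds i g K(2), of j] g0 by (simp add: G_def)
    then show "(\<integral>\<omega>. ?y \<omega> j ^ 4 * g (weights \<omega>) \<partial>M) \<le> C * G" by simp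
    show "(\<integral>\<omega>. ?Q \<omega> ^ (2 * r) * g (weights \<omega>) \<partial>M) \<le> 4 ^ r * (1 + C) * G"
      using gain_power_le[OF K(1)] by (simp add: G_def power_mult)
  qed simp
  also have "\<dots> = (C + 4 ^ r * (1 + C)) / N * G"
    using N by (simp add: N_def power2_eq_square field_simps)
  finally show ?thesis by (simp add: N_def G_def)
qed

end

end

end

section \<open>Moments of the energy\<close>

lemma abs_ln_diff_le:
  fixes x y :: real
  assumes "1 \<le> x" "1 \<le> y"
  shows "\<bar>ln x - ln y\<bar> \<le> \<bar>x - y\<bar>"
proof -
  have "ln x - ln y \<le> \<bar>x - y\<bar>" if "1 \<le> x" "1 \<le> y" for x y :: real
  proof -
    have "ln x - ln y = ln (x / y)" using that by (simp add: ln_div)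
    also have "\<dots> \<le> x / y - 1" using that by (intro ln_le_minus_one) auto
    also have "\<dots> = (x - y) / y" using that by (simp add: field_simps)
    also have "\<dots> \<le> \<bar>x - y\<bar> / 1" using that by (intro frac_le) auto
    finally show ?thesis by simp
  qed
  from this[OF assms] this[OF assms(2,1)] show ?thesis by (simp add: abs_if split: if_splits)
qed

lemma abs_ln_one_plus_diff_le:
  fixes z :: real
  assumes "0 \<le> z"
  shows "\<bar>ln (1 + z) - z\<bar> \<le> z\<^sup>2"
proof -
  have "z - z\<^sup>2 \<le> ln (1 + z)"
  proof (cases "z \<le> 1")
    case True
    then show ?thesis using ln_one_plus_pos_lower_bound assms by simp
  next
    case False
    then have "z * 1 \<le> z * z" by (intro mult_left_mono) auto
    moreover have "0 \<le> ln (1 + z)" using assms by simp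
    ultimately show ?thesis by (simp add: power2_eq_square)
  qed
  moreover have "ln (1 + z) \<le> z" using assms by (rule ln_add_one_self_le_self)
  ultimately show ?thesis by (simp add: abs_if)
qed

context network
begin

definition energy_moment :: "nat \<Rightarrow> nat \<Rightarrow> real" where
  "energy_moment k i = (\<integral>\<omega>. energy p n u (weights \<omega>) i ^ k \<partial>M)"

definition moment_const :: "nat \<Rightarrow> real \<Rightarrow> real" where
  "moment_const k C = 2 ^ k * C + real (k choose 2) * (var_const * (C + 4 ^ k * (1 + C)))"

context
  fixes K :: nat and C :: real and k :: nat
  assumes bounds: "layer_bounds K C" and K: "8 * k + 12 \<le> K"
begin

lemma adapted_energy_power: "adapted n i (\<lambda>x. energy p n u x i ^ k)"
  by (intro adapted_power adapted_energy)

lemma energy_power_Suc: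
  "energy p n u x (Suc i) ^ k = step_gain p n u x i ^ k * energy p n u x i ^ k"
  by (simp add: energy_step power_mult_distrib)

lemma energy_power_nonneg: "0 \<le> energy p n u x i ^ k"
  by (simp add: energy_nonneg)

lemma integrable_energy_power: "i \<le> d \<Longrightarrow> integrable M (\<lambda>\<omega>. energy p n u (weights \<omega>) i ^ k)"
proof (induction i)
  case 0
  show ?case by (simp add: energy_0)
next
  case (Suc i)
  then show ?case
    unfolding energy_power_Suc
    using K by (intro gain_power_integrable(1)[OF bounds _ adapted_energy_power _ energy_power_nonneg]) auto
qed

lemma energy_moment_mono:
  assumes i: "i < d"
  shows "energy_moment k i \<le> energy_moment k (Suc i)"
  unfolding energy_moment_def energy_power_Suc
  by (rule gain_power_ge[OF bounds i adapted_energy_power integrable_energy_power energy_power_nonneg])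
     (use i K in auto)

lemma energy_moment_0: "energy_moment k 0 = 1"
  by (simp add: energy_moment_def energy_0 prob_space)

lemma energy_moment_ge_1: "i \<le> d \<Longrightarrow> 1 \<le> energy_moment k i"
proof (induction i)
  case (Suc i)
  then show ?case using energy_moment_mono[of i] by simp
qed (simp add: energy_moment_0)

lemma moment_const_nonneg: "0 \<le> moment_const k C"
  using C_nonneg[OF bounds] var_const_nonneg by (simp add: moment_const_def)

text \<open>Only the replacement of the conditional variance by \<open>layer_var i\<close> is
  delicate. For \<open>i > 0\<close> its error is the fourth-power sum of the heading weighted by
  the \<open>k\<close>-th power of the energy. That weight contains the \<open>k\<close>-th power of
  the preceding gain, just what \<open>quart_gain_le\<close> needs to bring in the missing factor
  \<open>1 / n i\<close>.\<close>

lemma energy_moment_step: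
  assumes i: "i < d"
  shows "\<bar>energy_moment k (Suc i) - (1 + real (k choose 2) * layer_var i) * energy_moment k i\<bar> \<le>
    moment_const k C * layer_err i * energy_moment k i"
proof -
  define N where "N = real (n (Suc i))"
  define c where "c = real (k choose 2)"
  define D where "D = C + 4 ^ k * (1 + C)"
  let ?g = "\<lambda>x. energy p n u x i ^ k"
  have N: "1 \<le> N" using n_Suc_ge_1[OF i] by (simp add: N_def)
  have C0: "0 \<le> C" by (rule C_nonneg[OF bounds])
  have e1: "1 \<le> energy_moment k i" using energy_moment_ge_1 i by simp
  note g = adapted_energy_power[of i] integrable_energy_power[OF less_imp_le[OF i]]
  let ?V = "\<integral>\<omega>. (deviation \<omega> i)\<^sup>2 * ?g (weights \<omega>) \<partial>M"
  have 1: "\<bar>energy_moment k (Suc i) - energy_moment k i - c * ?V\<bar> \<le> 2 ^ k * (C / N\<^sup>2 * energy_moment k i)"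
    using gain_power_expand[OF bounds i g energy_power_nonneg, of k] K
    unfolding energy_moment_def energy_power_Suc c_def N_def by simp
  have 2: "c * \<bar>?V - layer_var i * energy_moment k i\<bar> \<le>
      c * (if i = 0 then 0 else var_const * D / (N * real (n i)) * energy_moment k i)"
  proof (cases "c = 0 \<or> i = 0")
    case True
    then show ?thesis
      using deviation_sq_expand[OF bounds i g] K by (auto simp: energy_moment_def)
  next
    case False
    then obtain l where l: "i = Suc l" using not0_implies_Suc by blast
    \<comment> \<open>Two powers of the gain are thus always at hand: for \<open>k < 2\<close> the
      coefficient \<open>c\<close> vanishes, and the term with it.\<close>
    have "2 \<le> k" by (rule ccontr) (use False in \<open>simp add: c_def binomial_eq_0\<close>)
    then have k: "k = (k - 2) + 2" by simp
    have ld: "l < d" "l \<le> d" using i l by auto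
    have Q: "(\<integral>\<omega>. quart_norm (n i) (dir (weights \<omega>) i) * ?g (weights \<omega>) \<partial>M) \<le> D / real (n i) * energy_moment k i"
    proof -
      have "(\<integral>\<omega>. quart_norm (n i) (dir (weights \<omega>) i) * ?g (weights \<omega>) \<partial>M) =
        (\<integral>\<omega>. quart_norm (n (Suc l)) (dir (weights \<omega>) (Suc l)) *
          (step_gain p n u (weights \<omega>) l ^ ((k - 2) + 2) * energy p n u (weights \<omega>) l ^ k) \<partial>M)"
        unfolding l energy_power_Suc k[symmetric] ..
      also have "\<dots> \<le> (C + 4 ^ (k - 2) * (1 + C)) / real (n (Suc l)) * energy_moment k l"
        unfolding energy_moment_def
        by (rule quart_gain_le[OF bounds ld(1) adapted_energy_power integrable_energy_power[OF ld(2)] energy_power_nonneg])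
           (use K in auto)
      \<comment> \<open>Monotonicity of the moments returns from layer \<open>l\<close> to layer
        \<open>i\<close>, so that the error is relative to the current moment.\<close>
      also have "\<dots> \<le> D / real (n (Suc l)) * energy_moment k (Suc l)"
      proof (intro mult_mono divide_right_mono)
        show "C + 4 ^ (k - 2) * (1 + C) \<le> D"
          unfolding D_def using C0 by (intro add_left_mono mult_right_mono power_increasing) auto
        show "energy_moment k l \<le> energy_moment k (Suc l)" by (rule energy_moment_mono[OF ld(1)])
        show "0 \<le> D / real (n (Suc l))" using C0 by (simp add: D_def)
        show "0 \<le> energy_moment k l" using energy_moment_ge_1[OF ld(2)] by simp
      qed simp
      finally show ?thesis by (simp add: l)
    qed
    have "\<bar>?V - layer_var i * energy_moment k i\<bar> \<le>
        var_const / N * (\<integral>\<omega>. quart_norm (n i) (dir (weights \<omega>) i) * ?g (weights \<omega>) \<partial>M)"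
      using deviation_sq_expand[OF bounds i g] K False energy_power_nonneg
      by (simp add: energy_moment_def N_def)
    also have "\<dots> \<le> var_const / N * (D / real (n i) * energy_moment k i)"
      using Q var_const_nonneg N by (intro mult_left_mono) auto
    also have "\<dots> = (if i = 0 then 0 else var_const * D / (N * real (n i)) * energy_moment k i)"
      using False by simp
    finally show ?thesis by (rule mult_left_mono) (simp add: c_def)
  qed
  have tri: "\<bar>a + c * b\<bar> \<le> \<bar>a\<bar> + c * \<bar>b\<bar>" for a b
    using abs_triangle_ineq[of a "c * b"] by (simp add: abs_mult c_def)
  have eq: "energy_moment k (Suc i) - (1 + c * layer_var i) * energy_moment k i =
      (energy_moment k (Suc i) - energy_moment k i - c * ?V) + c * (?V - layer_var i * energy_moment k i)"
    by (simp add: algebra_simps)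
  have "\<bar>energy_moment k (Suc i) - (1 + c * layer_var i) * energy_moment k i\<bar> \<le>
      \<bar>energy_moment k (Suc i) - energy_moment k i - c * ?V\<bar> + c * \<bar>?V - layer_var i * energy_moment k i\<bar>"
    unfolding eq by (rule tri)
  also have "\<dots> \<le> 2 ^ k * (C / N\<^sup>2 * energy_moment k i) +
      c * (if i = 0 then 0 else var_const * D / (N * real (n i)) * energy_moment k i)"
    by (rule add_mono[OF 1 2])
  also have "\<dots> = (2 ^ k * C) * (1 / N\<^sup>2) * energy_moment k i +
      (c * (var_const * D)) * (if i = 0 then 0 else 1 / (N * real (n i))) * energy_moment k i"
    by simp
  also have "\<dots> \<le> (2 ^ k * C) * layer_err i * energy_moment k i + (c * (var_const * D)) * layer_err i * energy_moment k i"
  proof (intro add_mono mult_right_mono mult_left_mono)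
    show "1 / N\<^sup>2 \<le> layer_err i" unfolding N_def by (rule layer_err_ge)
    show "(if i = 0 then 0 else 1 / (N * real (n i))) \<le> layer_err i"
      by (simp add: layer_err_def N_def)
  qed (use C0 var_const_nonneg e1 in \<open>auto simp: D_def c_def\<close>)
  also have "\<dots> = moment_const k C * layer_err i * energy_moment k i"
    by (simp add: moment_const_def D_def c_def distrib_right)
  finally show ?thesis by (simp add: c_def)
qed

text \<open>Dividing each step by the current moment gives a ratio \<open>\<rho>\<close> at least 1,
  where the logarithm is 1-Lipschitz. Its logarithm is \<open>c * layer_var i\<close> up to the step
  error and the square of that term, and the logarithms telescope. No bound on the moments
  themselves is involved.\<close>

lemma energy_moment_exp:
  "\<exists>r. \<bar>r\<bar> \<le> (2 * moment_const k C + (real (k choose 2))\<^sup>2 * var_const\<^sup>2) * inv_sq_sum d n \<and>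
     energy_moment k d = exp (real (k choose 2) * beta_param \<mu> p d n u + r)"
proof -
  define c where "c = real (k choose 2)"
  define r where "r = ln (energy_moment k d) - c * beta_param \<mu> p d n u"
  have step: "\<bar>ln (energy_moment k (Suc i)) - ln (energy_moment k i) - c * layer_var i\<bar> \<le>
      moment_const k C * layer_err i + c\<^sup>2 * (layer_var i)\<^sup>2" if i: "i < d" for i
  proof -
    have e: "1 \<le> energy_moment k i" using energy_moment_ge_1 i by simp
    define \<rho> where "\<rho> = energy_moment k (Suc i) / energy_moment k i"
    have \<rho>: "1 \<le> \<rho>" using energy_moment_mono[OF i] e by (simp add: \<rho>_def)
    have z: "0 \<le> c * layer_var i" using layer_var_bounds(1)[OF i] by (simp add: c_def)
    have eq: "\<rho> - (1 + c * layer_var i) = (energy_moment k (Suc i) - (1 + c * layer_var i) * energy_moment k i) / energy_moment k i"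
      using e by (simp add: \<rho>_def diff_divide_distrib)
    have "\<bar>\<rho> - (1 + c * layer_var i)\<bar> =
        \<bar>energy_moment k (Suc i) - (1 + c * layer_var i) * energy_moment k i\<bar> / energy_moment k i"
      unfolding eq abs_divide using e by simp
    also have "\<dots> \<le> moment_const k C * layer_err i * energy_moment k i / energy_moment k i"
      using energy_moment_step[OF i] e by (intro divide_right_mono) (auto simp: c_def)
    finally have "\<bar>\<rho> - (1 + c * layer_var i)\<bar> \<le> moment_const k C * layer_err i" using e by simp
    moreover have "\<bar>ln \<rho> - ln (1 + c * layer_var i)\<bar> \<le> \<bar>\<rho> - (1 + c * layer_var i)\<bar>"
      using \<rho> z by (intro abs_ln_diff_le) auto
    moreover have "\<bar>ln (1 + c * layer_var i) - c * layer_var i\<bar> \<le> c\<^sup>2 * (layer_var i)\<^sup>2"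
      using abs_ln_one_plus_diff_le[OF z] by (simp add: power_mult_distrib)
    moreover have "ln \<rho> = ln (energy_moment k (Suc i)) - ln (energy_moment k i)"
      using e energy_moment_mono[OF i] by (simp add: \<rho>_def ln_div)
    ultimately show ?thesis by linarith
  qed
  have eq: "r = (\<Sum>i<d. ln (energy_moment k (Suc i)) - ln (energy_moment k i) - c * layer_var i)"
    unfolding sum_subtractf[of _ "\<lambda>i. c * layer_var i"]
      sum_lessThan_telescope[of "\<lambda>i. ln (energy_moment k i)"]
    by (simp add: r_def energy_moment_0 sum_layer_var flip: sum_distrib_left)
  have "\<bar>r\<bar> \<le> (\<Sum>i<d. moment_const k C * layer_err i + c\<^sup>2 * (layer_var i)\<^sup>2)"
    unfolding eq by (rule order_trans[OF sum_abs sum_mono]) (use step in auto)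
  also have "\<dots> = moment_const k C * (\<Sum>i<d. layer_err i) + c\<^sup>2 * (\<Sum>i<d. (layer_var i)\<^sup>2)"
    by (simp add: sum.distrib sum_distrib_left)
  also have "\<dots> \<le> moment_const k C * (2 * inv_sq_sum d n) + c\<^sup>2 * (var_const\<^sup>2 * inv_sq_sum d n)"
    by (intro add_mono mult_left_mono sum_layer_err sum_layer_var_sq moment_const_nonneg) simp
  also have "\<dots> = (2 * moment_const k C + c\<^sup>2 * var_const\<^sup>2) * inv_sq_sum d n"
    by (simp add: algebra_simps)
  finally have "\<bar>r\<bar> \<le> (2 * moment_const k C + c\<^sup>2 * var_const\<^sup>2) * inv_sq_sum d n" .
  moreover have "energy_moment k d = exp (c * beta_param \<mu> p d n u + r)"
    using energy_moment_ge_1[of d] by (simp add: r_def)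
  ultimately show ?thesis unfolding c_def by blast
qed

end

end

section \<open>Characteristic function of the log-energy\<close>

context network
begin

text \<open>A real variable defined everywhere, in place of a logarithm that may be infinite; it
  agrees with the logarithm of the energy outside \<open>bad_event\<close>.\<close>

definition log_energy :: "nat \<Rightarrow> (param \<Rightarrow> real) \<Rightarrow> real" where
  "log_energy i x = (\<Sum>l<i. trunc_ln (step_gain p n u x l))"

lemma adapted_log_energy: "adapted n i (log_energy i)"
proof -
  have "adapted n i (\<lambda>x. trunc_ln (step_gain p n u x l))" if "l < i" for l
    using that by (intro adapted_compose[OF adapted_mono[OF adapted_step_gain]]) auto
  then have "adapted n i (\<lambda>x. \<Sum>l<i. trunc_ln (step_gain p n u x l))"
    by (intro adapted_sum) auto
  then show ?thesis by (simp add: log_energy_def[abs_def])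
qed

lemma adapted_phase: "adapted n i (\<lambda>x. iexp (t * log_energy i x))"
  by (rule adapted_compose[OF adapted_log_energy, where h = "\<lambda>y. iexp (t * y)"]) simp

lemma integrable_phase: "i \<le> d \<Longrightarrow> integrable M (\<lambda>\<omega>. iexp (t * log_energy i (weights \<omega>)))"
  by (intro integrable_const_bound[of _ 1] AE_I2 measurable_adapted[OF adapted_phase]) auto

definition phase_mean :: "real \<Rightarrow> nat \<Rightarrow> complex" where
  "phase_mean t i = (\<integral>\<omega>. iexp (t * log_energy i (weights \<omega>)) \<partial>M)"

text \<open>The parts are 300 from the Taylor remainder and 1 from the cubic term, 20 from the mean
  fourth-power sum of a heading, and \<open>var_const\<^sup>2\<close> from the linearised
  exponential.\<close>

definition phase_const :: "real \<Rightarrow> real" where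
  "phase_const C = 301 * C + 20 * var_const * C + var_const\<^sup>2"

definition bad_event :: "'a set" where
  "bad_event = {\<omega>\<in>space M. \<exists>i<d. 1 / 2 < \<bar>deviation \<omega> i\<bar>}"

context
  fixes K :: nat and C :: real
  assumes bounds: "layer_bounds K C" and K: "20 \<le> K"
begin

text \<open>Order 4 is the highest deviation needed for the characteristic function;
  \<open>4 * 4 + 4\<close> is the required value 20 of \<open>K\<close>.\<close>

lemma deviation_pow4:
  assumes i: "i < d"
  shows "integrable M (\<lambda>\<omega>. deviation \<omega> i ^ 4)"
    and "(\<integral>\<omega>. deviation \<omega> i ^ 4 \<partial>M) \<le> C / (real (n (Suc i)))\<^sup>2"
  using deviation_power(1)[OF bounds i, of "\<lambda>_. 1 :: real" 4] deviation_higher[OF bounds i, of "\<lambda>_. 1 :: real" 4] K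
  by (simp_all add: adapted_const prob_space)

text \<open>A phase has modulus 1 and supplies no power of the gain to clear the denominator. Where
  the deviation is at most 1/2, the squared gain is at least 1/4 and can be inserted at the price of
  a factor 4. Elsewhere the fourth-power sum is at most 1, hence at most
  \<open>16 * deviation \<omega> i ^ 4\<close>. The sum 4 + 16 is the constant.\<close>

lemma quart_mean:
  assumes i: "i < d"
  shows "(\<integral>\<omega>. quart_norm (n (Suc i)) (dir (weights \<omega>) (Suc i)) \<partial>M) \<le> 20 * C / real (n (Suc i))"
proof -
  define N where "N = real (n (Suc i))"
  let ?q = "\<lambda>\<omega>. quart_norm (n (Suc i)) (dir (weights \<omega>) (Suc i))"
  let ?y = "\<lambda>\<omega> j. row_energy p (weights \<omega>) (n i) (Suc i) (dir (weights \<omega>) i) j"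
  have N: "1 \<le> N" using n_Suc_ge_1[OF i] by (simp add: N_def)
  have C0: "0 \<le> C" by (rule C_nonneg[OF bounds])
  have int1: "integrable M (\<lambda>\<omega>. (?y \<omega> j)\<^sup>2)" and le1: "(\<integral>\<omega>. (?y \<omega> j)\<^sup>2 \<partial>M) \<le> C" if "j < n (Suc i)" for j
    using row_energy_power[OF bounds i, of "\<lambda>_. 1 :: real" 2 j] that K by (simp_all add: adapted_const prob_space)
  note d4 = deviation_pow4[OF i]
  have q0: "0 \<le> ?q \<omega>" for \<omega> by (rule quart_dir_bounds) (use i in simp)
  have pt: "?q \<omega> \<le> 4 / N\<^sup>2 * (\<Sum>j<n (Suc i). (?y \<omega> j)\<^sup>2) + 16 * deviation \<omega> i ^ 4" for \<omega>
  proof (cases "\<bar>deviation \<omega> i\<bar> \<le> 1 / 2")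
    case True
    define Q where "Q = step_gain p n u (weights \<omega>) i"
    have "1 / 2 \<le> Q" using abs_le_D2[OF True] by (simp add: Q_def)
    then have "(1 / 2)\<^sup>2 \<le> Q\<^sup>2" by (intro power_mono) auto
    then have "1 \<le> 4 * Q\<^sup>2" by (simp add: power2_eq_square)
    then have "?q \<omega> * 1 \<le> ?q \<omega> * (4 * Q\<^sup>2)"
      by (rule mult_left_mono[OF _ q0])
    also have "\<dots> = 4 * (?q \<omega> * Q\<^sup>2)" by simp
    also have "?q \<omega> * Q\<^sup>2 = (\<Sum>j<n (Suc i). (?y \<omega> j)\<^sup>2) / N\<^sup>2"
      using quart_norm_heading_Suc[where n = n and i = i and u = u and x = "weights \<omega>", OF p_pos] n_pos[of "Suc i"] i
      by (simp only: N_def Q_def)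
    finally have "?q \<omega> \<le> 4 / N\<^sup>2 * (\<Sum>j<n (Suc i). (?y \<omega> j)\<^sup>2)" by simp
    moreover have "0 \<le> deviation \<omega> i ^ 4" by (rule zero_le_even_power) simp
    ultimately show ?thesis by linarith
  next
    case False
    then have "(1 / 2) ^ 4 \<le> \<bar>deviation \<omega> i\<bar> ^ 4" by (intro power_mono) auto
    then have "1 \<le> 16 * deviation \<omega> i ^ 4" by (simp add: power_even_abs power_divide)
    moreover have "?q \<omega> \<le> 1" by (rule quart_dir_bounds) (use i in simp)
    moreover have "0 \<le> 4 / N\<^sup>2 * (\<Sum>j<n (Suc i). (?y \<omega> j)\<^sup>2)" by (simp add: sum_nonneg)
    ultimately show ?thesis by linarith
  qed
  have "(\<integral>\<omega>. ?q \<omega> \<partial>M) \<le> (\<integral>\<omega>. 4 / N\<^sup>2 * (\<Sum>j<n (Suc i). (?y \<omega> j)\<^sup>2) + 16 * deviation \<omega> i ^ 4 \<partial>M)"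
  proof (rule integral_mono')
    show "integrable M (\<lambda>\<omega>. 4 / N\<^sup>2 * (\<Sum>j<n (Suc i). (?y \<omega> j)\<^sup>2) + 16 * deviation \<omega> i ^ 4)"
      using int1 d4(1) by (intro Bochner_Integration.integrable_add integrable_mult_right Bochner_Integration.integrable_sum) auto
    show "0 \<le> 4 / N\<^sup>2 * (\<Sum>j<n (Suc i). (?y \<omega> j)\<^sup>2) + 16 * deviation \<omega> i ^ 4" for \<omega>
      by (intro add_nonneg_nonneg mult_nonneg_nonneg sum_nonneg) auto
  qed (rule pt)
  also have "\<dots> = 4 / N\<^sup>2 * (\<Sum>j<n (Suc i). \<integral>\<omega>. (?y \<omega> j)\<^sup>2 \<partial>M) + 16 * (\<integral>\<omega>. deviation \<omega> i ^ 4 \<partial>M)"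
  proof -
    define Y where "Y \<omega> = (\<Sum>j<n (Suc i). (?y \<omega> j)\<^sup>2)" for \<omega>
    have "integrable M Y" "(\<integral>\<omega>. Y \<omega> \<partial>M) = (\<Sum>j<n (Suc i). \<integral>\<omega>. (?y \<omega> j)\<^sup>2 \<partial>M)"
      unfolding Y_def using int1 by (auto intro!: Bochner_Integration.integrable_sum Bochner_Integration.integral_sum)
    then show ?thesis using d4(1) unfolding Y_def[symmetric] by simp
  qed
  also have "\<dots> \<le> 4 / N\<^sup>2 * (\<Sum>j<n (Suc i). C) + 16 * (C / N\<^sup>2)"
    using le1 d4(2) by (intro add_mono mult_left_mono sum_mono) (auto simp: N_def)
  also have "\<dots> = 4 * C / N + 16 * (C / N\<^sup>2)"
    using N by (simp add: N_def[symmetric] power2_eq_square)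
  also have "\<dots> \<le> 4 * C / N + 16 * (C / N)"
    using N C0 by (intro add_left_mono mult_left_mono frac_le) (auto simp: power2_eq_square)
  also have "\<dots> = 20 * C / N" by simp
  finally show ?thesis by (simp add: N_def)
qed

lemma phase_const_nonneg: "0 \<le> phase_const C"
  using C_nonneg[OF bounds] var_const_nonneg by (simp add: phase_const_def)

lemma phase_mean_norm: "i \<le> d \<Longrightarrow> cmod (phase_mean t i) \<le> 1"
  unfolding phase_mean_def
  by (rule order_trans[OF integral_norm_bound]) (simp add: prob_space)

text \<open>The factor contributed by the new layer is expanded to third order in the deviation.
  Conditionally on the past, the linear term vanishes, the quadratic one gives
  \<open>c2 * layer_var i\<close> plus the heading error, and the cubic term and the remainder are
  of order \<open>1 / (real (n (Suc i)))\<^sup>2\<close>. The exponential then replaces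
  \<open>1 + c2 * layer_var i\<close>, to make the layers multiply exactly.\<close>

lemma phase_mean_step:
  fixes t :: real
  assumes i: "i < d"
  defines "c2 \<equiv> \<i> * t * (\<i> * t - 1) / 2"
  shows "cmod (phase_mean t (Suc i) - exp (c2 * layer_var i) * phase_mean t i) \<le>
    phase_const C * (\<bar>t\<bar> + t ^ 4) * layer_err i"
proof -
  define N where "N = real (n (Suc i))"
  define c3 where "c3 = \<i> * t * (\<i> * t - 1) * (\<i> * t - 2) / 6"
  define \<tau> where "\<tau> = \<bar>t\<bar> + t ^ 4"
  define v where "v = layer_var i"
  let ?\<delta> = "\<lambda>\<omega>. deviation \<omega> i"
  define g where "g x = iexp (t * log_energy i x)" for x
  define R where "R \<omega> = iexp (t * trunc_ln (1 + ?\<delta> \<omega>)) - (1 + \<i> * t * ?\<delta> \<omega> + c2 * (?\<delta> \<omega>)\<^sup>2 + c3 * ?\<delta> \<omega> ^ 3)" for \<omega>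
  have N: "1 \<le> N" using n_Suc_ge_1[OF i] by (simp add: N_def)
  have C0: "0 \<le> C" by (rule C_nonneg[OF bounds])
  have \<tau>0: "0 \<le> \<tau>" by (simp add: \<tau>_def)
  have g1: "cmod (g x) = 1" for x by (simp add: g_def)
  have g: "adapted n i g" "integrable M (\<lambda>\<omega>. g (weights \<omega>))"
    using adapted_phase integrable_phase[of i] i by (simp_all add: g_def[abs_def])
  have c2: "cmod c2 \<le> \<tau>" "(cmod c2)\<^sup>2 \<le> \<tau>" and c3: "cmod c3 \<le> \<tau>"
    unfolding c2_def c3_def \<tau>_def by (rule iexp_trunc_ln_taylor)+
  have Rb: "cmod (R \<omega>) \<le> 300 * \<tau> * ?\<delta> \<omega> ^ 4" for \<omega>
    using iexp_trunc_ln_taylor(1)[of t "?\<delta> \<omega>"] unfolding R_def c2_def c3_def \<tau>_def by simp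
  have int: "integrable M (\<lambda>\<omega>. of_real (?\<delta> \<omega> ^ r) * g (weights \<omega>))" if "r \<le> 4" for r
    using deviation_power(1)[OF bounds i g, of r] K that by (simp add: scaleR_conv_of_real)
  have E1: "(\<integral>\<omega>. of_real (?\<delta> \<omega>) * g (weights \<omega>) \<partial>M) = 0"
    using deviation_mean[OF bounds i g] K by (simp add: scaleR_conv_of_real)
  define E2 where "E2 = (\<integral>\<omega>. of_real ((?\<delta> \<omega>)\<^sup>2) * g (weights \<omega>) \<partial>M)"
  define E3 where "E3 = (\<integral>\<omega>. of_real (?\<delta> \<omega> ^ 3) * g (weights \<omega>) \<partial>M)"
  have E3b: "cmod E3 \<le> C / N\<^sup>2"
    using deviation_higher[OF bounds i g, of 3] K g1 by (simp add: E3_def N_def scaleR_conv_of_real prob_space)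
  have E2b: "cmod (E2 - v * phase_mean t i) \<le> 20 * var_const * C * layer_err i"
  proof (cases "i = 0")
    case True
    have "cmod (E2 - v * phase_mean t i) \<le> 0"
      using deviation_sq_expand[OF bounds i g] K True
      by (simp add: E2_def v_def phase_mean_def g_def scaleR_conv_of_real)
    also have "0 \<le> 20 * var_const * C * layer_err i"
      using C0 var_const_nonneg layer_err_nonneg by simp
    finally show ?thesis .
  next
    case False
    then obtain l where l: "i = Suc l" using not0_implies_Suc by blast
    have "cmod (E2 - v * phase_mean t i) \<le> var_const / N * (\<integral>\<omega>. quart_norm (n i) (dir (weights \<omega>) i) \<partial>M)"
      using deviation_sq_expand[OF bounds i g] K False g1
      by (simp add: E2_def v_def phase_mean_def g_def N_def scaleR_conv_of_real)
    also have "\<dots> \<le> var_const / N * (20 * C / real (n i))"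
      using quart_mean[of l] i l var_const_nonneg N by (intro mult_left_mono) auto
    also have "\<dots> = 20 * var_const * C * (1 / (N * real (n i)))" by simp
    also have "\<dots> \<le> 20 * var_const * C * layer_err i"
      using C0 var_const_nonneg False by (intro mult_left_mono) (auto simp: layer_err_def N_def)
    finally show ?thesis .
  qed
  have expand: "iexp (t * log_energy (Suc i) (weights \<omega>)) =
      g (weights \<omega>) + \<i> * t * (of_real (?\<delta> \<omega>) * g (weights \<omega>)) + c2 * (of_real ((?\<delta> \<omega>)\<^sup>2) * g (weights \<omega>)) +
      c3 * (of_real (?\<delta> \<omega> ^ 3) * g (weights \<omega>)) + R \<omega> * g (weights \<omega>)" for \<omega>
  proof -
    have "iexp (t * log_energy (Suc i) (weights \<omega>)) = g (weights \<omega>) * iexp (t * trunc_ln (1 + ?\<delta> \<omega>))"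
      by (simp add: g_def log_energy_def distrib_left exp_add[symmetric])
    then show ?thesis by (simp add: R_def algebra_simps)
  qed
  have intR: "integrable M (\<lambda>\<omega>. R \<omega> * g (weights \<omega>))"
  proof -
    have "R \<omega> * g (weights \<omega>) = iexp (t * log_energy (Suc i) (weights \<omega>)) -
      (g (weights \<omega>) + \<i> * t * (of_real (?\<delta> \<omega>) * g (weights \<omega>)) + c2 * (of_real ((?\<delta> \<omega>)\<^sup>2) * g (weights \<omega>)) +
      c3 * (of_real (?\<delta> \<omega> ^ 3) * g (weights \<omega>)))" for \<omega>
      unfolding expand by simp
    then show ?thesis
      using int[of 1] int[of 2] int[of 3] g(2) integrable_phase[of "Suc i" t] i by simp
  qed
  define ER where "ER = (\<integral>\<omega>. R \<omega> * g (weights \<omega>) \<partial>M)"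
  have ERb: "cmod ER \<le> 300 * \<tau> * (C / N\<^sup>2)"
  proof -
    have "cmod ER \<le> (\<integral>\<omega>. 300 * \<tau> * ?\<delta> \<omega> ^ 4 \<partial>M)"
      unfolding ER_def using deviation_pow4(1)[OF i] Rb g1
      by (intro norm_integral_le) (auto simp: norm_mult)
    also have "\<dots> \<le> 300 * \<tau> * (C / N\<^sup>2)"
      using mult_left_mono[OF deviation_pow4(2)[OF i], of "300 * \<tau>"] \<tau>0 by (simp add: N_def)
    finally show ?thesis .
  qed
  have "phase_mean t (Suc i) = phase_mean t i + c2 * E2 + c3 * E3 + ER"
    unfolding phase_mean_def expand E2_def E3_def ER_def
    using int[of 1] int[of 2] int[of 3] g(2) intR E1 by (simp add: g_def)
  then have "phase_mean t (Suc i) - exp (c2 * v) * phase_mean t i =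
      c2 * (E2 - v * phase_mean t i) + c3 * E3 + ER - (exp (c2 * v) - (1 + c2 * v)) * phase_mean t i"
    by (simp add: algebra_simps)
  then have "cmod (phase_mean t (Suc i) - exp (c2 * v) * phase_mean t i) \<le>
      cmod c2 * cmod (E2 - v * phase_mean t i) + cmod c3 * cmod E3 + cmod ER +
      cmod (exp (c2 * v) - (1 + c2 * v)) * cmod (phase_mean t i)"
    by (simp only: norm_mult[symmetric]) (intro norm_triangle_le_diff norm_triangle_le add_mono order_refl)
  also have "\<dots> \<le> \<tau> * (20 * var_const * C * layer_err i) + \<tau> * (C / N\<^sup>2) + 300 * \<tau> * (C / N\<^sup>2) +
      \<tau> * (var_const\<^sup>2 / N\<^sup>2) * 1"
  proof (intro add_mono mult_mono c2 E2b c3 E3b ERb phase_mean_norm)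
    have "Re (c2 * v) \<le> 0"
      using layer_var_bounds(1)[OF i] by (simp add: c2_def v_def)
    then have "cmod (exp (c2 * v) - (1 + c2 * v)) \<le> (cmod (c2 * v))\<^sup>2"
      by (rule cmod_exp_linear_approx)
    also have "\<dots> = (cmod c2)\<^sup>2 * v\<^sup>2" by (simp add: norm_mult power_mult_distrib)
    also have "\<dots> \<le> \<tau> * (var_const / N)\<^sup>2"
      using layer_var_bounds[OF i] c2 \<tau>0 by (intro mult_mono power_mono) (auto simp: v_def N_def)
    finally show "cmod (exp (c2 * v) - (1 + c2 * v)) \<le> \<tau> * (var_const\<^sup>2 / N\<^sup>2)" by (simp add: power_divide)
  qed (use i \<tau>0 C0 var_const_nonneg in auto)
  also have "\<dots> = \<tau> * (20 * var_const * C) * layer_err i + \<tau> * (301 * C + var_const\<^sup>2) * (1 / N\<^sup>2)"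
    by (simp add: algebra_simps add_divide_distrib)
  also have "\<dots> \<le> \<tau> * (20 * var_const * C) * layer_err i + \<tau> * (301 * C + var_const\<^sup>2) * layer_err i"
    using \<tau>0 C0 layer_err_ge[of i] by (intro add_left_mono mult_left_mono) (auto simp: N_def)
  also have "\<dots> = phase_const C * \<tau> * layer_err i"
    by (simp add: phase_const_def algebra_simps)
  finally show ?thesis by (simp add: v_def \<tau>_def)
qed

text \<open>The multiplier of a layer has modulus \<open>exp (- layer_var i * t ^ 2 / 2)\<close>, at
  most 1. Earlier errors are therefore not amplified, and the errors of all layers simply
  add.\<close>

lemma phase_mean_approx:
  fixes t :: real
  assumes "i \<le> d"
  defines "c2 \<equiv> \<i> * t * (\<i> * t - 1) / 2"
  shows "cmod (phase_mean t i - exp (c2 * (\<Sum>l<i. layer_var l))) \<le>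
    phase_const C * (\<bar>t\<bar> + t ^ 4) * (\<Sum>l<i. layer_err l)"
  using assms(1)
proof (induction i)
  case 0
  show ?case by (simp add: phase_mean_def log_energy_def prob_space)
next
  case (Suc i)
  then have i: "i < d" by simp
  let ?s = "\<Sum>l<i. layer_var l" and ?\<tau> = "\<bar>t\<bar> + t ^ 4"
  have "Re (c2 * layer_var i) \<le> 0"
    using layer_var_bounds(1)[OF i] by (simp add: c2_def)
  then have e1: "cmod (exp (c2 * layer_var i)) \<le> 1" by (simp add: norm_exp_eq_Re)
  have "phase_mean t (Suc i) - exp (c2 * (\<Sum>l<Suc i. layer_var l)) =
      (phase_mean t (Suc i) - exp (c2 * layer_var i) * phase_mean t i) +
      exp (c2 * layer_var i) * (phase_mean t i - exp (c2 * ?s))"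
    by (simp add: algebra_simps exp_add[symmetric])
  then have "cmod (phase_mean t (Suc i) - exp (c2 * (\<Sum>l<Suc i. layer_var l))) \<le>
      cmod (phase_mean t (Suc i) - exp (c2 * layer_var i) * phase_mean t i) +
      cmod (exp (c2 * layer_var i)) * cmod (phase_mean t i - exp (c2 * ?s))"
    by (simp only: norm_mult[symmetric] norm_triangle_ineq)
  also have "\<dots> \<le> phase_const C * ?\<tau> * layer_err i + 1 * (phase_const C * ?\<tau> * (\<Sum>l<i. layer_err l))"
    using Suc.IH i e1 by (intro add_mono mult_mono phase_mean_step[OF i, of t, folded c2_def]) auto
  finally show ?case by (simp add: algebra_simps)
qed

text \<open>The accumulated exponent is
  \<open>- \<beta> * t ^ 2 / 2 - \<i> * t * \<beta> / 2\<close>: exactly that of a normal law with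
  variance \<beta> and mean \<open>- \<beta> / 2\<close>. The factor 2 comes from
  \<open>sum_layer_err\<close>.\<close>

lemma phase_mean_gaussian:
  "cmod (phase_mean t d - char (gaussian (- (1 / 2) * beta_param \<mu> p d n u) (beta_param \<mu> p d n u)) t) \<le>
    2 * phase_const C * inv_sq_sum d n * (\<bar>t\<bar> + t ^ 4)"
proof -
  define \<beta> where "\<beta> = beta_param \<mu> p d n u"
  have "char (gaussian (- (1 / 2) * \<beta>) \<beta>) t = exp (\<i> * t * (\<i> * t - 1) / 2 * \<beta>)"
    using beta_pos by (subst char_gaussian)
      (auto simp: \<beta>_def field_simps power2_eq_square intro!: arg_cong[where f = exp])
  then have "cmod (phase_mean t d - char (gaussian (- (1 / 2) * \<beta>) \<beta>) t) \<le>
      phase_const C * (\<bar>t\<bar> + t ^ 4) * (\<Sum>l<d. layer_err l)"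
    using phase_mean_approx[of d t] sum_layer_var by (simp add: \<beta>_def)
  also have "\<dots> \<le> phase_const C * (\<bar>t\<bar> + t ^ 4) * (2 * inv_sq_sum d n)"
    using phase_const_nonneg by (intro mult_left_mono sum_layer_err) auto
  also have "\<dots> = 2 * phase_const C * inv_sq_sum d n * (\<bar>t\<bar> + t ^ 4)" by (simp only: mult_ac)
  finally show ?thesis by (simp only: \<beta>_def)
qed

lemma measurable_deviation: "i < d \<Longrightarrow> (\<lambda>\<omega>. deviation \<omega> i) \<in> borel_measurable M"
  using measurable_adapted[OF adapted_step_gain, of i] by (intro borel_measurable_diff) auto

text \<open>Markov's inequality for the fourth power, with 16 = 2^4, and a union over the layers.
  Second moments would give only the sum of the \<open>1 / n i\<close>, which is too large.\<close>

lemma bad_event: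
  "bad_event \<in> sets M" "measure M bad_event \<le> 16 * C * inv_sq_sum d n"
proof -
  let ?B = "\<lambda>i. {\<omega>\<in>space M. 1 / 2 < \<bar>deviation \<omega> i\<bar>}"
  have B: "?B i \<in> sets M" if "i < d" for i
    using measurable_deviation[OF that] by measurable
  have eq: "bad_event = (\<Union>i\<in>{..<d}. ?B i)" by (auto simp: bad_event_def)
  show "bad_event \<in> sets M" unfolding eq using B by auto
  have "measure M (?B i) \<le> 16 * C * (1 / (real (n (Suc i)))\<^sup>2)" if i: "i < d" for i
  proof -
    have "measure M (?B i) = (\<integral>\<omega>. indicator (?B i) \<omega> \<partial>M)" using B[OF i] by simp
    also have "\<dots> \<le> (\<integral>\<omega>. 16 * deviation \<omega> i ^ 4 \<partial>M)"
    proof (rule integral_mono')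
      show "integrable M (\<lambda>\<omega>. 16 * deviation \<omega> i ^ 4)" using deviation_pow4(1)[OF i] by simp
      fix \<omega>
      show "0 \<le> 16 * deviation \<omega> i ^ 4" by simp
      have "1 \<le> 16 * deviation \<omega> i ^ 4" if "1 / 2 < \<bar>deviation \<omega> i\<bar>"
      proof -
        have "(1 / 2) ^ 4 \<le> \<bar>deviation \<omega> i\<bar> ^ 4" using that by (intro power_mono) auto
        then show ?thesis by (simp add: power_even_abs power_divide)
      qed
      then show "indicator (?B i) \<omega> \<le> 16 * deviation \<omega> i ^ 4" by (auto split: split_indicator)
    qed
    also have "\<dots> \<le> 16 * (C / (real (n (Suc i)))\<^sup>2)"
      using deviation_pow4(2)[OF i] by simp
    finally show ?thesis by simp
  qed
  then have "(\<Sum>i<d. measure M (?B i)) \<le> (\<Sum>i<d. 16 * C * (1 / (real (n (Suc i)))\<^sup>2))"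
    by (intro sum_mono) auto
  also have "\<dots> = 16 * C * inv_sq_sum d n"
    by (simp only: sum_distrib_left[symmetric] sum_inv_sq)
  finally show "measure M bad_event \<le> 16 * C * inv_sq_sum d n"
    unfolding eq using B by (intro order_trans[OF finite_measure_subadditive_finite]) auto
qed

lemma energy_good:
  assumes "\<omega> \<in> space M - bad_event"
  shows "0 < energy p n u (weights \<omega>) d \<and> ln (energy p n u (weights \<omega>) d) = log_energy d (weights \<omega>)"
proof -
  have near: "\<bar>deviation \<omega> i\<bar> \<le> 1 / 2" if "i < d" for i
  proof (rule ccontr)
    assume "\<not> ?thesis"
    then have "\<omega> \<in> bad_event" using assms that by (auto simp: bad_event_def not_le)
    then show False using assms by simp
  qed
  have pos: "0 < step_gain p n u (weights \<omega>) i" if "i < d" for i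
    using abs_le_D2[OF near[OF that]] by simp
  then have nz: "step_gain p n u (weights \<omega>) i \<noteq> 0" if "i < d" for i using that by fastforce
  have "ln (energy p n u (weights \<omega>) d) = (\<Sum>i<d. ln (step_gain p n u (weights \<omega>) i))"
    unfolding energy_def using pos nz by (subst ln_prod) auto
  also have "\<dots> = log_energy d (weights \<omega>)"
    unfolding log_energy_def trunc_ln_def using near by (intro sum.cong) auto
  finally show ?thesis using pos by (auto simp: energy_def intro: prod_pos)
qed

lemma ks_dist_bound:
  assumes S: "inv_sq_sum d n \<le> 1" and b: "0 < b" "b \<le> beta_param \<mu> p d n u"
  shows "ks_dist (distr M borel (\<lambda>\<omega>. ext_ln (scaled_sq_norm p d n W \<xi> u \<omega>)))
      (distr (gaussian (- (1 / 2) * beta_param \<mu> p d n u) (beta_param \<mu> p d n u)) borel ereal) \<le>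
    (4 * poly_gauss_const * phase_const C + 6 / sqrt b + 16 * C) * inv_sq_sum d n powr (1 / 5)"
proof -
  define s where "s = inv_sq_sum d n"
  define \<beta> where "\<beta> = beta_param \<mu> p d n u"
  define G where "G = gaussian (- (1 / 2) * \<beta>) \<beta>"
  define h where "h = s powr (1 / 5)"
  define X where "X \<omega> = log_energy d (weights \<omega>)" for \<omega>
  have \<beta>: "0 < \<beta>" using beta_pos by (simp add: \<beta>_def)
  have s: "0 < s" "s \<le> 1"
  proof -
    have "0 < 1 / (real (n (Suc i)))\<^sup>2" if "i < d" for i using n_Suc_ge_1[OF that] by simp
    then show "0 < s" unfolding s_def sum_inv_sq[symmetric] using d_pos by (intro sum_pos) auto
  qed (use S in \<open>simp add: s_def\<close>)
  have h: "0 < h" "h \<le> 1" using s by (auto simp: h_def powr_le_one_le intro!: powr_le1)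
  have h5: "h ^ 5 = s" using s by (simp add: h_def powr_power)
  have sh4: "s / h ^ 4 = h" using h h5 by (simp add: field_simps eval_nat_numeral)
  \<comment> \<open>Used for the bad event: its probability \<open>O(s)\<close> is dominated by the
    smoothing error because \<open>s \<le> 1\<close>.\<close>
  have sh: "s \<le> h"
  proof -
    have "h ^ 5 \<le> h ^ 1" using h by (intro power_decreasing) auto
    then show ?thesis by (simp add: h5)
  qed
  have G: "real_distribution G" unfolding G_def by (rule real_distribution_gaussian[OF \<beta>])
  have Xm: "X \<in> borel_measurable M"
    unfolding X_def by (rule measurable_adapted[OF adapted_log_energy]) simp
  have Zm: "(\<lambda>\<omega>. energy p n u (weights \<omega>) d) \<in> borel_measurable M"
    by (rule measurable_adapted[OF adapted_energy]) simp
  have char: "char (distr M borel X) t = phase_mean t d" for t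
    unfolding char_def phase_mean_def using Xm by (subst integral_distr) (auto simp: X_def)
  have cdf: "\<bar>cdf (distr M borel X) x - cdf G x\<bar> \<le>
      2 * poly_gauss_const * (2 * phase_const C * s) / h ^ 4 + 6 * (1 / sqrt \<beta>) * h" for x
  proof (rule kolmogorov_smoothing[OF real_distribution_distr[OF Xm] G _ _ h])
    show "cmod (char (distr M borel X) t - char G t) \<le> 2 * phase_const C * s * (\<bar>t\<bar> + t ^ 4)" for t
      unfolding char using phase_mean_gaussian[of t] by (simp add: G_def \<beta>_def s_def)
    show "cdf G y - cdf G x \<le> 1 / sqrt \<beta> * (y - x)" if "x \<le> y" for x y
      unfolding G_def by (rule cdf_gaussian_lipschitz[OF \<beta> that])
  qed (use phase_const_nonneg s \<beta> in auto)
  have "ks_dist (distr M borel (\<lambda>\<omega>. ext_ln (energy p n u (weights \<omega>) d))) (distr G borel ereal) \<le>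
      2 * poly_gauss_const * (2 * phase_const C * s) / h ^ 4 + 6 * (1 / sqrt \<beta>) * h + measure M bad_event"
    by (rule ks_dist_ext_ln_le[OF prob_space_axioms Xm Zm bad_event(1) _ G cdf])
       (use energy_good in \<open>simp add: X_def\<close>)
  also have "\<dots> \<le> 4 * poly_gauss_const * phase_const C * h + 6 / sqrt b * h + 16 * C * h"
  proof (intro add_mono)
    have "2 * poly_gauss_const * (2 * phase_const C * s) / h ^ 4 = 4 * poly_gauss_const * phase_const C * (s / h ^ 4)"
      by simp
    then show "2 * poly_gauss_const * (2 * phase_const C * s) / h ^ 4 \<le> 4 * poly_gauss_const * phase_const C * h"
      unfolding sh4 by simp
    have "6 / sqrt \<beta> \<le> 6 / sqrt b" using b by (intro divide_left_mono) (auto simp: \<beta>_def)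
    then show "6 * (1 / sqrt \<beta>) * h \<le> 6 / sqrt b * h" using h by (intro mult_right_mono) auto
    have "16 * C * s \<le> 16 * C * h" using sh C_nonneg[OF bounds] by (intro mult_left_mono) auto
    then show "measure M bad_event \<le> 16 * C * h" using bad_event(2) by (simp add: s_def)
  qed
  finally show ?thesis
    unfolding scaled_sq_norm_eq by (simp add: G_def \<beta>_def h_def s_def distrib_right)
qed

end

end

section \<open>Uniform constants\<close>

lemma real_choose_2: "real (k choose 2) = real k * (real k - 1) / 2"
  by (induction k) (simp_all add: numeral_2_eq_2 field_simps)

lemma abs_exp_minus_one_le: "\<bar>exp r - 1\<bar> \<le> \<bar>r\<bar> * exp \<bar>r\<bar>" for r :: real
proof (cases "0 \<le> r")
  case True
  have "(1 - r) * exp r \<le> exp (- r) * exp r"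
    using exp_ge_add_one_self[of "- r"] by (intro mult_right_mono) auto
  then have "exp r - 1 \<le> r * exp r" by (simp add: algebra_simps exp_add[symmetric])
  with True show ?thesis by simp
next
  case False
  have "\<bar>exp r - 1\<bar> = 1 - exp r" using False by simp
  also have "\<dots> \<le> \<bar>r\<bar> * 1" using exp_ge_add_one_self[of r] False by linarith
  also have "\<dots> \<le> \<bar>r\<bar> * exp \<bar>r\<bar>" by (intro mult_left_mono) auto
  finally show ?thesis .
qed

context network
begin

lemma moment_integral:
  "(\<integral>\<omega>. real (n 0) ^ k / real (n d) ^ k * l2_norm (matrix_product p n W \<xi> d \<omega> *\<^sub>v u) ^ (2 * k) \<partial>M) = energy_moment k d"
proof -
  have "real (n 0) ^ k / real (n d) ^ k * l2_norm (matrix_product p n W \<xi> d \<omega> *\<^sub>v u) ^ (2 * k) =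
      scaled_sq_norm p d n W \<xi> u \<omega> ^ k" for \<omega>
    by (simp add: scaled_sq_norm_def power_mult_distrib power_divide power_mult)
  then show ?thesis by (simp add: scaled_sq_norm_eq energy_moment_def)
qed

text \<open>Past the first layer \<open>3 / p - 1 \<ge> 1\<close> gives
  \<open>1 / n (Suc i) \<le> layer_var i\<close>. In the first layer the variance may be much
  smaller than \<open>1 / n 1\<close>, so this layer is charged to the constant 1. An upper bound on
  \<beta> thereby bounds the exponent error in the moments.\<close>

lemma inv_sq_sum_le: "inv_sq_sum d n \<le> 1 + beta_param \<mu> p d n u"
proof -
  have "1 / (real (n (Suc i)))\<^sup>2 \<le> (if i = 0 then 1 else 0) + layer_var i" if i: "i < d" for i
  proof -
    have N: "1 \<le> real (n (Suc i))" using n_Suc_ge_1[OF i] .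
    have sq: "1 / (real (n (Suc i)))\<^sup>2 \<le> 1 / real (n (Suc i))"
      using N by (intro divide_left_mono) (auto simp: power2_eq_square)
    show ?thesis
    proof (cases "i = 0")
      case True
      have "1 / real (n (Suc i)) \<le> 1" using N by simp
      then show ?thesis using sq True layer_var_bounds(1)[OF i] by simp
    next
      case False
      have "3 * p \<le> 3 * 1" using p_le_1 by simp
      then have "1 \<le> 3 / p - 1" using p_pos p_le_1 by (simp add: field_simps)
      then have "1 / real (n (Suc i)) \<le> (3 / p - 1) / real (n (Suc i))"
        by (intro divide_right_mono) auto
      then show ?thesis using sq False by (simp add: layer_var_def)
    qed
  qed
  then have "inv_sq_sum d n \<le> (\<Sum>i<d. (if i = 0 then 1 else 0) + layer_var i)"
    unfolding sum_inv_sq[symmetric] by (intro sum_mono) auto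
  also have "\<dots> = 1 + beta_param \<mu> p d n u"
    using d_pos by (simp add: sum.distrib sum_layer_var sum.delta)
  finally show ?thesis .
qed

lemma gaussian_moment:
  "(\<integral>x. exp x ^ k \<partial>gaussian (- (1 / 2) * beta_param \<mu> p d n u) (beta_param \<mu> p d n u)) =
    exp (real (k choose 2) * beta_param \<mu> p d n u)"
  unfolding gaussian_exp_moment[OF beta_pos] real_choose_2
  by (simp add: field_simps power2_eq_square)

end

lemma networkI:
  assumes "random_layers M \<mu> p d n W \<xi>" "weight_distribution \<mu>" "0 < p" "p \<le> 1"
    "u \<in> carrier_vec (n 0)" "l2_norm u = 1"
  shows "network M \<mu> p d n W \<xi> u"
  using assms by (simp add: network_def random_network_def random_network_axioms_def network_axioms_def)

text \<open>Compactness of \<open>K\<close> provides a smallest \<open>p\<close>, which fixes the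
  layer bounds; closedness of \<open>B\<close> provides a neighbourhood of 0 free of \<beta>, which
  fixes the Lipschitz constant. Networks with \<open>inv_sq_sum d n > 1\<close> lie outside the
  smoothing argument, but there the claimed bound exceeds the trivial bound 1 on the
  distance.\<close>

lemma ks_dist_uniform:
  assumes \<mu>: "weight_distribution \<mu>" and K: "compact K" "K \<subseteq> {0<..1}" and B: "compact B" "0 \<notin> B"
  shows "\<exists>C. \<forall>p (M :: 'a measure) d n W \<xi> u.
     p \<in> K \<and> random_layers M \<mu> p d n W \<xi> \<and> u \<in> carrier_vec (n 0) \<and> l2_norm u = 1
       \<and> beta_param \<mu> p d n u \<in> B \<longrightarrow>
     ks_dist (distr M borel (\<lambda>\<omega>. ext_ln (scaled_sq_norm p d n W \<xi> u \<omega>)))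
         (distr (gaussian (- (1 / 2) * beta_param \<mu> p d n u) (beta_param \<mu> p d n u)) borel ereal)
       \<le> C * inv_sq_sum d n powr (1 / 5)"
proof (cases "K = {}")
  case False
  then obtain p0 where p0: "p0 \<in> K" "\<And>p. p \<in> K \<Longrightarrow> p0 \<le> p"
    using compact_attains_inf[OF K(1)] by auto
  have p01: "0 < p0" "p0 \<le> 1" using p0(1) K(2) by auto
  have "open (- B)" using B(1) by (simp add: compact_imp_closed open_Compl)
  then obtain b where b: "0 < b" "ball 0 b \<subseteq> - B" using B(2) open_contains_ball[of "- B"] by auto
  obtain C where C: "\<And>(M :: 'a measure) p d n W \<xi>. random_network M \<mu> p d n W \<xi> \<Longrightarrow> p0 \<le> p \<Longrightarrow>
      random_network.layer_bounds M p d n W \<xi> 20 C"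
    using ex_layer_bounds[OF p01, of "raw_moment \<mu>" 20] by blast
  define A where "A = (3 + \<bar>raw_moment \<mu> 4 - 3\<bar>) / p0"
  define Cst where "Cst = 4 * poly_gauss_const * (301 * C + 20 * A * C + A\<^sup>2) + 6 / sqrt b + 16 * C"
  \<comment> \<open>The constant is made at least 1 for the sake of the trivial case.\<close>
  have "ks_dist (distr M borel (\<lambda>\<omega>. ext_ln (scaled_sq_norm p d n W \<xi> u \<omega>)))
         (distr (gaussian (- (1 / 2) * beta_param \<mu> p d n u) (beta_param \<mu> p d n u)) borel ereal)
       \<le> (\<bar>Cst\<bar> + 1) * inv_sq_sum d n powr (1 / 5)"
    if H: "p \<in> K" "random_layers M \<mu> p d n W \<xi>" "u \<in> carrier_vec (n 0)" "l2_norm u = 1" "beta_param \<mu> p d n u \<in> B"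
    for p and M :: "'a measure" and d n W \<xi> u
  proof -
    have p: "0 < p" "p \<le> 1" "p0 \<le> p" using H(1) K(2) p0(2) by auto
    interpret network M \<mu> p d n W \<xi> u by (rule networkI) (use H \<mu> p in auto)
    have bounds: "layer_bounds 20 C" by (rule C[OF random_network_axioms p(3)])
    have bb: "b \<le> beta_param \<mu> p d n u"
    proof (rule ccontr)
      assume "\<not> b \<le> beta_param \<mu> p d n u"
      then have "beta_param \<mu> p d n u \<in> ball 0 b" using beta_pos by simp
      then show False using b(2) H(5) by auto
    qed
    have A: "var_const \<le> A" unfolding var_const_def A_def using p p01 by (intro divide_left_mono) auto
    have C0: "0 \<le> C" by (rule C_nonneg[OF bounds])
    have "phase_const C \<le> 301 * C + 20 * A * C + A\<^sup>2"
      unfolding phase_const_def using A C0 var_const_nonneg by (intro add_mono mult_right_mono power_mono) auto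
    then have "4 * poly_gauss_const * phase_const C \<le> 4 * poly_gauss_const * (301 * C + 20 * A * C + A\<^sup>2)"
      by (rule mult_left_mono) (use poly_gauss_const_nonneg in simp)
    then have "4 * poly_gauss_const * phase_const C + 6 / sqrt b + 16 * C \<le> Cst"
      unfolding Cst_def by (intro add_mono order_refl)
    then have le: "4 * poly_gauss_const * phase_const C + 6 / sqrt b + 16 * C \<le> \<bar>Cst\<bar> + 1"
      by simp
    show ?thesis
    proof (cases "inv_sq_sum d n \<le> 1")
      case True
      from ks_dist_bound[OF bounds order_refl True b(1) bb] mult_right_mono[OF le, of "inv_sq_sum d n powr (1 / 5)"]
      show ?thesis by simp
    next
      case False
      interpret G: real_distribution "gaussian (- (1 / 2) * beta_param \<mu> p d n u) (beta_param \<mu> p d n u)"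
        by (rule real_distribution_gaussian[OF beta_pos])
      have [measurable]: "(\<lambda>\<omega>. scaled_sq_norm p d n W \<xi> u \<omega>) \<in> borel_measurable M"
        unfolding scaled_sq_norm_eq by (rule measurable_adapted[OF adapted_energy]) simp
      have "ks_dist (distr M borel (\<lambda>\<omega>. ext_ln (scaled_sq_norm p d n W \<xi> u \<omega>)))
         (distr (gaussian (- (1 / 2) * beta_param \<mu> p d n u) (beta_param \<mu> p d n u)) borel ereal) \<le> 1"
        by (intro ks_dist_le_1 prob_space_distr G.prob_space_distr) measurable
      also have "1 \<le> inv_sq_sum d n powr (1 / 5)" using False by (intro ge_one_powr_ge_zero) auto
      also have "\<dots> \<le> (\<bar>Cst\<bar> + 1) * inv_sq_sum d n powr (1 / 5)"
        using mult_right_mono[of 1 "\<bar>Cst\<bar> + 1" "inv_sq_sum d n powr (1 / 5)"] by simp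
      finally show ?thesis .
    qed
  qed
  then show ?thesis by blast
qed simp

text \<open>The sequence \<open>m\<close> of moments is fixed before \<mu>, so the constant depends
  on \<mu> through its moments only, and on \<open>p\<close> and \<open>k\<close>.\<close>

lemma energy_moment_uniform:
  fixes m :: "nat \<Rightarrow> real" and k :: nat
  assumes p: "0 < p" "p \<le> 1"
  shows "\<exists>C. \<forall>\<mu> (M :: 'a measure) d n W \<xi> u.
      network M \<mu> p d n W \<xi> u \<and> raw_moment \<mu> = m \<longrightarrow>
      (\<exists>r. \<bar>r\<bar> \<le> C * inv_sq_sum d n \<and>
        network.energy_moment M p n W \<xi> u k d = exp (real (k choose 2) * beta_param \<mu> p d n u + r))"
proof -
  obtain C where C: "\<And>(M :: 'a measure) \<mu> d n W \<xi>. random_network M \<mu> p d n W \<xi> \<Longrightarrow> raw_moment \<mu> = m \<Longrightarrow>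
      random_network.layer_bounds M p d n W \<xi> (8 * k + 12) C"
    using ex_layer_bounds[OF p, of m "8 * k + 12"] by blast
  define A where "A = (3 + \<bar>m 4 - 3\<bar>) / p"
  define c where "c = real (k choose 2)"
  show ?thesis
  proof (rule exI[of _ "2 * (2 ^ k * C + c * (A * (C + 4 ^ k * (1 + C)))) + c\<^sup>2 * A\<^sup>2"], intro allI impI)
    fix \<mu> and M :: "'a measure" and d n W \<xi> u
    assume H: "network M \<mu> p d n W \<xi> u \<and> raw_moment \<mu> = m"
    then interpret network M \<mu> p d n W \<xi> u by blast
    have bounds: "layer_bounds (8 * k + 12) C" by (rule C[OF random_network_axioms]) (use H in simp)
    have "var_const = A" using H by (simp add: var_const_def A_def)
    with energy_moment_exp[OF bounds order_refl]
    show "\<exists>r. \<bar>r\<bar> \<le> (2 * (2 ^ k * C + c * (A * (C + 4 ^ k * (1 + C)))) + c\<^sup>2 * A\<^sup>2) * inv_sq_sum d n \<and>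
        network.energy_moment M p n W \<xi> u k d = exp (real (k choose 2) * beta_param \<mu> p d n u + r)"
      unfolding moment_const_def c_def by simp
  qed
qed

text \<open>Passing from a relative to an absolute error multiplies it by
  \<open>exp ((k choose 2) * \<beta>)\<close>; the bound \<open>b\<close> keeps this factor, and
  through \<open>inv_sq_sum_le\<close> also \<open>exp \<bar>r\<bar>\<close>, under control. The
  constant therefore depends on \<open>b\<close>.\<close>

lemma energy_moment_difference_uniform:
  fixes m :: "nat \<Rightarrow> real" and k :: nat and b :: real
  assumes p: "0 < p" "p \<le> 1"
  shows "\<exists>C. \<forall>\<mu> (M :: 'a measure) d n W \<xi> u.
      network M \<mu> p d n W \<xi> u \<and> raw_moment \<mu> = m \<and> beta_param \<mu> p d n u \<le> b \<longrightarrow>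
      (\<exists>r. \<bar>r\<bar> \<le> C * (inverse (beta_param \<mu> p d n u) * inv_sq_sum d n) \<and>
        network.energy_moment M p n W \<xi> u k d = exp (real (k choose 2) * beta_param \<mu> p d n u) + r)"
proof -
  define c where "c = real (k choose 2)"
  obtain C where C: "\<And>\<mu> (M :: 'a measure) d n W \<xi> u.
      network M \<mu> p d n W \<xi> u \<Longrightarrow> raw_moment \<mu> = m \<Longrightarrow>
      (\<exists>r. \<bar>r\<bar> \<le> C * inv_sq_sum d n \<and>
        network.energy_moment M p n W \<xi> u k d = exp (c * beta_param \<mu> p d n u + r))"
    using energy_moment_uniform[OF p, where k = k and m = m] unfolding c_def by blast
  define D where "D = exp (c * b) * (\<bar>C\<bar> * exp (\<bar>C\<bar> * (1 + b))) * b"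
  show ?thesis
  proof (rule exI[of _ D], intro allI impI)
    fix \<mu> and M :: "'a measure" and d n W \<xi> u
    assume H: "network M \<mu> p d n W \<xi> u \<and> raw_moment \<mu> = m \<and> beta_param \<mu> p d n u \<le> b"
    then interpret network M \<mu> p d n W \<xi> u by blast
    define \<beta> where "\<beta> = beta_param \<mu> p d n u"
    define S where "S = inv_sq_sum d n"
    obtain r where r: "\<bar>r\<bar> \<le> C * S" and eq: "energy_moment k d = exp (c * \<beta> + r)"
      using C[of M \<mu> d n W \<xi> u] H by (auto simp: S_def \<beta>_def)
    have \<beta>: "0 < \<beta>" "\<beta> \<le> b" using beta_pos H by (auto simp: \<beta>_def)
    have S: "0 \<le> S" "S \<le> 1 + b"
      using inv_sq_sum_nonneg inv_sq_sum_le \<beta> by (auto simp: S_def \<beta>_def)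
    have c: "0 \<le> c" by (simp add: c_def)
    have rS: "\<bar>r\<bar> \<le> \<bar>C\<bar> * S"
      using r mult_right_mono[OF abs_ge_self[of C] S(1)] by linarith
    have rb: "\<bar>r\<bar> \<le> \<bar>C\<bar> * (1 + b)"
      using rS mult_left_mono[OF S(2), of "\<bar>C\<bar>"] by simp
    have "exp (c * \<beta> + r) - exp (c * \<beta>) = exp (c * \<beta>) * (exp r - 1)"
      by (simp add: exp_add right_diff_distrib)
    then have "\<bar>exp (c * \<beta> + r) - exp (c * \<beta>)\<bar> = exp (c * \<beta>) * \<bar>exp r - 1\<bar>"
      by (simp add: abs_mult)
    also have "\<dots> \<le> exp (c * b) * ((\<bar>C\<bar> * S) * exp (\<bar>C\<bar> * (1 + b)))"
    proof (intro mult_mono)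
      show "exp (c * \<beta>) \<le> exp (c * b)" using \<beta> c by (simp add: mult_left_mono)
      have "\<bar>exp r - 1\<bar> \<le> \<bar>r\<bar> * exp \<bar>r\<bar>" by (rule abs_exp_minus_one_le)
      also have "\<dots> \<le> (\<bar>C\<bar> * S) * exp (\<bar>C\<bar> * (1 + b))"
        using rS rb S by (intro mult_mono) auto
      finally show "\<bar>exp r - 1\<bar> \<le> (\<bar>C\<bar> * S) * exp (\<bar>C\<bar> * (1 + b))" .
    qed auto
    also have "\<dots> = (exp (c * b) * (\<bar>C\<bar> * exp (\<bar>C\<bar> * (1 + b))) * S) * 1" by simp
    \<comment> \<open>The factor \<open>inverse \<beta>\<close> of the claim is created here from
      \<open>1 \<le> b / \<beta>\<close>.\<close>
    also have "\<dots> \<le> (exp (c * b) * (\<bar>C\<bar> * exp (\<bar>C\<bar> * (1 + b))) * S) * (b / \<beta>)"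
      using \<beta> S by (intro mult_left_mono) auto
    also have "\<dots> = D * (inverse \<beta> * S)" by (simp add: D_def divide_inverse)
    finally have "\<bar>exp (c * \<beta> + r) - exp (c * \<beta>)\<bar> \<le> D * (inverse \<beta> * S)" .
    then show "\<exists>r. \<bar>r\<bar> \<le> D * (inverse (beta_param \<mu> p d n u) * inv_sq_sum d n) \<and>
        network.energy_moment M p n W \<xi> u k d = exp (real (k choose 2) * beta_param \<mu> p d n u) + r"
      unfolding eq
      by (intro exI[of _ "exp (c * \<beta> + r) - exp (c * \<beta>)"]) (simp add: \<beta>_def S_def c_def)
  qed
qed

theorem theorem1:
  shows
  "(\<forall>\<mu> K B. weight_distribution \<mu> \<and> compact K \<and> K \<subseteq> {0<..1} \<and> compact B \<and> 0 \<notin> B \<longrightarrow>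
      (\<exists>C. \<forall>p (M :: 'a measure) d n W \<xi> u.
         p \<in> K \<and> random_layers M \<mu> p d n W \<xi> \<and> u \<in> carrier_vec (n 0) \<and> l2_norm u = 1
           \<and> beta_param \<mu> p d n u \<in> B \<longrightarrow>
         ks_dist (distr M borel (\<lambda>\<omega>. ext_ln (scaled_sq_norm p d n W \<xi> u \<omega>)))
             (distr (gaussian (- (1 / 2) * beta_param \<mu> p d n u) (beta_param \<mu> p d n u)) borel ereal)
           \<le> C * inv_sq_sum d n powr (1 / 5)))
   \<and>
   (\<forall>(p::real) (m :: nat \<Rightarrow> real) (k::nat). 0 < p \<and> p \<le> 1 \<longrightarrow>
      (\<exists>C. \<forall>\<mu> (M :: 'a measure) d n W \<xi> u.
         weight_distribution \<mu> \<and> raw_moment \<mu> = m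
           \<and> random_layers M \<mu> p d n W \<xi> \<and> u \<in> carrier_vec (n 0) \<and> l2_norm u = 1
           \<and> k choose 2 < Min (n ` {1..d}) \<longrightarrow>
         (\<exists>r. \<bar>r\<bar> \<le> C * inv_sq_sum d n \<and>
            (\<integral>\<omega>. real (n 0) ^ k / real (n d) ^ k
                * l2_norm (matrix_product p n W \<xi> d \<omega> *\<^sub>v u) ^ (2 * k) \<partial>M)
              = exp (real (k choose 2) * beta_param \<mu> p d n u + r)))
    \<and> (\<forall>b. \<exists>C. \<forall>\<mu> (M :: 'a measure) d n W \<xi> u.
         weight_distribution \<mu> \<and> raw_moment \<mu> = m
           \<and> random_layers M \<mu> p d n W \<xi> \<and> u \<in> carrier_vec (n 0) \<and> l2_norm u = 1
           \<and> k choose 2 < Min (n ` {1..d})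
           \<and> beta_param \<mu> p d n u \<le> b \<longrightarrow>
         (\<exists>r. \<bar>r\<bar> \<le> C * (inverse (beta_param \<mu> p d n u) * inv_sq_sum d n) \<and>
            (\<integral>\<omega>. real (n 0) ^ k / real (n d) ^ k
                * l2_norm (matrix_product p n W \<xi> d \<omega> *\<^sub>v u) ^ (2 * k) \<partial>M)
              = (\<integral>x. exp x ^ k \<partial>gaussian (- (1 / 2) * beta_param \<mu> p d n u) (beta_param \<mu> p d n u)) + r)))"
proof ((intro conjI allI impI; (elim conjE)?), goal_cases)
  case (1 \<mu> K B)
  then show ?case by (rule ks_dist_uniform)
next
  case (2 p m k)
  obtain C where C: "\<And>\<mu> (M :: 'a measure) d n W \<xi> u. network M \<mu> p d n W \<xi> u \<Longrightarrow> raw_moment \<mu> = m \<Longrightarrow>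
      \<exists>r. \<bar>r\<bar> \<le> C * inv_sq_sum d n \<and>
        network.energy_moment M p n W \<xi> u k d = exp (real (k choose 2) * beta_param \<mu> p d n u + r)"
    using energy_moment_uniform[OF 2, where k = k and m = m] by blast
  show ?case
  proof (rule exI[of _ C], intro allI impI, elim conjE, goal_cases)
    case (1 \<mu> M d n W \<xi> u)
    then interpret network M \<mu> p d n W \<xi> u by (intro networkI 2)
    show ?case unfolding moment_integral by (rule C[OF network_axioms]) fact
  qed
next
  case (3 p m k b)
  obtain C where C: "\<And>\<mu> (M :: 'a measure) d n W \<xi> u. network M \<mu> p d n W \<xi> u \<Longrightarrow> raw_moment \<mu> = m \<Longrightarrow>
      beta_param \<mu> p d n u \<le> b \<Longrightarrow> \<exists>r. \<bar>r\<bar> \<le> C * (inverse (beta_param \<mu> p d n u) * inv_sq_sum d n) \<and>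
        network.energy_moment M p n W \<xi> u k d = exp (real (k choose 2) * beta_param \<mu> p d n u) + r"
    using energy_moment_difference_uniform[OF 3, where k = k and m = m and b = b] by blast
  show ?case
  proof (rule exI[of _ C], intro allI impI, elim conjE, goal_cases)
    case (1 \<mu> M d n W \<xi> u)
    then interpret network M \<mu> p d n W \<xi> u by (intro networkI 3)
    show ?case unfolding moment_integral gaussian_moment by (rule C[OF network_axioms]) fact+
  qed
qed

end
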